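(* Let $\alpha\ge1$ and let $f_\alpha\colon S^1\to S^1$, $S^1=[0,1)$, be the intermittent map $$f_\alpha(x)=\begin{cases}x(1+2^\alpha x^\alpha)&x<1/2,\\2x-1&x\ge1/2,\end{cases}$$ with its $\sigma$-finite, infinite invariant measure $\mu$ absolutely continuous with respect to Lebesgue measure. Suppose $(B_n)$ is a decreasing sequence of balls, with $$\sum_{n\ge1}\mu(B_{n^{\alpha+\varepsilon_1}})=\infty$$ for some $\varepsilon_1\in(0,\alpha)$, and $0\notin\bigcap_n\overline{B}_n$. Then for $\mu$-almost every $x$, and for all $\varepsilon\in(0,\varepsilon_1]$, $$\sum_{k=1}^{n^{\frac1{\alpha+\varepsilon}}}\mu(B_{k^{\alpha+\varepsilon}})\le\sum_{k=1}^{n}1_{B_k}(f_\alpha^k(x))\le\sum_{k=1}^{n^{\frac1{\alpha-\varepsilon}}}\mu(B_{k^{\alpha-\varepsilon}})$$ holds eventually as $n\to\infty$.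
   Context: Non-integer indices and summation limits are replaced by their integer parts. $1_B$ is the indicator function of $B$, and $\overline{B}$ the closure of $B$. The balls $B_n$ are subsets of $S^1$.
   Formalization: Terms with μ(B_k)=∞ are counted as 0 in the divergence hypothesis and in both sums; literally, if μ(B_1)=∞ (e.g. B_1=S^1) the lower bound would read ∞ ≤ a finite count and fail. If μ(B_1) is finite nothing changes. *)

theory Defs
  imports "HOL-Analysis.Analysis"
begin

definition circle :: "real set" where
  "circle = {0..<1}"

text \<open>The arc-length metric on the circle: the smaller of the lengths of the two arcs joining
  \<open>x\<close> and \<open>y\<close>. In particular points close to \<open>1\<close> are close to \<open>0\<close>.\<close>

definition circle_dist :: "real \<Rightarrow> real \<Rightarrow> real" where
  "circle_dist x y = min (frac (x - y)) (frac (y - x))"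

lemma circle_dist_altdef:
  assumes "x \<in> circle" "y \<in> circle"
  shows "circle_dist x y = min \<bar>x - y\<bar> (1 - \<bar>x - y\<bar>)"
proof -
  have *: "frac t = (if t < 0 then t + 1 else t)" if "-1 < t" "t < 1" for t :: real
    using that frac_unique_iff[of t t] frac_unique_iff[of t "t + 1"] by auto
  have "-1 < x - y" "x - y < 1" "-1 < y - x" "y - x < 1"
    using assms by (auto simp: circle_def)
  then show ?thesis
    unfolding circle_dist_def by (auto simp: * min_def)
qed

interpretation circle: Metric_space circle circle_dist
proof
  show "0 \<le> circle_dist x y" for x y
    by (simp add: circle_dist_def)
  show "circle_dist x y = circle_dist y x" for x y
    by (simp add: circle_dist_def min.commute)
  show "circle_dist x y = 0 \<longleftrightarrow> x = y" if "x \<in> circle" "y \<in> circle" for x y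
    using that unfolding circle_dist_altdef[OF that] by (auto simp: circle_def min_def)
  show "circle_dist x z \<le> circle_dist x y + circle_dist y z"
    if "x \<in> circle" "y \<in> circle" "z \<in> circle" for x y z
    using that by (simp add: circle_dist_altdef) (auto simp: circle_def min_def abs_if)
qed

text \<open>Balls may be open or closed; the radius is positive.\<close>

definition circle_ball :: "real set \<Rightarrow> bool" where
  "circle_ball A \<longleftrightarrow>
     (\<exists>c\<in>circle. \<exists>r>0. A = circle.mball c r \<or> A = circle.mcball c r)"

definition intermittent_map :: "real \<Rightarrow> real \<Rightarrow> real" where
  "intermittent_map \<alpha> x =
     (if x < 1/2 then x * (1 + 2 powr \<alpha> * x powr \<alpha>) else 2 * x - 1)"

text \<open>An infinite, \<open>\<sigma>\<close>-finite measure on the Borel sets of the circle that is invariant under \<open>T\<close>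
  and absolutely continuous with respect to Lebesgue measure. For the intermittent maps such a
  measure is determined only up to a positive constant factor; no normalisation is imposed.\<close>

definition infinite_acim :: "(real \<Rightarrow> real) \<Rightarrow> real measure \<Rightarrow> bool" where
  "infinite_acim T \<mu> \<longleftrightarrow>
     sets \<mu> = sets (restrict_space borel circle) \<and>
     sigma_finite_measure \<mu> \<and>
     emeasure \<mu> (space \<mu>) = \<infinity> \<and>
     T \<in> measurable \<mu> \<mu> \<and>
     (\<forall>A\<in>sets \<mu>. emeasure \<mu> (T -` A \<inter> space \<mu>) = emeasure \<mu> A) \<and>
     absolutely_continuous (restrict_space lborel circle) \<mu>"

text \<open>Integer part of a nonnegative real power, used for indices and summation limits.\<close>

definition ipow :: "nat \<Rightarrow> real \<Rightarrow> nat" where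
  "ipow n s = nat \<lfloor>real n powr s\<rfloor>"

text \<open>A ball with \<open>0\<close> in its closure can have infinite measure, although at most finitely many
  \<open>B n\<close> in the statement do. With \<open>\<mu> (B 1) = \<infinity>\<close> the lower bound in the conclusion would be \<open>\<infinity>\<close>,
  so the sums are taken with the real-valued \<open>measure\<close>: a term of infinite measure contributes \<open>0\<close>,
  both in the divergence hypothesis and in the conclusion.\<close>

end

theory Submission
  imports Defs "HOL-Real_Asymp.Real_Asymp"
begin

text \<open>The point \<open>0\<close> is a neutral fixed point, so an orbit spends long stretches near \<open>0\<close> between
visits to the right half \<open>[1/2, 1)\<close>. Let \<open>entry x\<close> be the first time at which the orbit of \<open>x\<close> is in
\<open>[1/2, 1)\<close>, and let \<open>H x\<close> be the point reached one step later. The jump transformation \<open>H\<close> has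
countably many branches, each of them mapping onto the whole interval, and
\<open>(f ^^ \<tau> n x) x = (H ^^ n) x\<close> for the sum \<open>\<tau> n x\<close> of the first \<open>n\<close> jump lengths.

Three facts explain the two estimates. First, an entrance time exceeds \<open>M\<close> with Lebesgue
probability of order \<open>M powr (-1/\<alpha>)\<close>, so \<open>\<tau> n x\<close> lies between \<open>n powr (\<alpha> - \<epsilon>)\<close> and
\<open>n powr (\<alpha> + \<epsilon>)\<close> eventually, for every \<open>\<epsilon> > 0\<close>: this is where the exponents come from
(\<open>AE_tau_lower\<close>, \<open>AE_tau_upper\<close>). Secondly, successive jumps are independent up to a constant
factor (\<open>quasi_independence\<close>), so that visits of \<open>H\<close> to a shrinking interval can be counted by
Borel-Cantelli arguments, again up to constant factors (\<open>AE_visits_upper\<close>, \<open>AE_visits_lower\<close>).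
Thirdly, constant factors do not matter: for a decreasing sequence \<open>b\<close>, the sum of
\<open>b (k powr s)\<close> over \<open>k \<le> n powr (1/s)\<close> gains an arbitrarily large factor when \<open>s\<close> is decreased,
up to an additive constant (\<open>powsum_ratio\<close>). Since the sums diverge, exponents arbitrarily close to
the wanted ones and estimates with unspecified constants are enough; this also absorbs the free
normalisation of \<open>\<mu>\<close>, and it reduces the statement for all real \<open>\<epsilon>\<close> to countably many exponents.

Independence up to constants rests on a cone of densities \<open>h\<close>, those for which \<open>h\<close> decreases and
\<open>x powr (\<alpha> + 1) * h x\<close> increases. Each of the two branches of \<open>f\<close> preserves it separately, and
the right branch only sees \<open>h\<close> on \<open>[1/2, 1)\<close>, where members of the cone vary by a factor of at most
\<open>2 powr (\<alpha> + 1)\<close>. This bounds the distortion of all branches of all iterates of \<open>H\<close> at once.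

Of \<open>\<mu>\<close> only the defining properties are known. The part of \<open>\<mu>\<close> on \<open>[1/2, 1)\<close>, pushed forward by
\<open>f\<close>, is a measure \<open>\<eta>\<close> that cannot increase under \<open>H\<close>, because distinct excursions contribute
disjointly to \<open>\<mu>\<close> (\<open>kac_visits\<close>). Approximating its density by functions of finitely many jumps
and using quasi-independence shows that \<open>\<eta>\<close> is finite and comparable to Lebesgue measure, and
hence that \<open>\<mu>\<close> is dominated by Lebesgue measure away from \<open>0\<close>. The hypothesis on closures is needed
here: it keeps all late balls away from \<open>0\<close>.\<close>

section \<open>Real inequalities and Lebesgue measure on the unit interval\<close>

lemma has_field_derivative_abs_real:
  fixes y :: real
  assumes "y \<noteq> 0"
  shows "(abs has_field_derivative sgn y) (at y)"
proof (cases "y > 0")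
  case True
  have "((\<lambda>x. x) has_field_derivative sgn y) (at y)" using True by simp
  then show ?thesis
    by (rule has_field_derivative_transform_within_open[where S = "{0<..}"]) (use True in auto)
next
  case False
  have "((\<lambda>x. - x) has_field_derivative - 1) (at y)"
    by (rule DERIV_minus[OF DERIV_ident])
  then have "((\<lambda>x. - x) has_field_derivative sgn y) (at y)" using False assms by simp
  then show ?thesis
    by (rule has_field_derivative_transform_within_open[where S = "{..<0}"])
       (use False assms in auto)
qed

lemma one_add_powr_ge:
  fixes r x :: real
  assumes "1 \<le> r" "0 \<le> x"
  shows "1 + r * x \<le> (1 + x) powr r"
proof -
  define F where "F = (\<lambda>x. (1 + x) powr r - r * x)"
  have "F 0 \<le> F x"
  proof (rule DERIV_nonneg_imp_nondecreasing[OF assms(2)])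
    fix y :: real assume y: "0 \<le> y" "y \<le> x"
    have "(F has_real_derivative r * (1 + y) powr (r - 1) - r) (at y)"
      unfolding F_def using y by (auto intro!: derivative_eq_intros)
    moreover have "1 \<le> (1 + y) powr (r - 1)"
      using y assms by (intro ge_one_powr_ge_zero) auto
    then have "r * 1 \<le> r * (1 + y) powr (r - 1)"
      using assms by (intro mult_left_mono) auto
    ultimately show "\<exists>d. (F has_real_derivative d) (at y) \<and> 0 \<le> d"
      by (intro exI conjI) auto
  qed
  then show ?thesis by (simp add: F_def)
qed

lemma one_add_powr_minus_ge:
  fixes r x :: real
  assumes "0 \<le> r" "0 \<le> x"
  shows "1 - r * x \<le> (1 + x) powr (- r)"
proof -
  have "1 - r * x \<le> 1 + (- r * ln (1 + x))"
    using mult_left_mono[OF ln_add_one_self_le_self[OF assms(2)] assms(1)] by simp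
  also have "\<dots> \<le> exp (- r * ln (1 + x))" by (rule exp_ge_add_one_self)
  finally show ?thesis using assms by (simp add: powr_def)
qed

text \<open>The reference probability. The open interval is used because \<open>0\<close> never enters the right half;
the underlying space is all of \<open>\<real>\<close>, so that measurability always refers to \<open>borel\<close>.\<close>

definition unif :: "real measure" where
  "unif = density lborel (indicator {0<..<1})"

lemma sets_unif [measurable_cong, simp]: "sets unif = sets borel"
  by (simp add: unif_def)

lemma space_unif [simp]: "space unif = UNIV"
  by (simp add: unif_def)

lemma nn_integral_unif:
  assumes [measurable]: "u \<in> borel_measurable borel"
  shows "(\<integral>\<^sup>+x. u x \<partial>unif) = (\<integral>\<^sup>+x. u x * indicator {0<..<1} x \<partial>lborel)"
  by (simp add: unif_def nn_integral_density mult.commute)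

lemma emeasure_unif:
  assumes [measurable]: "A \<in> sets borel"
  shows "emeasure unif A = emeasure lborel (A \<inter> {0<..<1})"
proof -
  have "emeasure unif A = (\<integral>\<^sup>+x. indicator {0<..<1} x * indicator A x \<partial>lborel)"
    unfolding unif_def by (rule emeasure_density) auto
  also have "\<dots> = (\<integral>\<^sup>+x. indicator (A \<inter> {0<..<1}) x \<partial>lborel)"
    by (intro nn_integral_cong) (auto split: split_indicator)
  also have "\<dots> = emeasure lborel (A \<inter> {0<..<1})"
    by (rule nn_integral_indicator) auto
  finally show ?thesis .
qed

lemma emeasure_unif_UNIV [simp]: "emeasure unif UNIV = 1"
  by (simp add: emeasure_unif)

lemma emeasure_unif_le_1: "emeasure unif A \<le> 1"
  using emeasure_space[of unif A] by (simp add: emeasure_unif_UNIV)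

interpretation unif: finite_measure unif
  by standard (simp add: emeasure_unif_UNIV)

section \<open>The branches of the map\<close>

locale intermittent =
  fixes \<alpha> :: real
  assumes alpha: "1 \<le> \<alpha>"
begin

abbreviation f :: "real \<Rightarrow> real" where "f \<equiv> intermittent_map \<alpha>"

text \<open>The distortion constant: densities in the cone below vary by at most this factor on
\<open>[1/2, 1)\<close>.\<close>

definition D :: real where "D = 2 powr (\<alpha> + 1)"

text \<open>The left branch, extended to an odd increasing bijection of \<open>\<real>\<close>. The absolute value makes the
extension differentiable at \<open>0\<close> as well, and its inverse monotone on all of \<open>\<real>\<close>, hence Borel.\<close>

definition \<phi> :: "real \<Rightarrow> real" where
  "\<phi> y = y * (1 + 2 powr \<alpha> * \<bar>y\<bar> powr \<alpha>)"

definition \<phi>' :: "real \<Rightarrow> real" where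
  "\<phi>' y = 1 + (\<alpha> + 1) * (2 powr \<alpha> * \<bar>y\<bar> powr \<alpha>)"

lemma phi'_ge_1: "1 \<le> \<phi>' y"
  using alpha by (simp add: \<phi>'_def)

lemma continuous_on_phi': "continuous_on A \<phi>'"
  unfolding \<phi>'_def using alpha
  by (intro continuous_intros continuous_on_powr') auto

lemma has_field_derivative_phi: "(\<phi> has_field_derivative \<phi>' y) (at y)"
proof (cases "y = 0")
  case True
  have "isCont (\<lambda>y. 1 + 2 powr \<alpha> * \<bar>y\<bar> powr \<alpha>) 0"
  proof -
    have "continuous_on UNIV (\<lambda>y. 1 + 2 powr \<alpha> * \<bar>y\<bar> powr \<alpha>)"
      using alpha by (intro continuous_intros continuous_on_powr') auto
    then show ?thesis by (simp add: continuous_on_eq_continuous_at)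
  qed
  then have "(\<phi> has_field_derivative 1) (at 0)"
    unfolding CARAT_DERIV
    by (intro exI[of _ "\<lambda>y. 1 + 2 powr \<alpha> * \<bar>y\<bar> powr \<alpha>"]) (use alpha in \<open>auto simp: \<phi>_def\<close>)
  then show ?thesis using True alpha by (simp add: \<phi>'_def)
next
  case False
  have e: "\<bar>y\<bar> powr \<alpha> = \<bar>y\<bar> * \<bar>y\<bar> powr (\<alpha> - 1)"
    using False by (simp add: powr_diff)
  have "(\<phi> has_field_derivative
      (1 + 2 powr \<alpha> * \<bar>y\<bar> powr \<alpha>) + y * (2 powr \<alpha> * (\<alpha> * \<bar>y\<bar> powr (\<alpha> - 1) * sgn y))) (at y)"
    unfolding \<phi>_def using False
    by (auto intro!: derivative_eq_intros has_field_derivative_abs_real simp: algebra_simps)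
  moreover have "y * (2 powr \<alpha> * (\<alpha> * \<bar>y\<bar> powr (\<alpha> - 1) * sgn y)) = \<alpha> * (2 powr \<alpha> * \<bar>y\<bar> powr \<alpha>)"
    unfolding e by (simp add: abs_sgn mult_ac)
  then have "(1 + 2 powr \<alpha> * \<bar>y\<bar> powr \<alpha>) + y * (2 powr \<alpha> * (\<alpha> * \<bar>y\<bar> powr (\<alpha> - 1) * sgn y)) = \<phi>' y"
    unfolding \<phi>'_def by (simp only:) (simp add: algebra_simps)
  ultimately show ?thesis by (simp only:)
qed

lemma strict_mono_phi: "strict_mono \<phi>"
proof (rule strict_monoI)
  fix x y :: real assume "x < y"
  then show "\<phi> x < \<phi> y"
    by (rule DERIV_pos_imp_increasing)
      (metis has_field_derivative_phi phi'_ge_1 less_le_trans zero_less_one)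
qed

lemma continuous_on_phi: "continuous_on A \<phi>"
  by (meson has_field_derivative_phi DERIV_isCont continuous_at_imp_continuous_on)

lemma phi_ge: "0 \<le> y \<Longrightarrow> y \<le> \<phi> y"
  by (simp add: \<phi>_def algebra_simps)

lemma phi_0 [simp]: "\<phi> 0 = 0"
  by (simp add: \<phi>_def)

lemma phi_minus: "\<phi> (- y) = - \<phi> y"
  by (simp add: \<phi>_def)

lemma phi_half [simp]: "\<phi> (1/2) = 1"
  by (simp add: \<phi>_def powr_divide)

lemma bij_phi: "bij \<phi>"
proof -
  have pos: "\<exists>y. \<phi> y = x" if "0 \<le> x" for x
    using IVT'[of \<phi> 0 x x] that phi_ge[of x] continuous_on_phi by auto
  have "\<exists>y. \<phi> y = x" for x
    using pos[of x] pos[of "- x"] phi_minus by (metis minus_minus le_cases neg_0_le_iff_le)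
  then have "surj \<phi>" by (metis surjI)
  then show ?thesis
    using strict_mono_phi by (simp add: bij_def strict_mono_imp_inj_on)
qed

definition g :: "real \<Rightarrow> real" where "g = inv \<phi>"

lemma phi_g [simp]: "\<phi> (g x) = x"
  unfolding g_def using bij_phi by (simp add: bij_def surj_f_inv_f)

lemma g_phi [simp]: "g (\<phi> x) = x"
  unfolding g_def using bij_phi by (simp add: bij_def)

lemma g_less_iff: "g x < y \<longleftrightarrow> x < \<phi> y"
  by (metis phi_g strict_mono_less[OF strict_mono_phi])

lemma less_g_iff: "y < g x \<longleftrightarrow> \<phi> y < x"
  by (metis phi_g strict_mono_less[OF strict_mono_phi])

lemma mono_g: "x \<le> y \<Longrightarrow> g x \<le> g y"
  by (metis phi_g strict_mono_less_eq[OF strict_mono_phi])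

lemma g_pos: "0 < x \<Longrightarrow> 0 < g x"
  by (simp add: less_g_iff)

lemma g_less_half: "x < 1 \<Longrightarrow> g x < 1/2"
  by (simp only: g_less_iff phi_half)

lemma borel_measurable_g [measurable]: "g \<in> borel_measurable borel"
  by (rule borel_measurable_mono) (simp add: mono_def mono_g)

lemma borel_measurable_phi' [measurable]: "\<phi>' \<in> borel_measurable borel"
  by (rule borel_measurable_continuous_onI) (rule continuous_on_phi')

lemma f_left: "0 \<le> x \<Longrightarrow> x < 1/2 \<Longrightarrow> f x = \<phi> x"
  by (simp add: intermittent_map_def \<phi>_def)

lemma f_right: "1/2 \<le> x \<Longrightarrow> f x = 2 * x - 1"
  by (simp add: intermittent_map_def)

lemma borel_measurable_f [measurable]: "f \<in> borel_measurable borel"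
  unfolding intermittent_map_def by measurable

text \<open>The transfer operator of the left branch. The substitution rule gives the equality of the two
measures on Borel sets; integrals of arbitrary \<open>u\<close> follow because both sides are integrals of \<open>u\<close>
against these measures.\<close>

lemma nn_integral_left:
  assumes [measurable]: "h \<in> borel_measurable borel" "u \<in> borel_measurable borel"
    and nonneg: "\<And>x. 0 \<le> h x"
  shows "(\<integral>\<^sup>+x. ennreal (h x) * u (f x) * indicator {0<..<1/2} x \<partial>lborel) =
    (\<integral>\<^sup>+x. ennreal (h (g x) / \<phi>' (g x)) * u x * indicator {0<..<1} x \<partial>lborel)"
proof -
  let ?L = "distr (density lborel (\<lambda>x. ennreal (h x) * indicator {0<..<1/2} x)) borel f"
  let ?R = "density lborel (\<lambda>x. ennreal (h (g x) / \<phi>' (g x)) * indicator {0<..<1} x)"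
  have "?L = ?R"
  proof (rule measure_eqI)
    fix A assume "A \<in> sets ?L"
    then have [measurable]: "A \<in> sets borel" by simp
    define F where "F = (\<lambda>x. h (g x) / \<phi>' (g x) * indicator A x)"
    have [measurable]: "F \<in> borel_measurable borel" unfolding F_def by measurable
    have "emeasure ?R A = (\<integral>\<^sup>+x. ennreal (F x) * indicator {0<..<1} x \<partial>lborel)"
      by (auto simp: emeasure_density F_def intro!: nn_integral_cong split: split_indicator)
    also have "\<dots> = (\<integral>\<^sup>+x. ennreal (F x * indicator {\<phi> 0..\<phi> (1/2)} x) \<partial>lborel)"
    proof (rule nn_integral_cong_AE)
      show "AE x in lborel. ennreal (F x) * indicator {0<..<1} x =
          ennreal (F x * indicator {\<phi> 0..\<phi> (1/2)} x)"
        using AE_lborel_singleton[of 0] AE_lborel_singleton[of 1]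
        by eventually_elim (auto split: split_indicator)
    qed
    also have "\<dots> = (\<integral>\<^sup>+x. ennreal (F (\<phi> x) * \<phi>' x * indicator {0..1/2} x) \<partial>lborel)"
    proof (rule nn_integral_substitution)
      show "set_borel_measurable borel {\<phi> 0..\<phi> (1 / 2)} F"
        unfolding set_borel_measurable_def by measurable
      show "0 \<le> \<phi>' x" for x using phi'_ge_1[of x] by simp
    qed (simp_all add: has_field_derivative_phi continuous_on_phi')
    also have "\<dots> = (\<integral>\<^sup>+x. ennreal (h x) * indicator {0<..<1/2} x * indicator A (f x) \<partial>lborel)"
    proof (rule nn_integral_cong_AE)
      have ne: "\<phi>' x \<noteq> 0" for x using phi'_ge_1[of x] by simp
      show "AE x in lborel. ennreal (F (\<phi> x) * \<phi>' x * indicator {0..1/2} x) =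
          ennreal (h x) * indicator {0<..<1/2} x * indicator A (f x)"
        using AE_lborel_singleton[of 0] AE_lborel_singleton[of "1/2"]
        by eventually_elim (auto split: split_indicator simp: f_left F_def ne)
    qed
    also have "\<dots> = emeasure ?L A"
    proof -
      have [measurable]: "f -` A \<in> sets borel"
        using measurable_sets_borel[OF borel_measurable_f, of A] by simp
      show ?thesis
        by (auto simp: emeasure_distr emeasure_density intro!: nn_integral_cong split: split_indicator)
    qed
    finally show "emeasure ?L A = emeasure ?R A" by simp
  qed (simp only: sets_distr sets_density sets_lborel)
  then have "(\<integral>\<^sup>+x. u x \<partial>?L) = (\<integral>\<^sup>+x. u x \<partial>?R)" by (rule arg_cong)
  then show ?thesis
    by (simp add: nn_integral_distr nn_integral_density mult_ac)
qed

lemma nn_integral_right: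
  assumes [measurable]: "h \<in> borel_measurable borel" "u \<in> borel_measurable borel"
    and nonneg: "\<And>x. 0 \<le> h x"
  shows "(\<integral>\<^sup>+x. ennreal (h x) * u (f x) * indicator {1/2<..<1} x \<partial>lborel) =
    (\<integral>\<^sup>+x. ennreal (h ((x + 1) / 2) / 2) * u x * indicator {0<..<1} x \<partial>lborel)"
proof -
  have "(\<integral>\<^sup>+x. ennreal (h x) * u (f x) * indicator {1/2<..<1} x \<partial>lborel) =
      ennreal \<bar>1/2\<bar> * (\<integral>\<^sup>+x. ennreal (h (1/2 + 1/2 * x)) * u (f (1/2 + 1/2 * x)) *
        indicator {1/2<..<1} (1/2 + 1/2 * x) \<partial>lborel)"
    by (rule nn_integral_real_affine) auto
  also have "\<dots> = (\<integral>\<^sup>+x. ennreal (1/2) * (ennreal (h (1/2 + 1/2 * x)) * u (f (1/2 + 1/2 * x)) *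
        indicator {1/2<..<1} (1/2 + 1/2 * x)) \<partial>lborel)"
    by (subst nn_integral_cmult) auto
  also have "\<dots> = (\<integral>\<^sup>+x. ennreal (h ((x + 1) / 2) / 2) * u x * indicator {0<..<1} x \<partial>lborel)"
  proof (rule nn_integral_cong)
    fix x :: real
    have "ennreal (1/2) * ennreal (h ((x + 1) / 2)) = ennreal (h ((x + 1) / 2) / 2)"
      using nonneg by (subst ennreal_mult'[symmetric]) auto
    moreover have e: "1/2 + 1/2 * x = (x + 1) / 2" by (simp add: field_simps)
    moreover have "f ((x + 1) / 2) = x" if "0 < x"
      using that by (simp add: f_right field_simps)
    moreover have "(x + 1) / 2 \<in> {1/2<..<1} \<longleftrightarrow> x \<in> {0<..<1}" by auto
    ultimately show "ennreal (1/2) * (ennreal (h (1/2 + 1/2 * x)) * u (f (1/2 + 1/2 * x)) *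
        indicator {1/2<..<1} (1/2 + 1/2 * x)) =
        ennreal (h ((x + 1) / 2) / 2) * u x * indicator {0<..<1} x"
      unfolding e by (auto simp: indicator_def simp flip: mult.assoc)
  qed
  finally show ?thesis .
qed

section \<open>A cone of densities with bounded distortion\<close>

definition cone :: "(real \<Rightarrow> real) \<Rightarrow> bool" where
  "cone h \<longleftrightarrow> h \<in> borel_measurable borel \<and> (\<forall>x. 0 \<le> h x) \<and>
     (\<forall>x y. 0 < x \<longrightarrow> x \<le> y \<longrightarrow> y < 1 \<longrightarrow>
        h y \<le> h x \<and> x powr (\<alpha> + 1) * h x \<le> y powr (\<alpha> + 1) * h y)"

text \<open>Densities of images under a full jump. Unlike those of the cone, they cannot blow up at \<open>0\<close>.\<close>

definition flat :: "(real \<Rightarrow> real) \<Rightarrow> bool" where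
  "flat h \<longleftrightarrow> cone h \<and> (\<forall>x y. 0 < x \<longrightarrow> x < 1 \<longrightarrow> 0 < y \<longrightarrow> y < 1 \<longrightarrow> h x \<le> D * h y)"

lemma D_ge_1: "1 \<le> D"
  using alpha by (simp add: D_def ge_one_powr_ge_zero)

lemma flat_1: "flat (\<lambda>_. 1)"
  using D_ge_1 alpha by (auto simp: flat_def cone_def intro!: powr_mono2)

text \<open>Decrease is preserved since \<open>\<phi>\<close> is convex. For the other condition write \<open>x = p * (1 + s)\<close>
with \<open>p = g x\<close> and \<open>s = (2 * p) powr \<alpha>\<close>; the new density times \<open>x powr (\<alpha> + 1)\<close> is the old one
times \<open>p powr (\<alpha> + 1)\<close>, multiplied by \<open>(1 + s) powr (\<alpha> + 1) / (1 + (\<alpha> + 1) * s)\<close>. This last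
factor increases with \<open>s\<close>, by Bernoulli's inequality.\<close>

lemma cone_left:
  assumes "cone h"
  shows "cone (\<lambda>x. h (g x) / \<phi>' (g x))"
  unfolding cone_def
proof (intro conjI allI impI)
  have [measurable]: "h \<in> borel_measurable borel" using assms by (simp add: cone_def)
  show "(\<lambda>x. h (g x) / \<phi>' (g x)) \<in> borel_measurable borel" by measurable
  show "0 \<le> h (g x) / \<phi>' (g x)" for x
    using assms phi'_ge_1[of "g x"] by (simp add: cone_def)
  fix x y :: real assume xy: "0 < x" "x \<le> y" "y < 1"
  define p q where "p = g x" and "q = g y"
  have pq: "0 < p" "p \<le> q" "q < 1"
    using xy g_pos[of x] g_less_half[of y] by (auto simp: p_def q_def mono_g)
  have xp: "x = \<phi> p" "y = \<phi> q" by (simp_all add: p_def q_def)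
  define s t where "s = 2 powr \<alpha> * p powr \<alpha>" and "t = 2 powr \<alpha> * q powr \<alpha>"
  have st: "0 \<le> s" "s \<le> t" using pq alpha by (auto simp: s_def t_def intro!: mult_left_mono powr_mono2)
  have phi': "\<phi>' p = 1 + (\<alpha> + 1) * s" "\<phi>' q = 1 + (\<alpha> + 1) * t"
    using pq by (auto simp: \<phi>'_def s_def t_def)
  have hpq: "h q \<le> h p" "p powr (\<alpha> + 1) * h p \<le> q powr (\<alpha> + 1) * h q" "0 \<le> h p" "0 \<le> h q"
    using assms pq by (auto simp: cone_def)
  show "h q / \<phi>' q \<le> h p / \<phi>' p"
  proof (rule frac_le)
    show "0 < \<phi>' p" using phi'_ge_1[of p] by linarith
    show "\<phi>' p \<le> \<phi>' q" unfolding phi' using st alpha by (intro add_left_mono mult_left_mono) auto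
  qed (use hpq in auto)
  have "(1 + (\<alpha> + 1) * t) / (1 + (\<alpha> + 1) * s) \<le> 1 + (\<alpha> + 1) * ((t - s) / (1 + s))"
  proof -
    have "(1 + (\<alpha> + 1) * t) / (1 + (\<alpha> + 1) * s) = 1 + (\<alpha> + 1) * ((t - s) / (1 + (\<alpha> + 1) * s))"
    proof -
      have "1 + (\<alpha> + 1) * s \<noteq> 0" using phi'_ge_1[of p] unfolding phi' by linarith
      moreover have "b / c = 1 + (b - c) / c" if "c \<noteq> 0" for b c :: real
        using that by (simp add: field_simps)
      ultimately have "(1 + (\<alpha> + 1) * t) / (1 + (\<alpha> + 1) * s) =
          1 + ((1 + (\<alpha> + 1) * t) - (1 + (\<alpha> + 1) * s)) / (1 + (\<alpha> + 1) * s)" by blast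
      also have "(1 + (\<alpha> + 1) * t) - (1 + (\<alpha> + 1) * s) = (\<alpha> + 1) * (t - s)"
        by (simp add: algebra_simps)
      finally show ?thesis by simp
    qed
    also have "\<dots> \<le> 1 + (\<alpha> + 1) * ((t - s) / (1 + s))"
    proof -
      have "0 < 1 + (\<alpha> + 1) * s"
        using phi'_ge_1[of p] unfolding phi' by linarith
      moreover have "1 * s \<le> (\<alpha> + 1) * s"
        using st alpha by (intro mult_right_mono) auto
      ultimately have "0 < 1 + (\<alpha> + 1) * s" "s \<le> (\<alpha> + 1) * s" by simp_all
      then show ?thesis using st alpha
        by (intro add_left_mono mult_left_mono divide_left_mono) (auto intro!: mult_pos_pos)
    qed
    finally show ?thesis .
  qed
  also have "\<dots> \<le> (1 + (t - s) / (1 + s)) powr (\<alpha> + 1)"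
    using st alpha by (intro one_add_powr_ge) auto
  also have "1 + (t - s) / (1 + s) = (1 + t) / (1 + s)"
    using st by (simp add: field_simps)
  also have "\<dots> powr (\<alpha> + 1) = (1 + t) powr (\<alpha> + 1) / (1 + s) powr (\<alpha> + 1)"
    using st by (simp add: powr_divide)
  finally have "(1 + s) powr (\<alpha> + 1) / \<phi>' p \<le> (1 + t) powr (\<alpha> + 1) / \<phi>' q"
    using phi'_ge_1[of p] phi'_ge_1[of q] st unfolding phi' by (simp add: field_simps)
  then have "(p powr (\<alpha> + 1) * h p) * ((1 + s) powr (\<alpha> + 1) / \<phi>' p)
      \<le> (q powr (\<alpha> + 1) * h q) * ((1 + t) powr (\<alpha> + 1) / \<phi>' q)"
    using hpq phi'_ge_1[of p] by (intro mult_mono[OF hpq(2)]) auto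
  moreover have "x powr (\<alpha> + 1) = p powr (\<alpha> + 1) * (1 + s) powr (\<alpha> + 1)"
    "y powr (\<alpha> + 1) = q powr (\<alpha> + 1) * (1 + t) powr (\<alpha> + 1)"
    using pq st by (auto simp: xp \<phi>_def s_def t_def powr_mult)
  ultimately show "x powr (\<alpha> + 1) * (h p / \<phi>' p) \<le> y powr (\<alpha> + 1) * (h q / \<phi>' q)"
    by (simp add: mult_ac)
qed

text \<open>The image density at \<open>x\<close> is half the old density at \<open>(x + 1) / 2\<close>, a point of \<open>[1/2, 1)\<close>. On that
interval the two monotonicity conditions of the cone control the density from both sides, which
gives flatness.\<close>

lemma flat_right:
  assumes "cone h"
  shows "flat (\<lambda>x. h ((x + 1) / 2) / 2)"
  unfolding flat_def cone_def
proof (intro conjI allI impI)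
  have [measurable]: "h \<in> borel_measurable borel" using assms by (simp add: cone_def)
  show "(\<lambda>x. h ((x + 1) / 2) / 2) \<in> borel_measurable borel" by measurable
  show "0 \<le> h ((x + 1) / 2) / 2" for x
    using assms by (simp add: cone_def)
  have h: "h q \<le> h p" "p powr (\<alpha> + 1) * h p \<le> q powr (\<alpha> + 1) * h q" "0 \<le> h p" "0 \<le> h q"
    if "0 < p" "p \<le> q" "q < 1" for p q using assms that by (auto simp: cone_def)
  show "h ((y + 1) / 2) / 2 \<le> h ((x + 1) / 2) / 2" if "0 < x" "x \<le> y" "y < 1" for x y
    using h[of "(x+1)/2" "(y+1)/2"] that by simp
  show "x powr (\<alpha> + 1) * (h ((x + 1) / 2) / 2) \<le> y powr (\<alpha> + 1) * (h ((y + 1) / 2) / 2)"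
    if xy: "0 < x" "x \<le> y" "y < 1" for x y
  proof -
    define p q where "p = (x+1)/2" and "q = (y+1)/2"
    have pq: "0 < p" "p \<le> q" "q < 1" using xy by (auto simp: p_def q_def)
    have "x / p \<le> y / q" using xy by (simp add: p_def q_def field_simps)
    then have "(x / p) powr (\<alpha> + 1) \<le> (y / q) powr (\<alpha> + 1)"
      using xy pq alpha by (intro powr_mono2) auto
    then have "(p powr (\<alpha> + 1) * h p) * (x / p) powr (\<alpha> + 1)
        \<le> (q powr (\<alpha> + 1) * h q) * (y / q) powr (\<alpha> + 1)"
      using h[OF pq] pq by (intro mult_mono[OF h(2)[OF pq]]) auto
    then show ?thesis
      using pq xy by (simp add: powr_divide mult.commute flip: p_def q_def)
  qed
  show "h ((x + 1) / 2) / 2 \<le> D * (h ((y + 1) / 2) / 2)" if xy: "0 < x" "x < 1" "0 < y" "y < 1" for x y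
  proof -
    define p q where "p = (x+1)/2" and "q = (y+1)/2"
    have pq: "1/2 \<le> p" "p < 1" "1/2 \<le> q" "q < 1" using xy by (auto simp: p_def q_def)
    have "h p \<le> D * h q"
    proof (cases "q \<le> p")
      case True
      then have "h p \<le> 1 * h q" "0 \<le> h q" using h[of q p] pq by auto
      then show ?thesis using D_ge_1 mult_right_mono[of 1 D "h q"] by linarith
    next
      case False
      then have *: "p powr (\<alpha> + 1) * h p \<le> q powr (\<alpha> + 1) * h q" "0 \<le> h p" "0 \<le> h q"
        using h[of p q] pq by auto
      have "(1/2) powr (\<alpha> + 1) * h p \<le> p powr (\<alpha> + 1) * h p"
        using pq * alpha by (intro mult_right_mono powr_mono2) auto
      also note *(1)
      also have "q powr (\<alpha> + 1) * h q \<le> 1 * h q"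
        using pq * alpha by (intro mult_right_mono) (auto intro!: powr_le1)
      finally show ?thesis by (simp add: D_def powr_divide field_simps)
    qed
    then show ?thesis by (simp add: p_def q_def)
  qed
qed

section \<open>The jump transformation\<close>

definition entry :: "real \<Rightarrow> nat" where
  "entry x = (LEAST i. 1/2 \<le> (f ^^ i) x)"

definition H :: "real \<Rightarrow> real" where
  "H x = (f ^^ Suc (entry x)) x"

primrec word :: "nat \<Rightarrow> real \<Rightarrow> nat list" where
  "word 0 x = []"
| "word (Suc n) x = entry x # word n (H x)"

lemma borel_measurable_f_pow [measurable]: "(\<lambda>x. (f ^^ i) x) \<in> borel_measurable borel"
proof (induction i)
  case (Suc i)
  from measurable_compose[OF Suc borel_measurable_f] show ?case by simp
qed simp

lemma measurable_entry [measurable]: "entry \<in> borel \<rightarrow>\<^sub>M count_space UNIV"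
  unfolding entry_def by measurable

lemma borel_measurable_H [measurable]: "H \<in> borel_measurable borel"
proof -
  have [measurable]: "(\<lambda>x. (f ^^ Suc i) x) \<in> borel_measurable borel" for i
    using borel_measurable_f_pow[of "Suc i"] by simp
  show ?thesis unfolding H_def
    by (rule measurable_compose_countable[where f = "\<lambda>i x. (f ^^ Suc i) x" and g = entry]) measurable
qed

lemma borel_measurable_H_pow [measurable]: "(\<lambda>x. (H ^^ i) x) \<in> borel_measurable borel"
proof (induction i)
  case (Suc i)
  from measurable_compose[OF Suc borel_measurable_H] show ?case by simp
qed simp

lemma measurable_word [measurable]: "word n \<in> borel \<rightarrow>\<^sub>M count_space UNIV"
proof (induction n)
  case 0
  then show ?case by (simp add: word.simps(1)[abs_def])
next
  case (Suc n)
  note [measurable] = Suc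
  have "{x. word (Suc n) x = w} \<in> sets borel" for w
  proof (cases w)
    case (Cons k v)
    have "{x. entry x = k \<and> word n (H x) = v} \<in> sets borel" by measurable
    then show ?thesis by (simp add: Cons)
  qed simp
  then show ?case
    by (subst measurable_count_space_eq2_countable) (auto simp: vimage_def)
qed

text \<open>The coordinate in which the left branch is nearly a translation: one step of \<open>f\<close> lowers \<open>zpot\<close> by
an amount between \<open>1/2\<close> and \<open>\<alpha>\<close>, and the right half is reached when \<open>zpot\<close> is at most \<open>1\<close>.\<close>

definition zpot :: "real \<Rightarrow> real" where
  "zpot x = (2 * x) powr (- \<alpha>)"

lemma zpot_pos: "0 < x \<Longrightarrow> 0 < zpot x"
  by (simp add: zpot_def)

lemma f_left_bounds:
  assumes "0 < x" "x < 1/2"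
  shows "0 < f x" "f x < 1"
  using assms strict_mono_less[OF strict_mono_phi, of 0 x] strict_mono_less[OF strict_mono_phi, of x "1/2"]
  by (auto simp: f_left)

lemma zpot_f:
  assumes x: "0 < x" "x < 1/2"
  shows "zpot x - \<alpha> \<le> zpot (f x)" "zpot (f x) \<le> zpot x - 1/2"
proof -
  define t where "t = (2 * x) powr \<alpha>"
  have t: "0 < t" "t \<le> 1" using x alpha by (auto simp: t_def intro!: powr_le1)
  have zt: "zpot x * t = 1" using x by (simp add: zpot_def t_def powr_minus)
  have z: "0 < zpot x" using x by (simp add: zpot_pos)
  have "f x = x * (1 + t)"
    using x by (simp add: f_left \<phi>_def t_def powr_mult)
  then have zf: "zpot (f x) = zpot x * (1 + t) powr (- \<alpha>)"
    using x t by (simp add: zpot_def powr_mult flip: mult.assoc)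
  have "zpot x * (1 - \<alpha> * t) \<le> zpot (f x)"
    unfolding zf using one_add_powr_minus_ge[of \<alpha> t] alpha t z by (intro mult_left_mono) auto
  moreover have "zpot x * (1 - \<alpha> * t) = zpot x - \<alpha> * (zpot x * t)" by (simp add: algebra_simps)
  ultimately show "zpot x - \<alpha> \<le> zpot (f x)" using zt by simp
  have "(1 + t) powr (- \<alpha>) \<le> (1 + t) powr (- 1)"
    using t alpha by (intro powr_mono) auto
  also have "\<dots> = 1 - t / (1 + t)" using t by (simp add: powr_minus field_simps)
  also have "\<dots> \<le> 1 - t / 2" using t by (simp add: field_simps)
  finally have "zpot (f x) \<le> zpot x * (1 - t / 2)"
    unfolding zf using z by (intro mult_left_mono) auto
  also have "\<dots> = zpot x - (zpot x * t) / 2" by (simp add: algebra_simps)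
  finally show "zpot (f x) \<le> zpot x - 1/2" using zt by simp
qed

lemma enters_right_half:
  assumes "0 < x" "x < 1"
  shows "\<exists>i. 1/2 \<le> (f ^^ i) x \<and> real i \<le> 2 * zpot x"
proof -
  obtain n where "zpot x \<le> real n / 2"
    using real_arch_simple[of "2 * zpot x"] by (auto simp: field_simps)
  then show ?thesis using assms
  proof (induction n arbitrary: x)
    case 0
    then show ?case using zpot_pos[of x] by simp
  next
    case (Suc n)
    show ?case
    proof (cases "1/2 \<le> x")
      case True
      then show ?thesis using Suc.prems zpot_pos[of x] by (intro exI[of _ 0]) auto
    next
      case False
      then have x: "0 < x" "x < 1/2" using Suc.prems by auto
      note b = f_left_bounds[OF x] and z = zpot_f[OF x]
      have "zpot (f x) \<le> real n / 2" using z Suc.prems by simp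
      from Suc.IH[OF this b] obtain i where i: "1/2 \<le> (f ^^ i) (f x)" "real i \<le> 2 * zpot (f x)"
        by auto
      then show ?thesis using z
        by (intro exI[of _ "Suc i"]) (auto simp: funpow_swap1)
    qed
  qed
qed

lemma entry_right [simp]: "1/2 \<le> x \<Longrightarrow> entry x = 0"
  unfolding entry_def by (rule Least_eq_0) simp

lemma f_pow_entry:
  assumes "0 < x" "x < 1"
  shows "1/2 \<le> (f ^^ entry x) x"
  using enters_right_half[OF assms] unfolding entry_def by (metis (mono_tags, lifting) LeastI)

lemma f_pow_less_entry: "i < entry x \<Longrightarrow> (f ^^ i) x < 1/2"
  unfolding entry_def using not_less_Least not_le by blast

lemma entry_le_zpot:
  assumes "0 < x" "x < 1"
  shows "real (entry x) \<le> 2 * zpot x"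
proof -
  obtain i where "1/2 \<le> (f ^^ i) x" "real i \<le> 2 * zpot x"
    using enters_right_half[OF assms] by auto
  then show ?thesis unfolding entry_def
    using Least_le[of "\<lambda>i. 1/2 \<le> (f ^^ i) x" i] by (meson of_nat_mono order_trans)
qed

lemma entry_left:
  assumes "0 < x" "x < 1/2"
  shows "entry x = Suc (entry (f x))"
proof -
  obtain n where "1/2 \<le> (f ^^ n) x" using enters_right_half[of x] assms by auto
  then have "entry x = Suc (LEAST i. 1/2 \<le> (f ^^ Suc i) x)"
    unfolding entry_def using assms by (intro Least_Suc) auto
  then show ?thesis by (simp add: entry_def funpow_swap1)
qed

lemma H_left:
  assumes "0 < x" "x < 1/2"
  shows "H x = H (f x)"
  by (simp add: H_def entry_left[OF assms] funpow_swap1)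

lemma H_right: "1/2 \<le> x \<Longrightarrow> H x = f x"
  by (simp add: H_def)

text \<open>The transfer operator of one branch of \<open>H\<close>. The branch with \<open>entry x = k\<close> is \<open>k\<close> left branches
followed by the right branch, so it maps the cone to flat densities.\<close>

lemma nn_integral_entry:
  assumes "cone h"
  shows "\<exists>h'. flat h' \<and> (\<forall>u \<in> borel_measurable borel.
    (\<integral>\<^sup>+x. ennreal (h x) * u (H x) * indicator {x. entry x = k} x \<partial>unif) =
    (\<integral>\<^sup>+x. ennreal (h' x) * u x \<partial>unif))"
  using assms
proof (induction k arbitrary: h)
  case 0
  have [measurable]: "h \<in> borel_measurable borel" and h: "0 \<le> h x" for x
    using 0 by (simp_all add: cone_def)
  show ?case
  proof (intro exI[of _ "\<lambda>x. h ((x + 1) / 2) / 2"] conjI flat_right 0 ballI)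
    fix u :: "real \<Rightarrow> ennreal" assume [measurable]: "u \<in> borel_measurable borel"
    have "(\<integral>\<^sup>+x. ennreal (h x) * u (H x) * indicator {x. entry x = 0} x \<partial>unif) =
        (\<integral>\<^sup>+x. ennreal (h x) * u (f x) * indicator {1/2<..<1} x \<partial>lborel)"
      unfolding nn_integral_unif
    proof (subst nn_integral_unif, measurable, rule nn_integral_cong_AE)
      show "AE x in lborel. ennreal (h x) * u (H x) * indicator {x. entry x = 0} x *
          indicator {0<..<1} x = ennreal (h x) * u (f x) * indicator {1/2<..<1} x"
        using AE_lborel_singleton[of "1/2"]
      proof eventually_elim
        case (elim x)
        then show ?case
          by (cases "1/2 \<le> x") (auto simp: H_right entry_left split: split_indicator)
      qed
    qed
    also have "\<dots> = (\<integral>\<^sup>+x. ennreal (h ((x + 1) / 2) / 2) * u x * indicator {0<..<1} x \<partial>lborel)"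
      by (rule nn_integral_right) (simp_all add: h)
    also have "\<dots> = (\<integral>\<^sup>+x. ennreal (h ((x + 1) / 2) / 2) * u x \<partial>unif)"
      by (rule nn_integral_unif[symmetric]) measurable
    finally show "(\<integral>\<^sup>+x. ennreal (h x) * u (H x) * indicator {x. entry x = 0} x \<partial>unif) =
        (\<integral>\<^sup>+x. ennreal (h ((x + 1) / 2) / 2) * u x \<partial>unif)" .
  qed
next
  case (Suc k)
  have [measurable]: "h \<in> borel_measurable borel" and h: "0 \<le> h x" for x
    using Suc.prems by (simp_all add: cone_def)
  from Suc.IH[OF cone_left[OF Suc.prems]] obtain h' where h': "flat h'" and
    eq: "\<And>u. u \<in> borel_measurable borel \<Longrightarrow>
      (\<integral>\<^sup>+x. ennreal (h (g x) / \<phi>' (g x)) * u (H x) * indicator {x. entry x = k} x \<partial>unif) =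
      (\<integral>\<^sup>+x. ennreal (h' x) * u x \<partial>unif)" by blast
  show ?case
  proof (intro exI[of _ h'] conjI h' ballI)
    fix u :: "real \<Rightarrow> ennreal" assume [measurable]: "u \<in> borel_measurable borel"
    have "(\<integral>\<^sup>+x. ennreal (h x) * u (H x) * indicator {x. entry x = Suc k} x \<partial>unif) =
        (\<integral>\<^sup>+x. ennreal (h x) * u (H x) * indicator {x. entry x = Suc k} x * indicator {0<..<1} x \<partial>lborel)"
      by (rule nn_integral_unif) measurable
    also have "\<dots> = (\<integral>\<^sup>+x. ennreal (h x) * (u (H (f x)) * indicator {x. entry x = k} (f x)) *
          indicator {0<..<1/2} x \<partial>lborel)"
    proof (rule nn_integral_cong)
      fix x :: real
      show "ennreal (h x) * u (H x) * indicator {x. entry x = Suc k} x * indicator {0<..<1} x =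
          ennreal (h x) * (u (H (f x)) * indicator {x. entry x = k} (f x)) * indicator {0<..<1/2} x"
        by (cases "1/2 \<le> x") (auto simp: H_left entry_left split: split_indicator)
    qed
    also have "\<dots> = (\<integral>\<^sup>+x. ennreal (h (g x) / \<phi>' (g x)) * (u (H x) * indicator {x. entry x = k} x) *
          indicator {0<..<1} x \<partial>lborel)"
      by (rule nn_integral_left) (simp_all add: h)
    also have "\<dots> = (\<integral>\<^sup>+x. ennreal (h (g x) / \<phi>' (g x)) * (u (H x) * indicator {x. entry x = k} x) \<partial>unif)"
      by (rule nn_integral_unif[symmetric]) measurable
    also have "\<dots> = (\<integral>\<^sup>+x. ennreal (h' x) * u x \<partial>unif)"
      using eq[of u] by (simp add: mult.assoc)
    finally show "(\<integral>\<^sup>+x. ennreal (h x) * u (H x) * indicator {x. entry x = Suc k} x \<partial>unif) =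
        (\<integral>\<^sup>+x. ennreal (h' x) * u x \<partial>unif)" .
  qed
qed

lemma AE_unif: "AE x in unif. 0 < x \<and> x < 1"
  unfolding unif_def by (subst AE_density) (auto simp: indicator_def)

lemma nn_integral_split_entry:
  assumes [measurable]: "F \<in> borel_measurable borel"
  shows "(\<integral>\<^sup>+x. F x \<partial>unif) = (\<Sum>k. \<integral>\<^sup>+x. F x * indicator {x. entry x = k} x \<partial>unif)"
proof -
  have "(\<Sum>k. F x * indicator {x. entry x = k} x) = F x" for x
  proof -
    have "(\<lambda>k. if k = entry x then F x else 0) sums F x" by (rule sums_single)
    then have "(\<Sum>k. if k = entry x then F x else 0) = F x" by (rule sums_unique[symmetric])
    then show ?thesis
      by (subst (asm) suminf_cong[where g = "\<lambda>k. F x * indicator {x. entry x = k} x"])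
        (auto split: split_indicator)
  qed
  then have "(\<integral>\<^sup>+x. F x \<partial>unif) = (\<integral>\<^sup>+x. (\<Sum>k. F x * indicator {x. entry x = k} x) \<partial>unif)"
    by simp
  also have "\<dots> = (\<Sum>k. \<integral>\<^sup>+x. F x * indicator {x. entry x = k} x \<partial>unif)"
    by (rule nn_integral_suminf) measurable
  finally show ?thesis .
qed

lemma nn_integral_const_unif [simp]: "(\<integral>\<^sup>+x. c \<partial>unif) = c"
  by (simp add: emeasure_unif_UNIV)

text \<open>Conditionally on the first \<open>n\<close> jump lengths, \<open>(H ^^ n) x\<close> is distributed with a flat density, so it
is uniform up to the factor \<open>D\<close>. The induction peels off the first jump, and therefore has to be
over all flat initial densities \<open>h\<close>.\<close>

lemma quasi_independence:
  assumes "flat h" and [measurable]: "u \<in> borel_measurable borel"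
  shows "(\<integral>\<^sup>+x. ennreal (h x) * \<psi> (word n x) \<partial>unif) * (\<integral>\<^sup>+x. u x \<partial>unif)
      \<le> ennreal D * (\<integral>\<^sup>+x. ennreal (h x) * \<psi> (word n x) * u ((H ^^ n) x) \<partial>unif)" (is ?A)
    and "(\<integral>\<^sup>+x. ennreal (h x) * \<psi> (word n x) * u ((H ^^ n) x) \<partial>unif)
      \<le> ennreal D * ((\<integral>\<^sup>+x. ennreal (h x) * \<psi> (word n x) \<partial>unif) * (\<integral>\<^sup>+x. u x \<partial>unif))" (is ?B)
proof -
  have "?A \<and> ?B" using assms(1)
  proof (induction n arbitrary: h \<psi>)
    case 0
    have [measurable]: "h \<in> borel_measurable borel" using 0 by (simp add: flat_def cone_def)
    have nonneg: "0 \<le> h x" for x using 0 by (simp add: flat_def cone_def)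
    have le: "h x \<le> D * h y" if "0 < x" "x < 1" "0 < y" "y < 1" for x y
      using 0 that by (simp add: flat_def)
    define I where "I = (\<integral>\<^sup>+x. ennreal (h x) \<partial>unif)"
    have I_le: "I \<le> ennreal D * ennreal (h y)" if "0 < y" "y < 1" for y
    proof -
      have "I \<le> (\<integral>\<^sup>+x. ennreal D * ennreal (h y) \<partial>unif)"
        unfolding I_def using AE_unif
        by (intro nn_integral_mono_AE, elim eventually_mono)
           (use le[OF _ _ that] nonneg D_ge_1 in \<open>auto simp flip: ennreal_mult intro!: ennreal_leI\<close>)
      then show ?thesis by simp
    qed
    have le_I: "ennreal (h y) \<le> ennreal D * I" if "0 < y" "y < 1" for y
    proof -
      have "(\<integral>\<^sup>+x. ennreal (h y) \<partial>unif) \<le> (\<integral>\<^sup>+x. ennreal D * ennreal (h x) \<partial>unif)"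
        using AE_unif
        by (intro nn_integral_mono_AE, elim eventually_mono)
           (use le[OF that] nonneg D_ge_1 in \<open>auto simp flip: ennreal_mult intro!: ennreal_leI\<close>)
      then show ?thesis by (simp add: I_def nn_integral_cmult)
    qed
    have A: "I * (\<integral>\<^sup>+x. u x \<partial>unif) \<le> ennreal D * (\<integral>\<^sup>+x. ennreal (h x) * u x \<partial>unif)"
    proof -
      have "I * (\<integral>\<^sup>+x. u x \<partial>unif) = (\<integral>\<^sup>+x. I * u x \<partial>unif)" by (simp add: nn_integral_cmult)
      also have "\<dots> \<le> (\<integral>\<^sup>+x. ennreal D * (ennreal (h x) * u x) \<partial>unif)"
        using AE_unif
        by (intro nn_integral_mono_AE, elim eventually_mono)
           (auto simp flip: mult.assoc intro!: mult_right_mono I_le)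
      finally show ?thesis by (simp add: nn_integral_cmult)
    qed
    have B: "(\<integral>\<^sup>+x. ennreal (h x) * u x \<partial>unif) \<le> ennreal D * (I * (\<integral>\<^sup>+x. u x \<partial>unif))"
    proof -
      have "(\<integral>\<^sup>+x. ennreal (h x) * u x \<partial>unif) \<le> (\<integral>\<^sup>+x. (ennreal D * I) * u x \<partial>unif)"
        using AE_unif
        by (intro nn_integral_mono_AE, elim eventually_mono) (auto intro!: mult_right_mono le_I)
      then show ?thesis by (simp add: nn_integral_cmult mult.assoc)
    qed
    have e1: "(\<integral>\<^sup>+x. ennreal (h x) * \<psi> (word 0 x) \<partial>unif) = \<psi> [] * I"
      unfolding I_def by (subst nn_integral_cmult[symmetric]) (auto simp: mult.commute)
    have e2: "(\<integral>\<^sup>+x. ennreal (h x) * \<psi> (word 0 x) * u ((H ^^ 0) x) \<partial>unif) =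
        \<psi> [] * (\<integral>\<^sup>+x. ennreal (h x) * u x \<partial>unif)"
      by (simp flip: nn_integral_cmult add: mult_ac)
    show ?case unfolding e1 e2
      using mult_left_mono[OF A, of "\<psi> []"] mult_left_mono[OF B, of "\<psi> []"] by (simp add: mult_ac)
  next
    case (Suc n)
    have [measurable]: "h \<in> borel_measurable borel" using Suc.prems by (simp add: flat_def cone_def)
    have cone: "cone h" using Suc.prems by (simp add: flat_def)
    have *: "(\<integral>\<^sup>+x. ennreal (h x) * \<psi> (word (Suc n) x) * indicator {x. entry x = k} x \<partial>unif) *
            (\<integral>\<^sup>+x. u x \<partial>unif)
          \<le> ennreal D * (\<integral>\<^sup>+x. ennreal (h x) * \<psi> (word (Suc n) x) * u ((H ^^ Suc n) x) *
                indicator {x. entry x = k} x \<partial>unif) \<and>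
        (\<integral>\<^sup>+x. ennreal (h x) * \<psi> (word (Suc n) x) * u ((H ^^ Suc n) x) *
                indicator {x. entry x = k} x \<partial>unif)
          \<le> ennreal D * ((\<integral>\<^sup>+x. ennreal (h x) * \<psi> (word (Suc n) x) * indicator {x. entry x = k} x \<partial>unif) *
            (\<integral>\<^sup>+x. u x \<partial>unif))" for k
    proof -
      obtain h' where h': "flat h'" and
        eq: "\<And>u. u \<in> borel_measurable borel \<Longrightarrow>
          (\<integral>\<^sup>+x. ennreal (h x) * u (H x) * indicator {x. entry x = k} x \<partial>unif) =
          (\<integral>\<^sup>+x. ennreal (h' x) * u x \<partial>unif)" using nn_integral_entry[OF cone, of k] by blast
      have e1: "(\<integral>\<^sup>+x. ennreal (h x) * \<psi> (word (Suc n) x) * indicator {x. entry x = k} x \<partial>unif) =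
          (\<integral>\<^sup>+x. ennreal (h' x) * \<psi> (k # word n x) \<partial>unif)"
        by (subst eq[symmetric]) (auto intro!: nn_integral_cong split: split_indicator)
      have e2: "(\<integral>\<^sup>+x. ennreal (h x) * \<psi> (word (Suc n) x) * u ((H ^^ Suc n) x) *
            indicator {x. entry x = k} x \<partial>unif) =
          (\<integral>\<^sup>+x. ennreal (h' x) * (\<psi> (k # word n x) * u ((H ^^ n) x)) \<partial>unif)"
        by (subst eq[symmetric])
          (auto intro!: nn_integral_cong simp: funpow_swap1 mult.assoc split: split_indicator)
      show ?thesis
        unfolding e1 e2 using Suc.IH[OF h', of "\<lambda>w. \<psi> (k # w)"] by (simp add: mult.assoc)
    qed
    have s1: "(\<integral>\<^sup>+x. ennreal (h x) * \<psi> (word (Suc n) x) \<partial>unif) =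
        (\<Sum>k. \<integral>\<^sup>+x. ennreal (h x) * \<psi> (word (Suc n) x) * indicator {x. entry x = k} x \<partial>unif)"
      by (rule nn_integral_split_entry) (simp del: word.simps)
    have s2: "(\<integral>\<^sup>+x. ennreal (h x) * \<psi> (word (Suc n) x) * u ((H ^^ Suc n) x) \<partial>unif) =
        (\<Sum>k. \<integral>\<^sup>+x. ennreal (h x) * \<psi> (word (Suc n) x) * u ((H ^^ Suc n) x) *
            indicator {x. entry x = k} x \<partial>unif)"
      by (rule nn_integral_split_entry) (simp del: word.simps funpow.simps)
    show ?case unfolding s1 s2
      by (simp del: word.simps funpow.simps flip: ennreal_suminf_multc ennreal_suminf_cmult)
        (intro conjI suminf_le, use * in auto)
  qed
  then show ?A ?B by auto
qed

end

section \<open>Growth of the jump times\<close>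

lemma powr_add_le:
  fixes a b p :: real
  assumes "0 \<le> a" "0 \<le> b" "0 < p" "p \<le> 1"
  shows "(a + b) powr p \<le> a powr p + b powr p"
proof (cases "a = 0 \<or> b = 0")
  case False
  then have ab: "0 < a" "0 < b" using assms by auto
  have "(a + b) powr p = (a + b) * (a + b) powr (p - 1)"
    using ab by (simp add: powr_diff)
  also have "\<dots> = a * (a + b) powr (p - 1) + b * (a + b) powr (p - 1)"
    by (simp add: algebra_simps)
  also have "\<dots> \<le> a * a powr (p - 1) + b * b powr (p - 1)"
    using ab assms by (intro add_mono mult_left_mono powr_mono2') auto
  also have "\<dots> = a powr p + b powr p"
    using ab by (simp add: powr_diff)
  finally show ?thesis .
qed (use assms in auto)

lemma powr_sum_le:
  fixes a :: "nat \<Rightarrow> real"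
  assumes "\<And>i. 0 \<le> a i" "0 < p" "p \<le> 1"
  shows "(\<Sum>i<n. a i) powr p \<le> (\<Sum>i<n. a i powr p)"
proof (induction n)
  case (Suc n)
  have "(\<Sum>i<Suc n. a i) powr p \<le> (\<Sum>i<n. a i) powr p + a n powr p"
    using assms by (simp add: powr_add_le sum_nonneg)
  with Suc show ?case by simp
qed (use assms in simp)

lemma le_ipow_iff: "k \<le> ipow n s \<longleftrightarrow> real k \<le> real n powr s"
  unfolding ipow_def by (simp add: le_nat_iff le_floor_iff)

lemma real_ipow_le: "real (ipow n s) \<le> real n powr s"
  using le_ipow_iff[of "ipow n s" n s] by simp

lemma summable_exp_minus_powr:
  fixes c \<gamma> :: real
  assumes "0 < c" "0 < \<gamma>"
  shows "summable (\<lambda>j. exp (- c * real j powr \<gamma>))"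
proof (rule summable_comparison_test_ev)
  have "((\<lambda>x::real. exp (- c * x powr \<gamma>) * x ^ 2) \<longlongrightarrow> 0) at_top"
    using assms by real_asymp
  then have "\<forall>\<^sub>F x in at_top. exp (- c * x powr \<gamma>) * x ^ 2 < 1"
    by (rule order_tendstoD) simp
  then have "\<forall>\<^sub>F j in sequentially. exp (- c * real j powr \<gamma>) * real j ^ 2 < 1"
    using filterlim_real_sequentially by (rule eventually_compose_filterlim)
  then show "\<forall>\<^sub>F j in sequentially. norm (exp (- c * real j powr \<gamma>)) \<le> inverse (real j ^ 2)"
    using eventually_gt_at_top[of 0]
    by eventually_elim (auto simp: field_simps)
  show "summable (\<lambda>j. inverse (real j ^ 2))"
    by (rule inverse_power_summable) simp
qed

text \<open>This gives almost sure growth bounds without passing to subsequences: with weights that make the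
expectations summable, the weighted partial sums stay bounded, and monotone weights can be taken
out again.\<close>

lemma AE_partial_sums_bounded:
  assumes [measurable]: "\<And>i. X i \<in> borel_measurable M"
    and "(\<Sum>i. \<integral>\<^sup>+x. ennreal (X i x) \<partial>M) < \<infinity>"
    and nonneg: "\<And>i x. 0 \<le> X i x"
  shows "AE x in M. \<exists>C. 0 \<le> C \<and> (\<forall>n. (\<Sum>i<n. X i x) \<le> (C :: real))"
proof -
  have "(\<integral>\<^sup>+x. (\<Sum>i. ennreal (X i x)) \<partial>M) \<noteq> \<infinity>"
    using assms(2) by (subst nn_integral_suminf) auto
  then have "AE x in M. (\<Sum>i. ennreal (X i x)) \<noteq> \<infinity>"
    by (intro nn_integral_PInf_AE) auto
  then show ?thesis
  proof eventually_elim
    case (elim x)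
    define C where "C = enn2real (\<Sum>i. ennreal (X i x))"
    have "ennreal (\<Sum>i<n. X i x) \<le> ennreal C" for n
    proof -
      have "ennreal (\<Sum>i<n. X i x) = (\<Sum>i<n. ennreal (X i x))"
        using nonneg by (simp add: sum_ennreal)
      also have "\<dots> \<le> (\<Sum>i. ennreal (X i x))"
        by (rule sum_le_suminf) auto
      also have "\<dots> = ennreal C"
        using elim by (simp add: C_def less_top)
      finally show ?thesis .
    qed
    then show ?case
      by (intro exI[of _ C]) (auto simp: C_def ennreal_le_iff)
  qed
qed

context intermittent
begin

lemma borel_word_event [measurable]: "{x. word n x \<in> W} \<in> sets borel"
proof -
  have "word n -` W \<inter> space borel \<in> sets borel"
    by (rule measurable_sets[OF measurable_word]) simp
  then show ?thesis by (simp add: vimage_def)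
qed

lemma quasi_independent_events:
  assumes [measurable]: "A \<in> sets borel"
  shows "measure unif {x. word n x \<in> W} * measure unif A
      \<le> D * measure unif {x. word n x \<in> W \<and> (H ^^ n) x \<in> A}"
    and "measure unif {x. word n x \<in> W \<and> (H ^^ n) x \<in> A}
      \<le> D * (measure unif {x. word n x \<in> W} * measure unif A)"
proof -
  have 1: "(\<integral>\<^sup>+x. ennreal 1 * indicator W (word n x) \<partial>unif) = emeasure unif {x. word n x \<in> W}"
  proof -
    have "(\<integral>\<^sup>+x. ennreal 1 * indicator W (word n x) \<partial>unif) = (\<integral>\<^sup>+x. indicator {x. word n x \<in> W} x \<partial>unif)"
      by (intro nn_integral_cong) (auto split: split_indicator)
    also have "\<dots> = emeasure unif {x. word n x \<in> W}" by (rule nn_integral_indicator) simp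
    finally show ?thesis .
  qed
  have 2: "(\<integral>\<^sup>+x. ennreal 1 * indicator W (word n x) * indicator A ((H ^^ n) x) \<partial>unif) =
      emeasure unif {x. word n x \<in> W \<and> (H ^^ n) x \<in> A}"
  proof -
    have *: "{x. word n x \<in> W \<and> (H ^^ n) x \<in> A} \<in> sets borel" by measurable
    have "(\<integral>\<^sup>+x. ennreal 1 * indicator W (word n x) * indicator A ((H ^^ n) x) \<partial>unif) =
        (\<integral>\<^sup>+x. indicator {x. word n x \<in> W \<and> (H ^^ n) x \<in> A} x \<partial>unif)"
      by (intro nn_integral_cong) (auto split: split_indicator)
    also have "\<dots> = emeasure unif {x. word n x \<in> W \<and> (H ^^ n) x \<in> A}"
      by (rule nn_integral_indicator) (use * in simp)
    finally show ?thesis .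
  qed
  have 3: "(\<integral>\<^sup>+x. indicator A x \<partial>unif) = emeasure unif A" by simp
  have D: "0 \<le> D" using D_ge_1 by simp
  note q = quasi_independence[OF flat_1, of "indicator A :: real \<Rightarrow> ennreal" "indicator W" n]
  show "measure unif {x. word n x \<in> W} * measure unif A
      \<le> D * measure unif {x. word n x \<in> W \<and> (H ^^ n) x \<in> A}"
    using q(1) D unfolding 1 2 3 unif.emeasure_eq_measure
    by (simp add: ennreal_mult[symmetric] ennreal_le_iff)
  show "measure unif {x. word n x \<in> W \<and> (H ^^ n) x \<in> A}
      \<le> D * (measure unif {x. word n x \<in> W} * measure unif A)"
    using q(2) D unfolding 1 2 3 unif.emeasure_eq_measure
    by (simp add: ennreal_mult[symmetric] ennreal_le_iff)
qed

lemma nn_integral_H_pow_le: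
  assumes [measurable]: "u \<in> borel_measurable borel"
  shows "(\<integral>\<^sup>+x. u ((H ^^ n) x) \<partial>unif) \<le> ennreal D * (\<integral>\<^sup>+x. u x \<partial>unif)"
  using quasi_independence(2)[OF flat_1 assms, of "\<lambda>_. 1" n] by simp

lemma AE_H_pow:
  assumes "AE x in unif. P x" and [measurable]: "Measurable.pred borel P"
  shows "AE x in unif. P ((H ^^ n) x)"
proof -
  have "(\<integral>\<^sup>+x. indicator {x. \<not> P x} ((H ^^ n) x) \<partial>unif) \<le> ennreal D * (\<integral>\<^sup>+x. indicator {x. \<not> P x} x \<partial>unif)"
    by (rule nn_integral_H_pow_le) simp
  also have "(\<integral>\<^sup>+x. indicator {x. \<not> P x} x \<partial>unif) = emeasure unif {x. \<not> P x}"
    by (rule nn_integral_indicator) simp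
  also have "\<dots> = 0"
    using assms(1) by (subst (asm) AE_iff_measurable[OF _ refl]) auto
  finally have "(\<integral>\<^sup>+x. indicator {x. \<not> P x} ((H ^^ n) x) \<partial>unif) = 0" by simp
  then have "AE x in unif. indicator {x. \<not> P x} ((H ^^ n) x) = (0::ennreal)"
    by (subst (asm) nn_integral_0_iff_AE) auto
  then show ?thesis by eventually_elim (auto split: split_indicator_asm)
qed

text \<open>Points whose \<open>H\<close>-orbit never hits \<open>0\<close>; for these all entrance times are genuine.\<close>

definition good :: "real \<Rightarrow> bool" where
  "good x \<longleftrightarrow> (\<forall>n. 0 < (H ^^ n) x \<and> (H ^^ n) x < 1)"

lemma AE_good: "AE x in unif. good x"
  unfolding good_def AE_all_countable by (intro allI AE_H_pow AE_unif) measurable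

lemma good_H: "good x \<Longrightarrow> good (H x)"
  unfolding good_def by (metis funpow_swap1 funpow.simps(2) comp_apply)

lemma goodD: "good x \<Longrightarrow> 0 < x" "good x \<Longrightarrow> x < 1"
  unfolding good_def by (metis funpow_0)+

lemma phi_expanding: "x \<le> y \<Longrightarrow> 0 \<le> x \<Longrightarrow> y - x \<le> \<phi> y - \<phi> x"
proof -
  assume xy: "x \<le> y" "0 \<le> x"
  then have "x * (2 powr \<alpha> * \<bar>x\<bar> powr \<alpha>) \<le> y * (2 powr \<alpha> * \<bar>y\<bar> powr \<alpha>)"
    using alpha by (intro mult_mono powr_mono2) auto
  then show ?thesis by (simp add: \<phi>_def algebra_simps)
qed

lemma H_expanding:
  assumes "0 < x" "x < 1" "0 < y" "y < 1" "entry x = k" "entry y = k"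
  shows "2 * \<bar>x - y\<bar> \<le> \<bar>H x - H y\<bar>"
  using assms
proof (induction k arbitrary: x y)
  case 0
  then have "1/2 \<le> x" "1/2 \<le> y" using f_pow_entry[of x] f_pow_entry[of y] by auto
  then have "H x - H y = 2 * (x - y)" by (simp add: H_right f_right)
  then show ?case by (simp only: abs_mult)
next
  case (Suc k)
  then have x: "0 < x" "x < 1/2" and y: "0 < y" "y < 1/2"
    using entry_right[of x] entry_right[of y] by (cases "1/2 \<le> x"; cases "1/2 \<le> y"; force)+
  have "entry (f x) = k" "entry (f y) = k"
    using Suc.prems entry_left[OF x] entry_left[OF y] by auto
  then have "2 * \<bar>f x - f y\<bar> \<le> \<bar>H (f x) - H (f y)\<bar>"
    using f_left_bounds[OF x] f_left_bounds[OF y] by (intro Suc.IH) auto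
  moreover have "\<bar>x - y\<bar> \<le> \<bar>f x - f y\<bar>"
  proof (cases "x \<le> y")
    case True
    then have "y - x \<le> f y - f x" using phi_expanding[of x y] x y by (simp add: f_left)
    then show ?thesis using True by linarith
  next
    case False
    then have "x - y \<le> f x - f y" using phi_expanding[of y x] x y by (simp add: f_left)
    then show ?thesis using False by linarith
  qed
  ultimately show ?case by (simp add: H_left[OF x] H_left[OF y])
qed

text \<open>Every branch of \<open>H\<close> expands by a factor of at least \<open>2\<close>, the slope of the right branch.\<close>

lemma word_determines:
  assumes "good x" "good y" "word n x = word n y"
  shows "\<bar>x - y\<bar> \<le> (1/2) ^ n"
  using assms
proof (induction n arbitrary: x y)
  case 0
  then show ?case using goodD[of x] goodD[of y] by auto
next
  case (Suc n)
  then have "\<bar>H x - H y\<bar> \<le> (1/2) ^ n" by (intro Suc.IH good_H) auto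
  moreover have "2 * \<bar>x - y\<bar> \<le> \<bar>H x - H y\<bar>"
    using Suc.prems goodD[of x] goodD[of y] by (intro H_expanding) auto
  ultimately show ?case by simp
qed

lemma word_Suc_right: "word (Suc n) x = word n x @ [entry ((H ^^ n) x)]"
  by (induction n arbitrary: x) (auto simp: funpow_swap1)

definition \<tau> :: "nat \<Rightarrow> real \<Rightarrow> nat" where
  "\<tau> n x = sum_list (word n x) + n"

lemma tau_0 [simp]: "\<tau> 0 x = 0"
  by (simp add: \<tau>_def)

lemma tau_Suc: "\<tau> (Suc n) x = \<tau> n x + Suc (entry ((H ^^ n) x))"
  by (simp add: \<tau>_def word_Suc_right del: word.simps)

lemma f_pow_tau: "(f ^^ \<tau> n x) x = (H ^^ n) x"
proof (induction n)
  case (Suc n)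
  have "(f ^^ \<tau> (Suc n) x) x = (f ^^ (Suc (entry ((H ^^ n) x)) + \<tau> n x)) x"
    by (simp only: tau_Suc add.commute)
  also have "\<dots> = (f ^^ Suc (entry ((H ^^ n) x))) ((H ^^ n) x)"
    using Suc by (simp only: funpow_add comp_apply)
  also have "\<dots> = (H ^^ Suc n) x" by (simp add: H_def)
  finally show ?case .
qed simp

lemma strict_mono_tau: "strict_mono (\<lambda>n. \<tau> n x)"
  by (rule strict_monoI_Suc) (simp add: tau_Suc)

lemma measurable_tau [measurable]: "\<tau> n \<in> borel \<rightarrow>\<^sub>M count_space UNIV"
  unfolding \<tau>_def by (rule measurable_compose[OF measurable_word]) simp

lemma zpot_le_1: "1/2 \<le> x \<Longrightarrow> zpot x \<le> 1"
  using alpha powr_mono2'[of "- \<alpha>" 1 "2 * x"] by (auto simp: zpot_def)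

lemma le_entry:
  assumes "0 < x" "x < 1" "1 + \<alpha> * real M < zpot x"
  shows "M \<le> entry x"
  using assms
proof (induction M arbitrary: x)
  case (Suc M)
  have "0 \<le> \<alpha> * real (Suc M)" using alpha by simp
  then have x: "0 < x" "x < 1/2" using zpot_le_1[of x] Suc.prems by (cases "1/2 \<le> x"; simp)+
  have "M \<le> entry (f x)"
    using Suc.prems zpot_f[OF x] by (intro Suc.IH f_left_bounds[OF x]) (simp add: algebra_simps)
  then show ?case by (simp add: entry_left[OF x])
qed simp

text \<open>The constant is the largest \<open>c\<close> for which \<open>le_entry\<close> covers \<open>(0, c)\<close>.\<close>

lemma prob_le_entry: "(1 + \<alpha> * real M) powr (- 1 / \<alpha>) / 2 \<le> measure unif {x. M \<le> entry x}"
proof -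
  define c where "c = (1 + \<alpha> * real M) powr (- 1 / \<alpha>) / 2"
  have "(1 + \<alpha> * real M) powr (- 1 / \<alpha>) \<le> 1 powr (- 1 / \<alpha>)"
    using alpha by (intro powr_mono2') auto
  moreover have "0 < 1 + \<alpha> * real M" using alpha by (simp add: add_pos_nonneg)
  ultimately have c: "0 < c" "c \<le> 1/2" by (auto simp: c_def)
  have "{0<..<c} \<subseteq> {x. M \<le> entry x}"
  proof safe
    fix x assume x: "x \<in> {0<..<c}"
    then have "2 * x < (1 + \<alpha> * real M) powr (- 1 / \<alpha>)" by (simp add: c_def)
    then have "((1 + \<alpha> * real M) powr (- 1 / \<alpha>)) powr (- \<alpha>) < (2 * x) powr (- \<alpha>)"
      using x alpha by (intro powr_less_mono2_neg) auto
    then have "1 + \<alpha> * real M < zpot x"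
      using alpha by (simp add: powr_powr zpot_def add_nonneg_nonneg)
    then show "M \<le> entry x" using x c by (intro le_entry) auto
  qed
  then have "measure unif {0<..<c} \<le> measure unif {x. M \<le> entry x}"
    by (intro unif.finite_measure_mono) (simp_all add: pred_def[symmetric])
  moreover have "{0<..<c} \<inter> {0<..<1} = {0<..<c}" using c by auto
  then have "emeasure unif {0<..<c} = ennreal c"
    using c by (simp add: emeasure_unif)
  then have "measure unif {0<..<c} = c" using c by (simp add: measure_def)
  ultimately show ?thesis by (simp add: c_def)
qed

lemma prob_entries_less:
  "measure unif {x. \<forall>k \<in> set (word j x). k < M} \<le> exp (- (measure unif {x. M \<le> entry x} / D) * real j)"
proof -
  define a where "a = measure unif {x. M \<le> entry x} / D"
  have a: "0 \<le> a" "a \<le> 1"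
  proof -
    show "0 \<le> a" using D_ge_1 by (simp add: a_def)
    have "measure unif {x. M \<le> entry x} \<le> 1"
      using unif.bounded_measure[of "{x. M \<le> entry x}"] by (simp add: measure_def)
    then show "a \<le> 1" using D_ge_1 by (simp add: a_def)
  qed
  have "measure unif {x. \<forall>k \<in> set (word j x). k < M} \<le> (1 - a) ^ j"
  proof (induction j)
    case 0
    show ?case by (simp add: measure_def)
  next
    case (Suc j)
    let ?W = "{w. \<forall>k \<in> set w. k < M}" and ?A = "{x. M \<le> entry x}"
    have A [measurable]: "?A \<in> sets borel" by measurable
    have e: "{x. \<forall>k \<in> set (word (Suc j) x). k < M} =
        {x. word j x \<in> ?W} - {x. word j x \<in> ?W \<and> (H ^^ j) x \<in> ?A}"
      by (auto simp: word_Suc_right simp del: word.simps)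
    have m: "{x. word j x \<in> ?W \<and> (H ^^ j) x \<in> ?A} \<in> sets borel" by measurable
    have "measure unif {x. \<forall>k \<in> set (word (Suc j) x). k < M} =
        measure unif {x. word j x \<in> ?W} - measure unif {x. word j x \<in> ?W \<and> (H ^^ j) x \<in> ?A}"
      unfolding e using m by (intro unif.finite_measure_Diff) auto
    also have "\<dots> \<le> measure unif {x. word j x \<in> ?W} * (1 - a)"
      using quasi_independent_events(1)[OF A, of j ?W] D_ge_1 by (simp add: a_def field_simps)
    also have "\<dots> \<le> (1 - a) ^ j * (1 - a)"
      using Suc a by (intro mult_right_mono) auto
    finally show ?case by (simp only: power_Suc2)
  qed
  also have "\<dots> \<le> exp (- a) ^ j"
    using a exp_ge_add_one_self[of "- a"] by (intro power_mono) auto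
  also have "\<dots> = exp (- a * real j)" by (simp add: exp_of_nat_mult[symmetric] mult.commute)
  finally show ?thesis by (simp add: a_def)
qed

lemma entry_less_tau: "k \<in> set (word j x) \<Longrightarrow> k < \<tau> j x"
  using member_le_sum_list[of k "word j x"] by (cases j) (auto simp: \<tau>_def)

text \<open>If \<open>\<tau> j x\<close> is at most \<open>M = j powr s\<close> then each of the first \<open>j\<close> entrance times is below \<open>M\<close>.
Given that the earlier ones are, each of them is at least \<open>M\<close> with probability at least a constant times
\<open>M powr (-1/\<alpha>) = j powr (- s/\<alpha>)\<close>, and \<open>s < \<alpha>\<close>, so this is a stretched exponentially rare
event.\<close>

lemma AE_tau_lower:
  assumes s: "0 < s" "s < \<alpha>"
  shows "AE x in unif. \<forall>\<^sub>F j in sequentially. ipow j s \<le> \<tau> j x"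
proof -
  define c where "c = (1 + \<alpha>) powr (- 1 / \<alpha>) / (2 * D)"
  define \<gamma> where "\<gamma> = 1 - s / \<alpha>"
  have pos: "0 < c" "0 < \<gamma>" using s alpha D_ge_1 by (auto simp: c_def \<gamma>_def)
  let ?A = "\<lambda>j. {x. \<tau> j x \<le> ipow j s}"
  have A [measurable]: "?A j \<in> sets unif" for j by measurable
  have bound: "measure unif (?A j) \<le> exp (- c * real j powr \<gamma>)" if j: "1 \<le> j" for j
  proof -
    define M where "M = ipow j s"
    have "1 \<le> real j powr s" using j s by (intro ge_one_powr_ge_zero) auto
    moreover have "\<alpha> * real M \<le> \<alpha> * real j powr s"
      using real_ipow_le[of j s] alpha by (intro mult_left_mono) (auto simp: M_def)
    ultimately have "1 + \<alpha> * real M \<le> (1 + \<alpha>) * real j powr s" by (simp add: algebra_simps)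
    then have "((1 + \<alpha>) * real j powr s) powr (- 1 / \<alpha>) \<le> (1 + \<alpha> * real M) powr (- 1 / \<alpha>)"
      using alpha by (intro powr_mono2') (auto intro!: add_pos_nonneg)
    then have "(1 + \<alpha>) powr (- 1 / \<alpha>) * real j powr (- s / \<alpha>) \<le> 2 * measure unif {x. M \<le> entry x}"
      using prob_le_entry[of M] alpha by (simp add: powr_mult powr_powr)
    then have "c * real j powr (- s / \<alpha>) \<le> measure unif {x. M \<le> entry x} / D"
      using D_ge_1 by (simp add: c_def field_simps)
    then have "c * real j powr (- s / \<alpha>) * real j \<le> measure unif {x. M \<le> entry x} / D * real j"
      by (intro mult_right_mono) auto
    moreover have "real j powr (- s / \<alpha>) * real j = real j powr \<gamma>"
      using j by (simp add: \<gamma>_def powr_diff powr_minus field_simps)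
    ultimately have *: "- (measure unif {x. M \<le> entry x} / D) * real j \<le> - c * real j powr \<gamma>"
      by (simp add: mult.assoc)
    have "measure unif (?A j) \<le> measure unif {x. \<forall>k \<in> set (word j x). k < M}"
    proof (rule unif.finite_measure_mono)
      show "?A j \<subseteq> {x. \<forall>k \<in> set (word j x). k < M}"
        unfolding M_def using entry_less_tau by fastforce
      have "{x. word j x \<in> {w. \<forall>k \<in> set w. k < M}} \<in> sets borel" by measurable
      then show "{x. \<forall>k \<in> set (word j x). k < M} \<in> sets unif" by simp
    qed
    also have "\<dots> \<le> exp (- (measure unif {x. M \<le> entry x} / D) * real j)"
      by (rule prob_entries_less)
    also have "\<dots> \<le> exp (- c * real j powr \<gamma>)" using * by simp
    finally show ?thesis .
  qed
  have "AE x in unif. \<forall>\<^sub>F j in sequentially. x \<in> space unif - ?A j"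
  proof (rule borel_cantelli_AE1)
    show "emeasure unif (?A j) < \<infinity>" for j by (simp add: unif.emeasure_eq_measure)
    show "summable (\<lambda>j. measure unif (?A j))"
      by (rule summable_comparison_test_ev[OF _ summable_exp_minus_powr[OF pos]])
         (use bound in \<open>auto intro!: eventually_sequentiallyI[of 1]\<close>)
  qed auto
  then show ?thesis
    by eventually_elim (auto elim: eventually_mono)
qed

lemma Suc_entry_le:
  assumes "0 < x" "x < 1"
  shows "real (Suc (entry x)) \<le> 2 * x powr (- \<alpha>)"
proof -
  have 1: "1 \<le> x powr (- \<alpha>)" using assms alpha powr_mono2'[of "- \<alpha>" x 1] by auto
  have "2 * 2 powr (- \<alpha>) \<le> (1 :: real)"
    using alpha powr_mono[of "1 - \<alpha>" 0 2] by (simp add: powr_diff powr_minus field_simps)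
  then have "2 * zpot x \<le> 1 * x powr (- \<alpha>)"
    unfolding zpot_def using assms by (subst powr_mult) (auto simp flip: mult.assoc intro!: mult_right_mono)
  then show ?thesis using entry_le_zpot[OF assms] 1 by simp
qed

lemma nn_integral_powr_minus_finite:
  assumes "0 \<le> q" "q < 1"
  shows "(\<integral>\<^sup>+x. ennreal (x powr (- q)) \<partial>unif) < \<infinity>"
proof -
  have hi: "((\<lambda>x. x powr (- q)) has_integral (1 powr (- q + 1) / (- q + 1))) {0..1}"
    using assms by (intro has_integral_powr_from_0) auto
  have "(\<integral>\<^sup>+x. ennreal (x powr (- q)) \<partial>unif) = (\<integral>\<^sup>+x. ennreal (x powr (- q)) * indicator {0<..<1} x \<partial>lborel)"
    by (rule nn_integral_unif) measurable
  also have "\<dots> \<le> (\<integral>\<^sup>+x. ennreal (x powr (- q)) * indicator {0..1} x \<partial>lborel)"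
    by (intro nn_integral_mono) (auto split: split_indicator)
  also have "\<dots> = ennreal (1 powr (- q + 1) / (- q + 1))"
    by (rule nn_integral_has_integral_lebesgue'[OF _ hi, THEN trans[rotated]]) auto
  finally show ?thesis using le_less_trans[OF _ ennreal_less_top] by simp
qed

text \<open>The jump lengths have finite moments of every order \<open>p < 1/\<alpha>\<close>. As \<open>p \<le> 1\<close>, the power \<open>p\<close> of
\<open>\<tau> j x\<close> is at most the sum of the powers of the jump lengths, which grows more slowly than
\<open>j powr q\<close> for every \<open>q > 1\<close>.\<close>

lemma AE_tau_upper:
  assumes s: "\<alpha> < s"
  shows "AE x in unif. \<exists>C. 0 \<le> C \<and> (\<forall>j. real (\<tau> j x) \<le> C * real j powr s)"
proof -
  \<comment> \<open>The gap between \<open>\<alpha>\<close> and \<open>s\<close> is shared: \<open>p = 1/s'\<close> leaves room for the moment, \<open>q = s/s'\<close> for the weights.\<close>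
  define s' where "s' = (\<alpha> + s) / 2"
  define p where "p = 1 / s'"
  define q where "q = s / s'"
  have s': "\<alpha> < s'" "s' < s" "1 < s'" using s alpha by (auto simp: s'_def)
  have p: "0 < p" "p \<le> 1" "\<alpha> * p < 1" and q: "1 < q"
    using s' alpha by (auto simp: p_def q_def)
  define R where "R = (\<lambda>x. real (Suc (entry x)) powr p)"
  have [measurable]: "R \<in> borel_measurable borel" unfolding R_def by measurable
  have R_nonneg: "0 \<le> R x" for x by (simp add: R_def)
  define E where "E = (\<integral>\<^sup>+x. ennreal (R x) \<partial>unif)"
  have E: "E < \<infinity>"
  proof -
    have "E \<le> (\<integral>\<^sup>+x. ennreal (2 powr p) * ennreal (x powr (- (\<alpha> * p))) \<partial>unif)"
      unfolding E_def using AE_unif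
    proof (intro nn_integral_mono_AE, elim eventually_mono)
      fix x :: real assume x: "0 < x \<and> x < 1"
      then have "R x \<le> (2 * x powr (- \<alpha>)) powr p"
        unfolding R_def using p by (intro powr_mono2 Suc_entry_le) auto
      also have "\<dots> = 2 powr p * x powr (- (\<alpha> * p))" using x by (simp add: powr_mult powr_powr)
      finally show "ennreal (R x) \<le> ennreal (2 powr p) * ennreal (x powr (- (\<alpha> * p)))"
        by (simp flip: ennreal_mult add: ennreal_leI)
    qed
    also have "\<dots> = ennreal (2 powr p) * (\<integral>\<^sup>+x. ennreal (x powr (- (\<alpha> * p))) \<partial>unif)"
      by (rule nn_integral_cmult) measurable
    also have "\<dots> < \<infinity>"
      using nn_integral_powr_minus_finite[of "\<alpha> * p"] p alpha by (simp add: ennreal_mult_less_top)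
    finally show ?thesis .
  qed
  define X where "X = (\<lambda>i x. R ((H ^^ i) x) * real (Suc i) powr (- q))"
  have [measurable]: "X i \<in> borel_measurable borel" for i unfolding X_def by measurable
  have sq: "summable (\<lambda>i. real (Suc i) powr (- q))"
    using q summable_real_powr_iff[of "- q"] summable_Suc_iff[of "\<lambda>i. real i powr (- q)"] by simp
  have "AE x in unif. \<exists>C. 0 \<le> C \<and> (\<forall>n. (\<Sum>i<n. X i x) \<le> (C :: real))"
  proof (rule AE_partial_sums_bounded)
    have "(\<integral>\<^sup>+x. ennreal (X i x) \<partial>unif) \<le> ennreal (real (Suc i) powr (- q)) * (ennreal D * E)" for i
    proof -
      have "(\<integral>\<^sup>+x. ennreal (X i x) \<partial>unif) =
          (\<integral>\<^sup>+x. ennreal (real (Suc i) powr (- q)) * ennreal (R ((H ^^ i) x)) \<partial>unif)"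
        unfolding X_def using R_nonneg by (intro nn_integral_cong) (simp add: mult.commute flip: ennreal_mult)
      also have "\<dots> = ennreal (real (Suc i) powr (- q)) * (\<integral>\<^sup>+x. ennreal (R ((H ^^ i) x)) \<partial>unif)"
        by (rule nn_integral_cmult) measurable
      also have "\<dots> \<le> ennreal (real (Suc i) powr (- q)) * (ennreal D * E)"
        unfolding E_def by (intro mult_left_mono nn_integral_H_pow_le) auto
      finally show ?thesis .
    qed
    then have "(\<Sum>i. \<integral>\<^sup>+x. ennreal (X i x) \<partial>unif)
        \<le> (\<Sum>i. ennreal (real (Suc i) powr (- q)) * (ennreal D * E))"
      by (intro suminf_le) auto
    also have "\<dots> = (\<Sum>i. ennreal (real (Suc i) powr (- q))) * (ennreal D * E)"
      by (rule ennreal_suminf_multc)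
    also have "\<dots> < \<infinity>"
      using E sq by (simp add: suminf_ennreal2 ennreal_mult_less_top)
    finally show "(\<Sum>i. \<integral>\<^sup>+x. ennreal (X i x) \<partial>unif) < \<infinity>" .
    show "0 \<le> X i x" for i x using R_nonneg by (simp add: X_def)
  qed simp
  then show ?thesis
  proof (elim eventually_mono, elim exE conjE)
    fix x C assume C: "0 \<le> C" "\<forall>n. (\<Sum>i<n. X i x) \<le> C"
    have "real (\<tau> j x) \<le> C powr s' * real j powr s" for j
    proof (cases "j = 0")
      case False
      define a where "a = (\<lambda>i. real (Suc (entry ((H ^^ i) x))))"
      have tau: "real (\<tau> j x) = (\<Sum>i<j. a i)"
        by (induction j) (auto simp: tau_Suc a_def)
      have "real (\<tau> j x) powr p \<le> (\<Sum>i<j. a i powr p)"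
        unfolding tau using p by (intro powr_sum_le) (auto simp: a_def)
      also have "\<dots> \<le> (\<Sum>i<j. X i x * real j powr q)"
      proof (rule sum_mono)
        fix i assume "i \<in> {..<j}"
        then have "real (Suc i) powr q \<le> real j powr q"
          using q by (intro powr_mono2) auto
        then have "1 \<le> real (Suc i) powr (- q) * real j powr q"
          by (simp add: powr_minus field_simps del: of_nat_Suc)
        then have "R ((H ^^ i) x) * 1 \<le> R ((H ^^ i) x) * (real (Suc i) powr (- q) * real j powr q)"
          using R_nonneg by (intro mult_left_mono) auto
        then show "a i powr p \<le> X i x * real j powr q"
          by (simp add: a_def R_def X_def mult.assoc)
      qed
      also have "\<dots> \<le> C * real j powr q"
        unfolding sum_distrib_right[symmetric] using C by (intro mult_right_mono) auto
      finally have "(real (\<tau> j x) powr p) powr s' \<le> (C * real j powr q) powr s'"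
        using s' by (intro powr_mono2) auto
      then show ?thesis
        using s' C by (simp add: powr_powr p_def q_def powr_mult)
    qed simp
    then show "\<exists>C\<ge>0. \<forall>j. real (\<tau> j x) \<le> C * real j powr s"
      by (intro exI[of _ "C powr s'"]) auto
  qed
qed

section \<open>Approximation by functions of finitely many jumps\<close>

definition word_approximable :: "(real \<Rightarrow> real) \<Rightarrow> bool" where
  "word_approximable h \<longleftrightarrow> (\<forall>\<epsilon>>0. \<exists>n (\<psi> :: nat list \<Rightarrow> real).
     integrable unif (\<lambda>x. \<psi> (word n x)) \<and> (\<integral>x. \<bar>h x - \<psi> (word n x)\<bar> \<partial>unif) < \<epsilon>)"

lemma borel_measurable_word [measurable]: "(\<lambda>x. \<psi> (word n x) :: 'b :: topological_space) \<in> borel_measurable borel"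
  by (rule measurable_compose[OF measurable_word]) simp

lemma take_word: "n \<le> m \<Longrightarrow> take n (word m x) = word n x"
proof (induction m arbitrary: n x)
  case (Suc m)
  then show ?case by (cases n) auto
qed simp

lemma word_approximable_add:
  assumes "word_approximable h" "word_approximable k" "integrable unif h" "integrable unif k"
  shows "word_approximable (\<lambda>x. h x + k x)"
  unfolding word_approximable_def
proof (intro allI impI)
  fix \<epsilon> :: real assume "0 < \<epsilon>"
  then have e: "0 < \<epsilon> / 2" by simp
  obtain n1 \<psi>1 where 1: "integrable unif (\<lambda>x. \<psi>1 (word n1 x) :: real)"
    "(\<integral>x. \<bar>h x - \<psi>1 (word n1 x)\<bar> \<partial>unif) < \<epsilon> / 2"
    using assms(1) e unfolding word_approximable_def by blast
  obtain n2 \<psi>2 where 2: "integrable unif (\<lambda>x. \<psi>2 (word n2 x) :: real)"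
    "(\<integral>x. \<bar>k x - \<psi>2 (word n2 x)\<bar> \<partial>unif) < \<epsilon> / 2"
    using assms(2) e unfolding word_approximable_def by blast
  define n where "n = max n1 n2"
  define \<psi> where "\<psi> = (\<lambda>w. \<psi>1 (take n1 w) + \<psi>2 (take n2 w))"
  have \<psi>: "\<psi> (word n x) = \<psi>1 (word n1 x) + \<psi>2 (word n2 x)" for x
    by (simp add: \<psi>_def n_def take_word)
  have "(\<integral>x. \<bar>h x + k x - \<psi> (word n x)\<bar> \<partial>unif)
      \<le> (\<integral>x. \<bar>h x - \<psi>1 (word n1 x)\<bar> + \<bar>k x - \<psi>2 (word n2 x)\<bar> \<partial>unif)"
    unfolding \<psi> using assms 1 2 by (intro integral_mono) auto
  also have "\<dots> < \<epsilon>"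
    using assms 1 2 by (subst Bochner_Integration.integral_add) auto
  finally show "\<exists>n \<psi>. integrable unif (\<lambda>x. \<psi> (word n x)) \<and>
      (\<integral>x. \<bar>h x + k x - \<psi> (word n x)\<bar> \<partial>unif) < \<epsilon>"
    using 1 2 by (intro exI[of _ n] exI[of _ \<psi>]) (auto simp: \<psi>)
qed

lemma word_approximable_lim:
  assumes "integrable unif h"
    and "\<And>\<epsilon>. 0 < \<epsilon> \<Longrightarrow> \<exists>k. integrable unif k \<and> word_approximable k \<and> (\<integral>x. \<bar>h x - k x\<bar> \<partial>unif) < \<epsilon>"
  shows "word_approximable h"
  unfolding word_approximable_def
proof (intro allI impI)
  fix \<epsilon> :: real assume "0 < \<epsilon>"
  then have e: "0 < \<epsilon> / 2" by simp
  obtain k where k: "integrable unif k" "word_approximable k" "(\<integral>x. \<bar>h x - k x\<bar> \<partial>unif) < \<epsilon> / 2"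
    using assms(2)[OF e] by blast
  obtain n \<psi> where 1: "integrable unif (\<lambda>x. \<psi> (word n x) :: real)"
    "(\<integral>x. \<bar>k x - \<psi> (word n x)\<bar> \<partial>unif) < \<epsilon> / 2"
    using k(2) e unfolding word_approximable_def by blast
  have "(\<integral>x. \<bar>h x - \<psi> (word n x)\<bar> \<partial>unif)
      \<le> (\<integral>x. \<bar>h x - k x\<bar> + \<bar>k x - \<psi> (word n x)\<bar> \<partial>unif)"
    using assms k 1 by (intro integral_mono) auto
  also have "\<dots> < \<epsilon>"
    using assms k 1 by (subst Bochner_Integration.integral_add) auto
  finally show "\<exists>n \<psi>. integrable unif (\<lambda>x. \<psi> (word n x)) \<and>
      (\<integral>x. \<bar>h x - \<psi> (word n x)\<bar> \<partial>unif) < \<epsilon>"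
    using 1 by (intro exI[of _ n] exI[of _ \<psi>]) auto
qed

lemma word_approximable_cmult:
  assumes "word_approximable h"
  shows "word_approximable (\<lambda>x. c * h x)"
  unfolding word_approximable_def
proof (intro allI impI)
  fix \<epsilon> :: real assume "0 < \<epsilon>"
  then have e: "0 < \<epsilon> / (\<bar>c\<bar> + 1)" by simp
  obtain n \<psi> where 1: "integrable unif (\<lambda>x. \<psi> (word n x) :: real)"
    "(\<integral>x. \<bar>h x - \<psi> (word n x)\<bar> \<partial>unif) < \<epsilon> / (\<bar>c\<bar> + 1)"
    using assms e unfolding word_approximable_def by blast
  have "(\<integral>x. \<bar>c * h x - c * \<psi> (word n x)\<bar> \<partial>unif) = (\<integral>x. \<bar>c\<bar> * \<bar>h x - \<psi> (word n x)\<bar> \<partial>unif)"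
    by (simp add: abs_mult flip: right_diff_distrib)
  also have "\<dots> = \<bar>c\<bar> * (\<integral>x. \<bar>h x - \<psi> (word n x)\<bar> \<partial>unif)"
    by (rule Bochner_Integration.integral_mult_right_zero)
  also have "\<dots> \<le> (\<bar>c\<bar> + 1) * (\<integral>x. \<bar>h x - \<psi> (word n x)\<bar> \<partial>unif)"
    by (intro mult_right_mono) auto
  also have "\<dots> < \<epsilon>" using 1 by (simp add: field_simps)
  finally show "\<exists>n \<psi>. integrable unif (\<lambda>x. \<psi> (word n x)) \<and>
      (\<integral>x. \<bar>c * h x - \<psi> (word n x)\<bar> \<partial>unif) < \<epsilon>"
    using 1 by (intro exI[of _ n] exI[of _ "\<lambda>w. c * \<psi> w"]) auto
qed

lemma integrable_unif_indicator [simp]: "A \<in> sets borel \<Longrightarrow> integrable unif (indicator A :: real \<Rightarrow> real)"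
  by (simp add: unif.emeasure_eq_measure)

lemma measure_unif_interval_le:
  assumes "a \<le> b"
  shows "measure unif {a..b} \<le> b - a"
proof -
  have "emeasure unif {a..b} \<le> emeasure lborel {a..b}"
    by (subst emeasure_unif) (auto intro!: emeasure_mono)
  also have "\<dots> = ennreal (b - a)" using assms by simp
  finally show ?thesis
    using assms by (simp add: unif.emeasure_eq_measure ennreal_le_iff)
qed

text \<open>A cylinder of \<open>n\<close> jumps has length at most \<open>(1/2) ^ n\<close>, so only the one cylinder around the endpoint
\<open>a\<close> is misjudged.\<close>

lemma word_approximable_atMost: "word_approximable (indicator {..a})"
  unfolding word_approximable_def
proof (intro allI impI)
  fix \<epsilon> :: real assume "0 < \<epsilon>"
  then obtain n where n: "(1/2 :: real) ^ n < \<epsilon>" using real_arch_pow_inv[of \<epsilon> "1/2"] by auto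
  define W where "W = {w. \<exists>y. good y \<and> y \<le> a \<and> word n y = w}"
  have "(\<integral>x. \<bar>indicator {..a} x - indicator W (word n x)\<bar> \<partial>unif)
      \<le> (\<integral>x. (indicator {a..a + (1/2) ^ n} x :: real) \<partial>unif)"
  proof (rule integral_mono_AE)
    have "integrable unif (\<lambda>x. indicator {x. word n x \<in> W} x :: real)"
      by (rule integrable_unif_indicator) simp
    then have "integrable unif (\<lambda>x. indicator W (word n x) :: real)"
      by (rule back_subst[of "integrable unif"]) (auto split: split_indicator)
    then show "integrable unif (\<lambda>x. \<bar>indicator {..a} x - indicator W (word n x) :: real\<bar>)"
      by (intro integrable_abs Bochner_Integration.integrable_diff) auto
    show "AE x in unif. \<bar>indicator {..a} x - indicator W (word n x)\<bar> \<le> (indicator {a..a + (1/2) ^ n} x :: real)"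
      using AE_good
    proof eventually_elim
      case (elim x)
      show ?case
      proof (cases "x \<le> a")
        case True
        then have "word n x \<in> W" using elim by (auto simp: W_def)
        then show ?thesis using True by simp
      next
        case False
        show ?thesis
        proof (cases "word n x \<in> W")
          case True
          then obtain y where "good y" "y \<le> a" "word n y = word n x" by (auto simp: W_def)
          then have "\<bar>x - y\<bar> \<le> (1/2) ^ n" using elim by (intro word_determines) auto
          then have "x \<in> {a..a + (1/2) ^ n}" using False \<open>y \<le> a\<close> by auto
          then show ?thesis by (simp split: split_indicator)
        qed (use False in simp)
      qed
    qed
  qed auto
  also have "\<dots> = measure unif {a..a + (1/2) ^ n}" by simp
  also have "\<dots> \<le> (1/2) ^ n" using measure_unif_interval_le[of a "a + (1/2) ^ n"] by simp
  finally have "(\<integral>x. \<bar>indicator {..a} x - indicator W (word n x)\<bar> \<partial>unif) < \<epsilon>" using n by simp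
  moreover have "integrable unif (\<lambda>x. indicator W (word n x) :: real)"
  proof -
    have "integrable unif (\<lambda>x. indicator {x. word n x \<in> W} x :: real)"
      by (rule integrable_unif_indicator) simp
    then show ?thesis
      by (rule back_subst[of "integrable unif"]) (auto split: split_indicator)
  qed
  ultimately show "\<exists>n \<psi>. integrable unif (\<lambda>x. \<psi> (word n x)) \<and>
      (\<integral>x. \<bar>indicator {..a} x - \<psi> (word n x)\<bar> \<partial>unif) < \<epsilon>" by blast
qed

lemma word_approximable_1: "word_approximable (\<lambda>_. 1)"
  unfolding word_approximable_def by (auto intro!: exI[of _ "\<lambda>_. 1"])

lemma word_approximable_dominated_lim:
  fixes s :: "nat \<Rightarrow> real \<Rightarrow> real"
  assumes "\<And>i. integrable unif (s i)" "\<And>i. word_approximable (s i)"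
    and "\<And>x. (\<lambda>i. s i x) \<longlonglongrightarrow> h x" "\<And>i x. \<bar>s i x\<bar> \<le> w x"
    and [simp]: "integrable unif h" "integrable unif w"
  shows "word_approximable h"
proof (rule word_approximable_lim)
  fix \<epsilon> :: real assume \<epsilon>: "0 < \<epsilon>"
  have [measurable]: "s i \<in> borel_measurable borel" "h \<in> borel_measurable borel" for i
    using borel_measurable_integrable[OF assms(1)[of i]] borel_measurable_integrable[OF assms(5)] by simp_all
  have "(\<lambda>i. \<integral>x. \<bar>h x - s i x\<bar> \<partial>unif) \<longlonglongrightarrow> (\<integral>x. 0 \<partial>unif)"
  proof (rule integral_dominated_convergence[where w = "\<lambda>x. \<bar>h x\<bar> + w x"])
    show "AE x in unif. (\<lambda>i. \<bar>h x - s i x\<bar>) \<longlonglongrightarrow> 0"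
    proof (rule AE_I2)
      fix x
      have "(\<lambda>i. \<bar>h x - s i x\<bar>) \<longlonglongrightarrow> \<bar>h x - h x\<bar>"
        by (intro tendsto_intros assms)
      then show "(\<lambda>i. \<bar>h x - s i x\<bar>) \<longlonglongrightarrow> 0" by simp
    qed
    show "AE x in unif. norm \<bar>h x - s i x\<bar> \<le> \<bar>h x\<bar> + w x" for i
    proof (rule AE_I2)
      fix x show "norm \<bar>h x - s i x\<bar> \<le> \<bar>h x\<bar> + w x"
        using assms(4)[of i x] abs_triangle_ineq4[of "h x" "s i x"] by simp
    qed
  qed auto
  then have "\<forall>\<^sub>F i in sequentially. (\<integral>x. \<bar>h x - s i x\<bar> \<partial>unif) < \<epsilon>"
    using \<epsilon> by (intro order_tendstoD) auto
  then obtain i where "(\<integral>x. \<bar>h x - s i x\<bar> \<partial>unif) < \<epsilon>"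
    by (auto simp: eventually_sequentially)
  then show "\<exists>k. integrable unif k \<and> word_approximable k \<and> (\<integral>x. \<bar>h x - k x\<bar> \<partial>unif) < \<epsilon>"
    using assms by blast
qed fact

lemma word_approximable_indicator:
  assumes "A \<in> sets borel"
  shows "word_approximable (indicator A)"
proof -
  have A: "A \<in> sigma_sets UNIV (range (\<lambda>a::real. {..a}))"
    using assms by (simp add: borel_eq_atMost)
  have IS: "Int_stable (range (\<lambda>a::real. {..a}))"
  proof (rule Int_stableI_image)
    fix a b :: real show "\<exists>k\<in>UNIV. {..a} \<inter> {..b} = {..k}"
      by (intro bexI[of _ "min a b"]) auto
  qed
  show ?thesis
  proof (induction rule: sigma_sets_induct_disjoint[OF IS _ A, case_names closed basic empty compl union])
    case (basic A)
    then show ?case using word_approximable_atMost by auto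
  next
    case empty
    have "word_approximable (\<lambda>x. 0 * 1)" by (intro word_approximable_cmult word_approximable_1)
    then show ?case by simp
  next
    case (compl A)
    then have A: "A \<in> sets borel" by (simp add: borel_eq_atMost)
    have "word_approximable (\<lambda>x. 1 + (- 1) * indicator A x)"
      using A compl by (intro word_approximable_add word_approximable_cmult word_approximable_1) auto
    also have "(\<lambda>x. 1 + (- 1) * indicator A x) = (indicator (UNIV - A) :: real \<Rightarrow> real)"
      by (auto split: split_indicator)
    finally show ?case .
  next
    case (union A)
    then have A [measurable]: "A i \<in> sets borel" for i by (auto simp: borel_eq_atMost)
    have fin: "integrable unif (\<lambda>x. \<Sum>i<n. indicator (A i) x :: real) \<and>
        word_approximable (\<lambda>x. \<Sum>i<n. indicator (A i) x)" for n
    proof (induction n)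
      case 0
      have "word_approximable (\<lambda>x. 0 * 1)" by (intro word_approximable_cmult word_approximable_1)
      then show ?case by simp
    next
      case (Suc n)
      then show ?case using union A by (simp add: word_approximable_add)
    qed
    have eq: "(\<Sum>i<n. indicator (A i) x) = (indicator (\<Union>i<n. A i) x :: real)" for n x
      using union(1) by (intro indicator_UN_disjoint[symmetric]) (auto simp: disjoint_family_on_def)
    show ?case
    proof (rule word_approximable_dominated_lim[where s = "\<lambda>n x. \<Sum>i<n. indicator (A i) x" and w = "\<lambda>_. 1"])
      show "(\<lambda>n. \<Sum>i<n. indicator (A i) x) \<longlonglongrightarrow> (indicator (\<Union>i. A i) x :: real)" for x
        unfolding eq by (rule LIMSEQ_indicator_UN)
    qed (use fin in \<open>auto simp: eq split: split_indicator\<close>)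
  qed auto
qed

lemma word_approximable_integrable:
  assumes "integrable unif h"
  shows "word_approximable h"
  using assms
proof (induction rule: integrable_induct)
  case (base A c)
  then have "word_approximable (\<lambda>x. c * indicator A x)"
    by (intro word_approximable_cmult word_approximable_indicator) simp
  then show ?case by (simp add: mult.commute)
next
  case (add f g)
  then show ?case by (intro word_approximable_add)
next
  case (lim f s)
  show ?case
  proof (rule word_approximable_dominated_lim[where s = s and w = "\<lambda>x. 2 * \<bar>f x\<bar>"])
    show "integrable unif (s i)" "word_approximable (s i)" for i by (rule lim)+
    show "(\<lambda>i. s i x) \<longlonglongrightarrow> f x" for x using lim.hyps(2)[of x] by simp
    show "\<bar>s i x\<bar> \<le> 2 * \<bar>f x\<bar>" for i x using lim.hyps(3)[of x i] by simp
    show "integrable unif f" by (rule lim)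
    then show "integrable unif (\<lambda>x. 2 * \<bar>f x\<bar>)" by simp
  qed
qed

text \<open>The form used below: test functions \<open>u\<close> bounded by \<open>1\<close> cannot distinguish \<open>h\<close> from its
approximation by more than \<open>\<epsilon>\<close>, whatever \<open>u\<close> is.\<close>

lemma word_approximation:
  fixes h :: "real \<Rightarrow> real"
  assumes h: "integrable unif h" "\<And>x. 0 \<le> h x" and e: "0 < \<epsilon>"
  obtains n and \<psi> :: "nat list \<Rightarrow> ennreal" where
    "\<And>u. u \<in> borel_measurable borel \<Longrightarrow> (\<And>x. u x \<le> 1) \<Longrightarrow>
      (\<integral>\<^sup>+x. ennreal (h x) * u x \<partial>unif) \<le> (\<integral>\<^sup>+x. \<psi> (word n x) * u x \<partial>unif) + ennreal \<epsilon>"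
    "\<And>u. u \<in> borel_measurable borel \<Longrightarrow> (\<And>x. u x \<le> 1) \<Longrightarrow>
      (\<integral>\<^sup>+x. \<psi> (word n x) * u x \<partial>unif) \<le> (\<integral>\<^sup>+x. ennreal (h x) * u x \<partial>unif) + ennreal \<epsilon>"
proof -
  have [measurable]: "h \<in> borel_measurable borel"
    using borel_measurable_integrable[OF h(1)] by simp
  obtain n \<psi> where 1: "integrable unif (\<lambda>x. \<psi> (word n x) :: real)"
    "(\<integral>x. \<bar>h x - \<psi> (word n x)\<bar> \<partial>unif) < \<epsilon>"
    using word_approximable_integrable[OF h(1)] e unfolding word_approximable_def by blast
  have "(\<integral>\<^sup>+x. ennreal \<bar>h x - \<psi> (word n x)\<bar> \<partial>unif) = ennreal (\<integral>x. \<bar>h x - \<psi> (word n x)\<bar> \<partial>unif)"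
    using h 1 by (intro nn_integral_eq_integral) auto
  also have "\<dots> \<le> ennreal \<epsilon>" using 1 by (intro ennreal_leI) simp
  finally have d: "(\<integral>\<^sup>+x. ennreal \<bar>h x - \<psi> (word n x)\<bar> \<partial>unif) \<le> ennreal \<epsilon>" .
  have close: "(\<integral>\<^sup>+x. ennreal (p x) * u x \<partial>unif) \<le> (\<integral>\<^sup>+x. ennreal (q x) * u x \<partial>unif) + ennreal \<epsilon>"
    if [measurable]: "u \<in> borel_measurable borel" "p \<in> borel_measurable borel" "q \<in> borel_measurable borel"
      and u: "\<And>x. u x \<le> 1" and pq: "\<And>x. p x \<le> q x + \<bar>h x - \<psi> (word n x)\<bar>" "\<And>x. 0 \<le> q x" for u p q
  proof -
    have "(\<integral>\<^sup>+x. ennreal (p x) * u x \<partial>unif)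
        \<le> (\<integral>\<^sup>+x. ennreal (q x) * u x + ennreal \<bar>h x - \<psi> (word n x)\<bar> \<partial>unif)"
    proof (rule nn_integral_mono)
      fix x
      have "ennreal (p x) * u x \<le> (ennreal (q x) + ennreal \<bar>h x - \<psi> (word n x)\<bar>) * u x"
        using pq by (intro mult_right_mono) (auto simp flip: ennreal_plus intro!: ennreal_leI)
      also have "\<dots> \<le> ennreal (q x) * u x + ennreal \<bar>h x - \<psi> (word n x)\<bar> * 1"
        unfolding distrib_right using u by (intro add_left_mono mult_left_mono) auto
      finally show "ennreal (p x) * u x \<le> ennreal (q x) * u x + ennreal \<bar>h x - \<psi> (word n x)\<bar>" by simp
    qed
    also have "\<dots> = (\<integral>\<^sup>+x. ennreal (q x) * u x \<partial>unif) + (\<integral>\<^sup>+x. ennreal \<bar>h x - \<psi> (word n x)\<bar> \<partial>unif)"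
      by (rule nn_integral_add) measurable
    also have "\<dots> \<le> (\<integral>\<^sup>+x. ennreal (q x) * u x \<partial>unif) + ennreal \<epsilon>"
      using d by (intro add_left_mono)
    finally show ?thesis .
  qed
  show ?thesis
  proof (rule that[where n = n and \<psi> = "\<lambda>w. ennreal (max 0 (\<psi> w))"])
    fix u :: "real \<Rightarrow> ennreal" assume u: "u \<in> borel_measurable borel" "\<And>x. u x \<le> 1"
    have m: "(\<lambda>x. max 0 (\<psi> (word n x))) \<in> borel_measurable borel" by measurable
    have "h x \<le> max 0 (\<psi> (word n x)) + \<bar>h x - \<psi> (word n x)\<bar>" for x by linarith
    then show "(\<integral>\<^sup>+x. ennreal (h x) * u x \<partial>unif)
        \<le> (\<integral>\<^sup>+x. ennreal (max 0 (\<psi> (word n x))) * u x \<partial>unif) + ennreal \<epsilon>"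
      using u m by (intro close) auto
    have "max 0 (\<psi> (word n x)) \<le> h x + \<bar>h x - \<psi> (word n x)\<bar>" for x using h(2)[of x] by linarith
    then show "(\<integral>\<^sup>+x. ennreal (max 0 (\<psi> (word n x))) * u x \<partial>unif)
        \<le> (\<integral>\<^sup>+x. ennreal (h x) * u x \<partial>unif) + ennreal \<epsilon>"
      using u m h by (intro close) auto
  qed
qed

lemma quasi_independence_word:
  assumes [measurable]: "A \<in> sets borel"
  shows "(\<integral>\<^sup>+x. \<psi> (word n x) \<partial>unif) * emeasure unif A
      \<le> ennreal D * (\<integral>\<^sup>+x. \<psi> (word n x) * indicator A ((H ^^ n) x) \<partial>unif)"
    and "(\<integral>\<^sup>+x. \<psi> (word n x) * indicator A ((H ^^ n) x) \<partial>unif)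
      \<le> ennreal D * ((\<integral>\<^sup>+x. \<psi> (word n x) \<partial>unif) * emeasure unif A)"
  using quasi_independence[OF flat_1, of "indicator A :: real \<Rightarrow> ennreal" \<psi> n] by simp_all

text \<open>An initial density that depends on \<open>n\<close> jumps only is forgotten after time \<open>n\<close>, up to the factor \<open>D\<close>;
a general density is approximated by such ones. A bound \<open>e\<close> that holds for all times survives the
limit.\<close>

lemma mixing_lower:
  fixes h :: "real \<Rightarrow> real"
  assumes h: "integrable unif h" "\<And>x. 0 \<le> h x" and A [measurable]: "A \<in> sets borel"
    and e: "\<And>n. (\<integral>\<^sup>+x. ennreal (h x) * indicator A ((H ^^ n) x) \<partial>unif) \<le> e"
  shows "emeasure unif A * (\<integral>\<^sup>+x. ennreal (h x) \<partial>unif) \<le> ennreal D * e"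
proof (rule ennreal_le_epsilon)
  fix \<epsilon> :: real assume \<epsilon>: "0 < \<epsilon>"
  define \<delta> where "\<delta> = \<epsilon> / (D + 1)"
  have \<delta>: "0 < \<delta>" using \<epsilon> D_ge_1 by (simp add: \<delta>_def)
  obtain n \<psi> where
    1: "\<And>u. u \<in> borel_measurable borel \<Longrightarrow> (\<And>x. u x \<le> 1) \<Longrightarrow>
      (\<integral>\<^sup>+x. ennreal (h x) * u x \<partial>unif) \<le> (\<integral>\<^sup>+x. \<psi> (word n x) * u x \<partial>unif) + ennreal \<delta>" and
    2: "\<And>u. u \<in> borel_measurable borel \<Longrightarrow> (\<And>x. u x \<le> 1) \<Longrightarrow>
      (\<integral>\<^sup>+x. \<psi> (word n x) * u x \<partial>unif) \<le> (\<integral>\<^sup>+x. ennreal (h x) * u x \<partial>unif) + ennreal \<delta>"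
    by (rule word_approximation[OF h \<delta>]) blast
  have "emeasure unif A * (\<integral>\<^sup>+x. ennreal (h x) \<partial>unif)
      \<le> emeasure unif A * ((\<integral>\<^sup>+x. \<psi> (word n x) \<partial>unif) + ennreal \<delta>)"
    using 1[of "\<lambda>_. 1"] by (intro mult_left_mono) auto
  also have "\<dots> \<le> (\<integral>\<^sup>+x. \<psi> (word n x) \<partial>unif) * emeasure unif A + 1 * ennreal \<delta>"
    unfolding distrib_left
    by (intro add_mono mult_right_mono emeasure_unif_le_1) (simp_all add: mult.commute)
  also have "\<dots> \<le> ennreal D * (\<integral>\<^sup>+x. \<psi> (word n x) * indicator A ((H ^^ n) x) \<partial>unif) + 1 * ennreal \<delta>"
    by (intro add_right_mono quasi_independence_word(1)) simp
  also have "\<dots> \<le> ennreal D * (e + ennreal \<delta>) + 1 * ennreal \<delta>"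
  proof (intro add_right_mono mult_left_mono)
    have "(\<integral>\<^sup>+x. \<psi> (word n x) * indicator A ((H ^^ n) x) \<partial>unif)
        \<le> (\<integral>\<^sup>+x. ennreal (h x) * indicator A ((H ^^ n) x) \<partial>unif) + ennreal \<delta>"
      by (rule 2) (auto split: split_indicator)
    also have "\<dots> \<le> e + ennreal \<delta>" by (intro add_right_mono e)
    finally show "(\<integral>\<^sup>+x. \<psi> (word n x) * indicator A ((H ^^ n) x) \<partial>unif) \<le> e + ennreal \<delta>" .
  qed simp
  also have "\<dots> = ennreal D * e + (ennreal D * ennreal \<delta> + ennreal \<delta>)"
    by (simp add: distrib_left add.assoc)
  also have "ennreal D * ennreal \<delta> + ennreal \<delta> = ennreal (D * \<delta> + \<delta>)"
    using \<delta> D_ge_1 by (simp add: ennreal_mult)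
  also have "D * \<delta> + \<delta> = (D + 1) * \<delta>" by (simp add: algebra_simps)
  also have "\<dots> = \<epsilon>" using D_ge_1 by (simp add: \<delta>_def)
  finally show "emeasure unif A * (\<integral>\<^sup>+x. ennreal (h x) \<partial>unif) \<le> ennreal D * e + ennreal \<epsilon>" .
qed

text \<open>The counterpart of \<open>mixing_lower\<close> for bounds from below on the mass of \<open>A\<close>.\<close>

lemma mixing_upper:
  fixes h :: "real \<Rightarrow> real"
  assumes h: "integrable unif h" "\<And>x. 0 \<le> h x" and A [measurable]: "A \<in> sets borel"
    and e: "\<And>n. e \<le> (\<integral>\<^sup>+x. ennreal (h x) * indicator A ((H ^^ n) x) \<partial>unif)"
  shows "e \<le> ennreal D * ((\<integral>\<^sup>+x. ennreal (h x) \<partial>unif) * emeasure unif A)"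
proof (rule ennreal_le_epsilon)
  fix \<epsilon> :: real assume \<epsilon>: "0 < \<epsilon>"
  define \<delta> where "\<delta> = \<epsilon> / (D + 1)"
  have \<delta>: "0 < \<delta>" using \<epsilon> D_ge_1 by (simp add: \<delta>_def)
  obtain n \<psi> where
    1: "\<And>u. u \<in> borel_measurable borel \<Longrightarrow> (\<And>x. u x \<le> 1) \<Longrightarrow>
      (\<integral>\<^sup>+x. ennreal (h x) * u x \<partial>unif) \<le> (\<integral>\<^sup>+x. \<psi> (word n x) * u x \<partial>unif) + ennreal \<delta>" and
    2: "\<And>u. u \<in> borel_measurable borel \<Longrightarrow> (\<And>x. u x \<le> 1) \<Longrightarrow>
      (\<integral>\<^sup>+x. \<psi> (word n x) * u x \<partial>unif) \<le> (\<integral>\<^sup>+x. ennreal (h x) * u x \<partial>unif) + ennreal \<delta>"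
    by (rule word_approximation[OF h \<delta>]) blast
  have "e \<le> (\<integral>\<^sup>+x. ennreal (h x) * indicator A ((H ^^ n) x) \<partial>unif)" by (rule e)
  also have "\<dots> \<le> (\<integral>\<^sup>+x. \<psi> (word n x) * indicator A ((H ^^ n) x) \<partial>unif) + ennreal \<delta>"
    by (rule 1) (auto split: split_indicator)
  also have "\<dots> \<le> ennreal D * ((\<integral>\<^sup>+x. \<psi> (word n x) \<partial>unif) * emeasure unif A) + ennreal \<delta>"
    by (intro add_right_mono quasi_independence_word(2)) simp
  also have "\<dots> \<le> ennreal D * (((\<integral>\<^sup>+x. ennreal (h x) \<partial>unif) + ennreal \<delta>) * emeasure unif A) + ennreal \<delta>"
    using 2[of "\<lambda>_. 1"] by (intro add_right_mono mult_left_mono mult_right_mono) auto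
  also have "\<dots> \<le> ennreal D * ((\<integral>\<^sup>+x. ennreal (h x) \<partial>unif) * emeasure unif A + ennreal \<delta> * 1) + ennreal \<delta>"
    unfolding distrib_right
    by (intro add_right_mono mult_left_mono add_left_mono emeasure_unif_le_1) auto
  also have "\<dots> = ennreal D * ((\<integral>\<^sup>+x. ennreal (h x) \<partial>unif) * emeasure unif A) +
      (ennreal D * ennreal \<delta> + ennreal \<delta>)"
    by (simp add: distrib_left add.assoc)
  also have "ennreal D * ennreal \<delta> + ennreal \<delta> = ennreal (D * \<delta> + \<delta>)"
    using \<delta> D_ge_1 by (simp add: ennreal_mult)
  also have "D * \<delta> + \<delta> = (D + 1) * \<delta>" by (simp add: algebra_simps)
  also have "\<dots> = \<epsilon>" using D_ge_1 by (simp add: \<delta>_def)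
  finally show "e \<le> ennreal D * ((\<integral>\<^sup>+x. ennreal (h x) \<partial>unif) * emeasure unif A) + ennreal \<epsilon>" .
qed

end

section \<open>Comparison of the invariant measure with Lebesgue measure\<close>

text \<open>The invariant measure is carried by all of \<open>\<real>\<close> here, with the complement of \<open>(0, 1)\<close> being null, to
match \<open>unif\<close>.\<close>

locale intermittent_invariant = intermittent +
  fixes \<nu> :: "real measure"
  assumes sets_nu [measurable_cong, simp]: "sets \<nu> = sets borel"
    and invariant: "\<And>A. A \<in> sets borel \<Longrightarrow> emeasure \<nu> (f -` A) = emeasure \<nu> A"
    and null: "\<And>A. A \<in> sets borel \<Longrightarrow> emeasure unif A = 0 \<Longrightarrow> emeasure \<nu> A = 0"
    and nonzero: "emeasure \<nu> UNIV \<noteq> 0"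
    and sigma_finite: "sigma_finite_measure \<nu>"
begin

lemma space_nu [simp]: "space \<nu> = UNIV"
  using sets_eq_imp_space_eq[OF sets_nu] by simp

lemma borel_f_vimage [simp]: "A \<in> sets borel \<Longrightarrow> f -` A \<in> sets borel"
  using measurable_sets_borel[OF borel_measurable_f, of A] by simp

lemma borel_f_pow_vimage [simp]: "A \<in> sets borel \<Longrightarrow> (f ^^ n) -` A \<in> sets borel"
  using measurable_sets_borel[OF borel_measurable_f_pow, of A n] by simp

lemma borel_H_pow_vimage [simp]: "A \<in> sets borel \<Longrightarrow> (H ^^ n) -` A \<in> sets borel"
  using measurable_sets_borel[OF borel_measurable_H_pow, of A n] by simp

lemma invariant_pow: "A \<in> sets borel \<Longrightarrow> emeasure \<nu> ((f ^^ n) -` A) = emeasure \<nu> A"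
proof (induction n)
  case (Suc n)
  have "(f ^^ Suc n) -` A = f -` ((f ^^ n) -` A)"
    by (auto simp: funpow_swap1)
  then show ?case using Suc by (simp only: invariant borel_f_pow_vimage)
qed simp

lemma nu_outside: "emeasure \<nu> (- {0<..<1}) = 0"
  by (rule null) (simp_all add: emeasure_unif)

text \<open>The distribution, under \<open>\<nu>\<close>, of the points at which excursions start: the images under \<open>f\<close> of
points of the right half.\<close>

definition \<eta> :: "real measure" where
  "\<eta> = distr (density \<nu> (indicator {1/2..})) borel f"

lemma sets_eta [measurable_cong, simp]: "sets \<eta> = sets borel"
  by (simp add: \<eta>_def)

lemma space_eta [simp]: "space \<eta> = UNIV"
  by (simp add: \<eta>_def)

lemma emeasure_eta:
  assumes "A \<in> sets borel"
  shows "emeasure \<eta> A = emeasure \<nu> ({1/2..} \<inter> f -` A)"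
proof -
  have [measurable]: "f -` A \<in> sets borel" using assms by simp
  have "emeasure \<eta> A = emeasure (density \<nu> (indicator {1/2..})) (f -` A)"
    unfolding \<eta>_def using assms by (subst emeasure_distr) auto
  also have "\<dots> = (\<integral>\<^sup>+x. indicator {1/2..} x * indicator (f -` A) x \<partial>\<nu>)"
    by (rule emeasure_density) auto
  also have "\<dots> = (\<integral>\<^sup>+x. indicator ({1/2..} \<inter> f -` A) x \<partial>\<nu>)"
    by (intro nn_integral_cong) (auto split: split_indicator)
  also have "\<dots> = emeasure \<nu> ({1/2..} \<inter> f -` A)" by (rule nn_integral_indicator) auto
  finally show ?thesis .
qed

lemma eta_null:
  assumes "A \<in> sets borel" "emeasure unif A = 0"
  shows "emeasure \<eta> A = 0"
proof -
  have "emeasure \<eta> A \<le> emeasure \<nu> (f -` A)"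
    unfolding emeasure_eta[OF assms(1)] using assms by (intro emeasure_mono) auto
  also have "\<dots> = 0" using assms by (simp add: invariant null)
  finally show ?thesis by simp
qed

text \<open>For \<open>n\<close> fixed, sort the points of \<open>(f ^^ n) -` B\<close> by the last time before \<open>n\<close> at which they are in the
right half. By invariance the \<open>i\<close>-th term is the measure of a set of points with last time \<open>n - 1 - i\<close>.\<close>

lemma kac_visits:
  assumes B [measurable]: "B \<in> sets borel"
  shows "(\<Sum>i. emeasure \<eta> {x. i \<le> entry x \<and> (f ^^ i) x \<in> B}) \<le> emeasure \<nu> B"
proof (rule suminf_le_const)
  fix n
  define E where "E = (\<lambda>i. {y. 1/2 \<le> y \<and> i \<le> entry (f y) \<and> (f ^^ i) (f y) \<in> B})"
  define F where "F = (\<lambda>i. (f ^^ (n - 1 - i)) -` E i)"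
  have E [simp]: "E i \<in> sets borel" for i unfolding E_def by measurable
  have F [simp]: "F i \<in> sets borel" for i unfolding F_def by simp
  have "emeasure \<eta> {x. i \<le> entry x \<and> (f ^^ i) x \<in> B} = emeasure \<nu> (F i)" for i
  proof -
    have "{x. i \<le> entry x \<and> (f ^^ i) x \<in> B} \<in> sets borel" by measurable
    then have "emeasure \<eta> {x. i \<le> entry x \<and> (f ^^ i) x \<in> B} =
        emeasure \<nu> ({1/2..} \<inter> f -` {x. i \<le> entry x \<and> (f ^^ i) x \<in> B})" by (rule emeasure_eta)
    also have "{1/2..} \<inter> f -` {x. i \<le> entry x \<and> (f ^^ i) x \<in> B} = E i"
      by (auto simp: E_def)
    also have "emeasure \<nu> (E i) = emeasure \<nu> (F i)" by (simp add: F_def invariant_pow)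
    finally show ?thesis .
  qed
  then have "(\<Sum>i<n. emeasure \<eta> {x. i \<le> entry x \<and> (f ^^ i) x \<in> B}) = (\<Sum>i<n. emeasure \<nu> (F i))"
    by simp
  also have "\<dots> = emeasure \<nu> (\<Union>i<n. F i)"
  proof (rule sum_emeasure)
    have "F i \<inter> F j = {}" if "i < j" "j < n" for i j
    proof (rule ccontr)
      assume "F i \<inter> F j \<noteq> {}"
      then obtain x where x: "(f ^^ (n - 1 - i)) x \<in> E i" "(f ^^ (n - 1 - j)) x \<in> E j"
        by (auto simp: F_def)
      define y where "y = (f ^^ (n - 1 - j)) x"
      have "n - 1 - i = (j - i - 1) + 1 + (n - 1 - j)" using that by simp
      then have "(f ^^ (n - 1 - i)) x = (f ^^ (j - i - 1)) (f y)"
        by (simp only: funpow_add comp_apply y_def) simp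
      then have "1/2 \<le> (f ^^ (j - i - 1)) (f y)" using x by (simp add: E_def)
      moreover have "j \<le> entry (f y)" using x by (simp add: E_def y_def)
      then have "j - i - 1 < entry (f y)" using that by linarith
      ultimately show False using f_pow_less_entry[of "j - i - 1" "f y"] by simp
    qed
    then show "disjoint_family_on F {..<n}"
      unfolding disjoint_family_on_def by (metis Int_commute lessThan_iff linorder_neqE_nat)
  qed auto
  also have "\<dots> \<le> emeasure \<nu> ((f ^^ n) -` B)"
  proof (rule emeasure_mono)
    show "(\<Union>i<n. F i) \<subseteq> (f ^^ n) -` B"
    proof safe
      fix i x assume i: "i < n" and "x \<in> F i"
      then have "(f ^^ i) (f ((f ^^ (n - 1 - i)) x)) \<in> B" by (simp add: F_def E_def)
      moreover have "(f ^^ n) x = (f ^^ (i + 1 + (n - 1 - i))) x" using i by simp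
      ultimately show "x \<in> (f ^^ n) -` B" by (simp only: funpow_add comp_apply vimage_eq) simp
    qed
  qed simp
  also have "\<dots> = emeasure \<nu> B" by (simp add: invariant_pow)
  finally show "(\<Sum>i<n. emeasure \<eta> {x. i \<le> entry x \<and> (f ^^ i) x \<in> B}) \<le> emeasure \<nu> B" .
qed auto

lemma AE_eta:
  assumes "AE x in unif. P x" and [measurable]: "Measurable.pred borel P"
  shows "AE x in \<eta>. P x"
proof -
  have "emeasure unif {x. \<not> P x} = 0"
    using assms(1) by (subst (asm) AE_iff_measurable[OF _ refl]) auto
  then have "emeasure \<eta> {x. \<not> P x} = 0" by (intro eta_null) auto
  then show ?thesis by (subst AE_iff_measurable[OF _ refl]) auto
qed

lemma pred_unit_interval: "Measurable.pred borel (\<lambda>x::real. 0 < x \<and> x < 1)"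
  by measurable

text \<open>A point of \<open>H -` A\<close> makes an excursion that ends in the right half at a preimage of \<open>A\<close>, so
\<open>kac_visits\<close> applies to \<open>{1/2..} \<inter> f -` A\<close>. Equality is available only once \<open>\<eta>\<close> is known to be
finite.\<close>

lemma eta_H_le:
  assumes A [measurable]: "A \<in> sets borel"
  shows "emeasure \<eta> (H -` A) \<le> emeasure \<eta> A"
proof -
  define B where "B = {1/2..} \<inter> f -` A"
  have B [measurable]: "B \<in> sets borel" by (simp add: B_def)
  have "emeasure \<eta> (H -` A) = (\<integral>\<^sup>+x. indicator A (H x) \<partial>\<eta>)"
  proof -
    have "H -` A \<in> sets borel" using borel_H_pow_vimage[OF A, of 1] by simp
    then have "emeasure \<eta> (H -` A) = (\<integral>\<^sup>+x. indicator (H -` A) x \<partial>\<eta>)" by simp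
    then show ?thesis by (simp add: indicator_def)
  qed
  also have "\<dots> \<le> (\<integral>\<^sup>+x. (\<Sum>i. indicator {x. i \<le> entry x \<and> (f ^^ i) x \<in> B} x) \<partial>\<eta>)"
  proof (rule nn_integral_mono_AE)
    show "AE x in \<eta>. indicator A (H x) \<le> (\<Sum>i. indicator {x. i \<le> entry x \<and> (f ^^ i) x \<in> B} x :: ennreal)"
      using AE_eta[OF AE_unif pred_unit_interval]
    proof eventually_elim
      case (elim x)
      show ?case
      proof (cases "H x \<in> A")
        case True
        then have "x \<in> {x. entry x \<le> entry x \<and> (f ^^ entry x) x \<in> B}"
          using f_pow_entry[of x] elim by (simp add: B_def H_def)
        then have "(1::ennreal) = (\<Sum>i\<in>{entry x}. indicator {x. i \<le> entry x \<and> (f ^^ i) x \<in> B} x)"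
          by simp
        also have "\<dots> \<le> (\<Sum>i. indicator {x. i \<le> entry x \<and> (f ^^ i) x \<in> B} x)"
          by (rule sum_le_suminf) auto
        finally show ?thesis using True by simp
      qed simp
    qed
  qed
  also have "\<dots> = (\<Sum>i. emeasure \<eta> {x. i \<le> entry x \<and> (f ^^ i) x \<in> B})"
  proof (subst nn_integral_suminf)
    have "{x. i \<le> entry x \<and> (f ^^ i) x \<in> B} \<in> sets borel" for i by measurable
    then show "(\<Sum>i. \<integral>\<^sup>+x. indicator {x. i \<le> entry x \<and> (f ^^ i) x \<in> B} x \<partial>\<eta>) =
        (\<Sum>i. emeasure \<eta> {x. i \<le> entry x \<and> (f ^^ i) x \<in> B})" by simp
  qed measurable
  also have "\<dots> \<le> emeasure \<nu> B" by (rule kac_visits) simp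
  also have "\<dots> = emeasure \<eta> A" by (simp add: emeasure_eta B_def)
  finally show ?thesis .
qed

lemma eta_H_pow_le:
  assumes "A \<in> sets borel"
  shows "emeasure \<eta> ((H ^^ n) -` A) \<le> emeasure \<eta> A"
  using assms
proof (induction n)
  case (Suc n)
  have "(H ^^ Suc n) -` A = H -` ((H ^^ n) -` A)" by (auto simp: funpow_swap1)
  then show ?case using Suc eta_H_le[of "(H ^^ n) -` A"] by (simp del: funpow.simps)
qed simp

definition \<rho> :: "real \<Rightarrow> ennreal" where "\<rho> = RN_deriv unif \<eta>"

lemma borel_measurable_rho [measurable]: "\<rho> \<in> borel_measurable borel"
  using borel_measurable_RN_deriv[of unif \<eta>] by (simp add: \<rho>_def)

lemma density_rho: "density unif \<rho> = \<eta>"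
  unfolding \<rho>_def
proof (rule unif.density_RN_deriv)
  show "absolutely_continuous unif \<eta>"
    unfolding absolutely_continuous_def by (auto simp: null_sets_def eta_null)
qed simp

lemma emeasure_eta_rho:
  assumes [measurable]: "A \<in> sets borel"
  shows "emeasure \<eta> ((H ^^ n) -` A) = (\<integral>\<^sup>+x. \<rho> x * indicator A ((H ^^ n) x) \<partial>unif)"
proof -
  have "emeasure \<eta> ((H ^^ n) -` A) = (\<integral>\<^sup>+x. \<rho> x * indicator ((H ^^ n) -` A) x \<partial>unif)"
    by (subst density_rho[symmetric], rule emeasure_density) auto
  then show ?thesis by (simp add: indicator_def)
qed

text \<open>The density of \<open>\<eta>\<close> may at this stage be infinite, so \<open>mixing_lower\<close> is applied to its truncations
and the supremum is taken.\<close>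

lemma unif_le_eta:
  assumes A [measurable]: "A \<in> sets borel"
  shows "emeasure unif A * emeasure \<eta> UNIV \<le> ennreal D * emeasure \<eta> A"
proof -
  define h where "h = (\<lambda>K x. enn2real (min (\<rho> x) (of_nat K)))"
  have hK: "ennreal (h K x) = min (\<rho> x) (of_nat K)" for K x
    by (simp add: h_def ennreal_enn2real_if min_def top_unique)
  have h_le: "\<bar>h K x\<bar> \<le> real K" for K x
  proof -
    have "ennreal (h K x) \<le> ennreal (real K)" unfolding hK by (simp add: ennreal_of_nat_eq_real_of_nat)
    moreover have "0 \<le> h K x" by (simp add: h_def)
    ultimately show ?thesis by (simp add: ennreal_le_iff)
  qed
  have [measurable]: "h K \<in> borel_measurable borel" for K unfolding h_def by measurable
  have "emeasure unif A * (\<integral>\<^sup>+x. min (\<rho> x) (of_nat K) \<partial>unif) \<le> ennreal D * emeasure \<eta> A" for K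
    unfolding hK[symmetric]
  proof (rule mixing_lower)
    show "integrable unif (h K)"
      by (rule unif.integrable_const_bound[where B = "real K"]) (auto simp: h_le)
    fix n
    have "(\<integral>\<^sup>+x. ennreal (h K x) * indicator A ((H ^^ n) x) \<partial>unif)
        \<le> (\<integral>\<^sup>+x. \<rho> x * indicator A ((H ^^ n) x) \<partial>unif)"
      unfolding hK by (intro nn_integral_mono mult_right_mono) auto
    also have "\<dots> \<le> emeasure \<eta> A"
      using eta_H_pow_le[OF A, of n] by (simp add: emeasure_eta_rho)
    finally show "(\<integral>\<^sup>+x. ennreal (h K x) * indicator A ((H ^^ n) x) \<partial>unif) \<le> emeasure \<eta> A" .
  qed (auto simp: h_def)
  then have "(SUP K. emeasure unif A * (\<integral>\<^sup>+x. min (\<rho> x) (of_nat K) \<partial>unif)) \<le> ennreal D * emeasure \<eta> A"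
    by (intro SUP_least)
  also have "(SUP K. emeasure unif A * (\<integral>\<^sup>+x. min (\<rho> x) (of_nat K) \<partial>unif)) =
      emeasure unif A * (SUP K. \<integral>\<^sup>+x. min (\<rho> x) (of_nat K) \<partial>unif)"
    by (rule SUP_mult_left_ennreal[symmetric])
  also have "(SUP K. \<integral>\<^sup>+x. min (\<rho> x) (of_nat K) \<partial>unif) = (\<integral>\<^sup>+x. (SUP K. min (\<rho> x) (of_nat K)) \<partial>unif)"
  proof (rule nn_integral_monotone_convergence_SUP[symmetric])
    show "incseq (\<lambda>K x. min (\<rho> x) (of_nat K))"
      unfolding incseq_def le_fun_def by (intro allI impI min.mono order_refl of_nat_mono)
  qed measurable
  also have "(\<integral>\<^sup>+x. (SUP K. min (\<rho> x) (of_nat K)) \<partial>unif) = (\<integral>\<^sup>+x. \<rho> x \<partial>unif)"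
  proof (rule nn_integral_cong)
    fix x show "(SUP K. min (\<rho> x) (of_nat K)) = \<rho> x"
      using inf_SUP[of "\<rho> x" "\<lambda>K::nat. of_nat K :: ennreal" UNIV]
      by (simp add: ennreal_SUP_of_nat_eq_top inf_min)
  qed
  also have "(\<integral>\<^sup>+x. \<rho> x \<partial>unif) = emeasure \<eta> UNIV"
    using emeasure_eta_rho[of UNIV 0] by simp
  finally show ?thesis .
qed

lemma nu_right_half:
  assumes [measurable]: "A \<in> sets borel"
  shows "emeasure \<nu> (A \<inter> {1/2..}) = emeasure \<eta> {x. (x + 1) / 2 \<in> A}"
proof -
  have "{x. (x + 1) / 2 \<in> A} \<in> sets borel" by measurable
  then have "emeasure \<eta> {x. (x + 1) / 2 \<in> A} = emeasure \<nu> ({1/2..} \<inter> f -` {x. (x + 1) / 2 \<in> A})"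
    by (rule emeasure_eta)
  also have "{1/2..} \<inter> f -` {x. (x + 1) / 2 \<in> A} = A \<inter> {1/2..}"
    by (auto simp: f_right)
  finally show ?thesis by simp
qed

lemma eta_UNIV_pos: "emeasure \<eta> UNIV \<noteq> 0"
proof
  assume "emeasure \<eta> UNIV = 0"
  then have 0: "emeasure \<nu> {1/2..} = 0" by (simp add: emeasure_eta)
  have "emeasure \<nu> ((f ^^ i) -` {1/2..}) = 0" for i using 0 by (simp add: invariant_pow)
  moreover define V where "V = (\<Union>i. (f ^^ i) -` {1/2..})"
  ultimately have V0: "emeasure \<nu> V = 0"
    unfolding V_def by (intro emeasure_UN_eq_0) auto
  have V: "V \<in> sets \<nu>"
    unfolding sets_nu V_def by (intro sets.countable_nat_UN) auto
  have "UNIV \<subseteq> V \<union> - {0<..<1}"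
  proof
    fix x :: real
    show "x \<in> V \<union> - {0<..<1}"
      using f_pow_entry[of x] by (cases "0 < x \<and> x < 1") (auto simp: V_def)
  qed
  then have "emeasure \<nu> UNIV \<le> emeasure \<nu> (V \<union> - {0<..<1})"
    using V by (intro emeasure_mono) auto
  also have "\<dots> \<le> emeasure \<nu> V + emeasure \<nu> (- {0<..<1})"
    using V by (intro emeasure_subadditive) auto
  finally have "emeasure \<nu> UNIV = 0" using nu_outside V0 by simp
  then show False using nonzero by simp
qed

text \<open>Otherwise \<open>unif_le_eta\<close> would give infinite mass to every set of positive Lebesgue measure, which is
incompatible with \<open>\<sigma>\<close>-finiteness.\<close>

lemma eta_UNIV_finite: "emeasure \<eta> UNIV < \<infinity>"
proof (rule ccontr)
  assume "\<not> emeasure \<eta> UNIV < \<infinity>"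
  then have inf: "emeasure \<eta> UNIV = \<infinity>" by (simp flip: less_top)
  interpret sigma_finite_measure \<nu> by (rule sigma_finite)
  obtain A :: "nat \<Rightarrow> real set" where A: "range A \<subseteq> sets \<nu>" "(\<Union>i. A i) = space \<nu>"
    "\<And>i. emeasure \<nu> (A i) \<noteq> \<infinity>" using sigma_finite by metis
  have Ai [measurable]: "A i \<in> sets borel" for i using A by auto
  have "emeasure \<nu> (A i \<inter> {1/2..}) = 0" for i
  proof -
    let ?B = "{x. (x + 1) / 2 \<in> A i}"
    have B: "?B \<in> sets borel" by measurable
    have e: "emeasure \<eta> ?B = emeasure \<nu> (A i \<inter> {1/2..})" by (simp add: nu_right_half)
    have "emeasure \<nu> (A i \<inter> {1/2..}) \<le> emeasure \<nu> (A i)" by (intro emeasure_mono) auto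
    then have "emeasure \<eta> ?B < top" using A(3)[of i] e by (auto simp: less_top intro: le_less_trans)
    then have "ennreal D * emeasure \<eta> ?B < top" by (simp add: ennreal_mult_less_top)
    then have "emeasure unif ?B * top < top"
      using unif_le_eta[OF B] unfolding inf by (simp add: le_less_trans)
    then have "emeasure unif ?B = 0" by (auto simp: ennreal_mult_less_top)
    then show ?thesis using eta_null[OF B] e by simp
  qed
  then have "emeasure \<nu> (\<Union>i. A i \<inter> {1/2..}) = 0" by (intro emeasure_UN_eq_0) auto
  also have "(\<Union>i. A i \<inter> {1/2..}) = {1/2..}" using A(2) by auto
  finally have "emeasure \<eta> UNIV = 0" by (simp add: emeasure_eta)
  then show False using inf by simp
qed

text \<open>A finite measure that does not increase on any set does not decrease on any set either: consider
the complement.\<close>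

lemma eta_H_pow:
  assumes A: "A \<in> sets borel"
  shows "emeasure \<eta> ((H ^^ n) -` A) = emeasure \<eta> A"
proof (rule antisym[OF eta_H_pow_le[OF A]], rule ccontr)
  assume "\<not> emeasure \<eta> A \<le> emeasure \<eta> ((H ^^ n) -` A)"
  then have less: "emeasure \<eta> ((H ^^ n) -` A) < emeasure \<eta> A" by simp
  have fin: "emeasure \<eta> X \<noteq> top" for X
    using emeasure_space[of \<eta> X] eta_UNIV_finite by (auto simp: top_unique)
  have "emeasure \<eta> UNIV = emeasure \<eta> ((H ^^ n) -` A) + emeasure \<eta> ((H ^^ n) -` (- A))"
    using A by (subst plus_emeasure) (auto intro!: arg_cong[where f = "emeasure \<eta>"])
  also have "\<dots> \<le> emeasure \<eta> ((H ^^ n) -` A) + emeasure \<eta> (- A)"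
    using A by (intro add_left_mono eta_H_pow_le) auto
  also have "\<dots> < emeasure \<eta> A + emeasure \<eta> (- A)"
    using less fin[of "- A"] by (subst (1 2) add.commute) (simp add: ennreal_add_left_cancel_less less_top)
  also have "\<dots> = emeasure \<eta> UNIV"
    using A by (subst plus_emeasure) (auto intro!: arg_cong[where f = "emeasure \<eta>"])
  finally show False by simp
qed

lemma nn_integral_eta_H_pow:
  assumes [measurable]: "u \<in> borel_measurable borel"
  shows "(\<integral>\<^sup>+x. u ((H ^^ n) x) \<partial>\<eta>) = (\<integral>\<^sup>+x. u x \<partial>\<eta>)"
proof -
  have "distr \<eta> borel (H ^^ n) = \<eta>"
  proof (rule measure_eqI)
    have "(H ^^ n) \<in> measurable \<eta> borel" using borel_measurable_H_pow[of n] by simp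
    then show "emeasure (distr \<eta> borel (H ^^ n)) A = emeasure \<eta> A" if "A \<in> sets (distr \<eta> borel (H ^^ n))" for A
      using that by (simp add: emeasure_distr eta_H_pow)
  qed simp
  then have "(\<integral>\<^sup>+x. u x \<partial>\<eta>) = (\<integral>\<^sup>+x. u x \<partial>distr \<eta> borel (H ^^ n))" by simp
  also have "\<dots> = (\<integral>\<^sup>+x. u ((H ^^ n) x) \<partial>\<eta>)"
    using borel_measurable_H_pow[of n] by (intro nn_integral_distr) auto
  finally show ?thesis by simp
qed

lemma eta_le_unif:
  assumes A [measurable]: "A \<in> sets borel"
  shows "emeasure \<eta> A \<le> ennreal D * (emeasure \<eta> UNIV * emeasure unif A)"
proof -
  define h where "h = (\<lambda>x. enn2real (\<rho> x))"
  have [measurable]: "h \<in> borel_measurable borel" unfolding h_def by measurable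
  have int: "(\<integral>\<^sup>+x. \<rho> x \<partial>unif) = emeasure \<eta> UNIV"
    using emeasure_eta_rho[of UNIV 0] by simp
  then have "AE x in unif. \<rho> x \<noteq> \<infinity>"
    using eta_UNIV_finite by (intro nn_integral_PInf_AE) auto
  then have h: "AE x in unif. \<rho> x = ennreal (h x)"
    by eventually_elim (simp add: h_def less_top)
  have int_h: "(\<integral>\<^sup>+x. ennreal (h x) \<partial>unif) = emeasure \<eta> UNIV"
    unfolding int[symmetric] using h by (intro nn_integral_cong_AE) auto
  have "emeasure \<eta> A \<le> ennreal D * ((\<integral>\<^sup>+x. ennreal (h x) \<partial>unif) * emeasure unif A)"
  proof (rule mixing_upper)
    show "integrable unif h"
      using int_h eta_UNIV_finite by (intro integrableI_nonneg) (auto simp: h_def)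
    fix n
    have "emeasure \<eta> A = (\<integral>\<^sup>+x. \<rho> x * indicator A ((H ^^ n) x) \<partial>unif)"
      by (simp add: eta_H_pow flip: emeasure_eta_rho)
    also have "\<dots> = (\<integral>\<^sup>+x. ennreal (h x) * indicator A ((H ^^ n) x) \<partial>unif)"
      using h by (intro nn_integral_cong_AE) auto
    finally show "emeasure \<eta> A \<le> (\<integral>\<^sup>+x. ennreal (h x) * indicator A ((H ^^ n) x) \<partial>unif)" by simp
  qed (auto simp: h_def)
  then show ?thesis by (simp add: int_h)
qed

lemma emeasure_left_preimage_le:
  assumes A [measurable]: "A \<in> sets borel" "A \<subseteq> {0<..<1/2}"
  shows "emeasure unif {x. g x \<in> A} \<le> ennreal (\<alpha> + 2) * emeasure unif A"
proof -
  have "emeasure unif {x. g x \<in> A} = (\<integral>\<^sup>+x. indicator {x. g x \<in> A} x \<partial>unif)" by simp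
  also have "\<dots> \<le> (\<integral>\<^sup>+x. ennreal (\<alpha> + 2) * (ennreal (1 / \<phi>' (g x)) * indicator A (g x)) \<partial>unif)"
  proof (rule nn_integral_mono)
    fix x
    show "indicator {x. g x \<in> A} x \<le> ennreal (\<alpha> + 2) * (ennreal (1 / \<phi>' (g x)) * indicator A (g x))"
    proof (cases "g x \<in> A")
      case True
      then have g: "0 < g x" "g x < 1/2" using A by auto
      have "2 powr \<alpha> * \<bar>g x\<bar> powr \<alpha> = (2 * g x) powr \<alpha>" using g by (simp add: powr_mult)
      also have "\<dots> \<le> 1" using g alpha by (intro powr_le1) auto
      finally have "(\<alpha> + 1) * (2 powr \<alpha> * \<bar>g x\<bar> powr \<alpha>) \<le> (\<alpha> + 1) * 1"
        using alpha by (intro mult_left_mono) auto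
      then have "\<phi>' (g x) \<le> \<alpha> + 2" by (simp add: \<phi>'_def)
      then have "1 \<le> (\<alpha> + 2) * (1 / \<phi>' (g x))" using phi'_ge_1[of "g x"] by simp
      then have "ennreal 1 \<le> ennreal ((\<alpha> + 2) * (1 / \<phi>' (g x)))" by (rule ennreal_leI)
      also have "\<dots> = ennreal (\<alpha> + 2) * ennreal (1 / \<phi>' (g x))"
        using alpha phi'_ge_1[of "g x"] by (intro ennreal_mult) auto
      finally show ?thesis using True by simp
    qed simp
  qed
  also have "\<dots> = ennreal (\<alpha> + 2) * (\<integral>\<^sup>+x. ennreal (1 / \<phi>' (g x)) * indicator A (g x) \<partial>unif)"
    by (rule nn_integral_cmult) measurable
  also have "(\<integral>\<^sup>+x. ennreal (1 / \<phi>' (g x)) * indicator A (g x) \<partial>unif) =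
      (\<integral>\<^sup>+x. ennreal (1 / \<phi>' (g x)) * indicator A (g x) * indicator {0<..<1} x \<partial>lborel)"
    by (rule nn_integral_unif) measurable
  also have "\<dots> = (\<integral>\<^sup>+x. ennreal 1 * indicator A (g (f x)) * indicator {0<..<1/2} x \<partial>lborel)"
    by (rule nn_integral_left[of "\<lambda>_. 1" "\<lambda>x. indicator A (g x)", symmetric]) auto
  also have "\<dots> = (\<integral>\<^sup>+x. indicator (A \<inter> {0<..<1}) x \<partial>lborel)"
    using A by (intro nn_integral_cong) (auto simp: f_left split: split_indicator)
  also have "\<dots> = emeasure unif A" by (simp add: emeasure_unif)
  finally show ?thesis .
qed

definition right_half_const :: real where
  "right_half_const = D * (enn2real (emeasure \<eta> UNIV) * 2)"

lemma right_half_const_nonneg: "0 \<le> right_half_const"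
  using D_ge_1 by (simp add: right_half_const_def)

lemma nu_right_half_le:
  assumes B [measurable]: "B \<in> sets borel" "B \<subseteq> {0<..<1}"
  shows "emeasure \<nu> (B \<inter> {1/2..}) \<le> ennreal right_half_const * emeasure unif B"
proof -
  let ?B = "{x. (x + 1) / 2 \<in> B}"
  have B' [measurable]: "?B \<in> sets borel" by measurable
  have "emeasure unif ?B = (\<integral>\<^sup>+x. ennreal 1 * indicator B ((x + 1) / 2) * indicator {0<..<1} x \<partial>lborel)"
  proof -
    have "emeasure unif ?B = (\<integral>\<^sup>+x. indicator ?B x \<partial>unif)" by simp
    also have "\<dots> = (\<integral>\<^sup>+x. indicator ?B x * indicator {0<..<1} x \<partial>lborel)"
      by (rule nn_integral_unif) measurable
    finally show ?thesis by (simp add: indicator_def)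
  qed
  also have "\<dots> = 2 * (\<integral>\<^sup>+x. ennreal (1 / 2) * indicator B ((x + 1) / 2) * indicator {0<..<1} x \<partial>lborel)"
  proof -
    have "ennreal 2 * ennreal (1 / 2) = ennreal (2 * (1 / 2))" by (rule ennreal_mult[symmetric]) auto
    then have two: "2 * ennreal (1 / 2) = 1" by simp
    have "(\<integral>\<^sup>+x. ennreal 1 * indicator B ((x + 1) / 2) * indicator {0<..<1} x \<partial>lborel) =
        (\<integral>\<^sup>+x. 2 * (ennreal (1 / 2) * indicator B ((x + 1) / 2) * indicator {0<..<1} x) \<partial>lborel)"
      by (simp only: mult.assoc[symmetric] two ennreal_1)
    also have "\<dots> = 2 * (\<integral>\<^sup>+x. ennreal (1 / 2) * indicator B ((x + 1) / 2) * indicator {0<..<1} x \<partial>lborel)"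
      by (rule nn_integral_cmult) measurable
    finally show ?thesis .
  qed
  also have "(\<integral>\<^sup>+x. ennreal (1 / 2) * indicator B ((x + 1) / 2) * indicator {0<..<1} x \<partial>lborel) =
      (\<integral>\<^sup>+x. ennreal 1 * indicator B ((f x + 1) / 2) * indicator {1/2<..<1} x \<partial>lborel)"
    by (rule nn_integral_right[of "\<lambda>_. 1" "\<lambda>x. indicator B ((x + 1) / 2)", symmetric]) auto
  also have "\<dots> \<le> (\<integral>\<^sup>+x. indicator (B \<inter> {0<..<1}) x \<partial>lborel)"
    by (intro nn_integral_mono) (auto simp: f_right split: split_indicator)
  also have "\<dots> = emeasure unif B" by (simp add: emeasure_unif)
  finally have *: "emeasure unif ?B \<le> 2 * emeasure unif B" by (simp add: mult_left_mono)
  have "emeasure \<nu> (B \<inter> {1/2..}) = emeasure \<eta> ?B" by (rule nu_right_half) simp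
  also have "\<dots> \<le> ennreal D * (emeasure \<eta> UNIV * emeasure unif ?B)" by (rule eta_le_unif) simp
  also have "\<dots> \<le> ennreal D * (emeasure \<eta> UNIV * (2 * emeasure unif B))"
    by (intro mult_left_mono *) auto
  also have "emeasure \<eta> UNIV = ennreal (enn2real (emeasure \<eta> UNIV))"
    using eta_UNIV_finite by simp
  also have "ennreal D * (ennreal (enn2real (emeasure \<eta> UNIV)) * (2 * emeasure unif B)) =
      ennreal right_half_const * emeasure unif B"
    using D_ge_1 by (simp add: right_half_const_def ennreal_mult mult.assoc)
  finally show ?thesis .
qed

text \<open>Push forward along the left branch \<open>l\<close> times. Each step replaces a set \<open>A\<close> in the left half by its image,
which has at least the measure \<open>\<nu> A\<close> by invariance and at most \<open>\<alpha> + 2\<close> times the Lebesgue measure of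
\<open>A\<close>, the maximal slope of that branch.\<close>

lemma nu_le_unif:
  "\<exists>C. 0 \<le> C \<and> (\<forall>B \<in> sets borel. B \<subseteq> {x. 0 < x \<and> x < 1 \<and> entry x \<le> l} \<longrightarrow>
     emeasure \<nu> B \<le> ennreal C * emeasure unif B)"
proof (induction l)
  case 0
  show ?case
  proof (intro exI[of _ right_half_const] conjI right_half_const_nonneg ballI impI)
    fix B :: "real set" assume B: "B \<in> sets borel" "B \<subseteq> {x. 0 < x \<and> x < 1 \<and> entry x \<le> 0}"
    have "1/2 \<le> x" if "x \<in> B" for x
    proof -
      have "0 < x" "x < 1" "entry x = 0" using B that by auto
      then show ?thesis using f_pow_entry[of x] by simp
    qed
    then have "B \<inter> {1/2..} = B" by auto
    moreover have "B \<subseteq> {0<..<1}" using B by auto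
    ultimately show "emeasure \<nu> B \<le> ennreal right_half_const * emeasure unif B"
      using nu_right_half_le[of B] B by simp
  qed
next
  case (Suc l)
  then obtain C' where C': "0 \<le> C'" "\<And>B. B \<in> sets borel \<Longrightarrow>
    B \<subseteq> {x. 0 < x \<and> x < 1 \<and> entry x \<le> l} \<Longrightarrow> emeasure \<nu> B \<le> ennreal C' * emeasure unif B"
    by auto
  show ?case
  proof (intro exI[of _ "right_half_const + C' * (\<alpha> + 2)"] conjI ballI impI)
    show "0 \<le> right_half_const + C' * (\<alpha> + 2)" using right_half_const_nonneg C'(1) alpha by simp
    fix B :: "real set" assume B [measurable]: "B \<in> sets borel"
      and sub: "B \<subseteq> {x. 0 < x \<and> x < 1 \<and> entry x \<le> Suc l}"
    define A where "A = B \<inter> {0<..<1/2}"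
    have A [measurable]: "A \<in> sets borel" by (simp add: A_def)
    let ?A = "{x. g x \<in> A}"
    have A' [measurable]: "?A \<in> sets borel" by measurable
    have "emeasure \<nu> A \<le> emeasure \<nu> (f -` ?A)"
      by (rule emeasure_mono) (auto simp: A_def f_left)
    also have "\<dots> = emeasure \<nu> ?A" by (rule invariant) measurable
    also have "\<dots> \<le> ennreal C' * emeasure unif ?A"
    proof (rule C')
      show "?A \<subseteq> {x. 0 < x \<and> x < 1 \<and> entry x \<le> l}"
      proof safe
        fix x assume x: "g x \<in> A"
        then have gx: "0 < g x" "g x < 1/2" by (auto simp: A_def)
        have fg: "f (g x) = x" using gx by (simp add: f_left)
        show "0 < x" "x < 1" using f_left_bounds[OF gx] fg by auto
        have "entry (g x) \<le> Suc l" using x sub by (auto simp: A_def)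
        then show "entry x \<le> l" using entry_left[OF gx] fg by simp
      qed
    qed measurable
    also have "\<dots> \<le> ennreal C' * (ennreal (\<alpha> + 2) * emeasure unif A)"
      by (intro mult_left_mono emeasure_left_preimage_le) (auto simp: A_def)
    also have "\<dots> \<le> ennreal C' * (ennreal (\<alpha> + 2) * emeasure unif B)"
      by (intro mult_left_mono emeasure_mono) (auto simp: A_def)
    finally have left: "emeasure \<nu> A \<le> ennreal (C' * (\<alpha> + 2)) * emeasure unif B"
      using C' alpha by (simp add: ennreal_mult mult.assoc)
    have "B = A \<union> (B \<inter> {1/2..})" using sub by (auto simp: A_def)
    then have "emeasure \<nu> B \<le> emeasure \<nu> A + emeasure \<nu> (B \<inter> {1/2..})"
      using emeasure_subadditive[of A \<nu> "B \<inter> {1/2..}"] by simp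
    also have "\<dots> \<le> ennreal (C' * (\<alpha> + 2)) * emeasure unif B + ennreal right_half_const * emeasure unif B"
      using sub by (intro add_mono left nu_right_half_le) auto
    also have "\<dots> = ennreal (right_half_const + C' * (\<alpha> + 2)) * emeasure unif B"
      using right_half_const_nonneg C' alpha by (simp add: distrib_right add.commute)
    finally show "emeasure \<nu> B \<le> ennreal (right_half_const + C' * (\<alpha> + 2)) * emeasure unif B" .
  qed
qed

end

section \<open>Sums along powers\<close>

lemma ipow_le_ipow:
  assumes "0 \<le> s" "real m powr s \<le> real n powr r"
  shows "ipow m s \<le> ipow n r"
  unfolding le_ipow_iff using real_ipow_le[of m s] assms by simp

lemma ipow_mono: "0 \<le> s \<Longrightarrow> m \<le> n \<Longrightarrow> ipow m s \<le> ipow n s"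
  by (intro ipow_le_ipow powr_mono2) auto

lemma ipow_le_of_le_root:
  assumes "0 < s" "k \<le> ipow n (1 / s)"
  shows "real k powr s \<le> real n"
proof -
  have "real k powr s \<le> (real n powr (1 / s)) powr s"
    using assms by (intro powr_mono2) (auto simp: le_ipow_iff)
  also have "\<dots> = real n" using assms by (simp add: powr_powr)
  finally show ?thesis .
qed

lemma half_powr_le_ipow:
  assumes "1 \<le> n" "0 \<le> s"
  shows "real n powr s / 2 \<le> real (ipow n s)"
proof -
  have "1 \<le> real n powr s" using assms by (intro ge_one_powr_ge_zero) auto
  then have "1 \<le> ipow n s" by (simp add: le_ipow_iff)
  moreover have "real n powr s < real (ipow n s) + 1"
    unfolding ipow_def by (simp add: of_nat_nat)
  ultimately show ?thesis by linarith
qed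

text \<open>The sums of the theorem, with the index shifted by one so that they run over initial segments.\<close>

definition powsum :: "(nat \<Rightarrow> real) \<Rightarrow> real \<Rightarrow> nat \<Rightarrow> real" where
  "powsum b s n = (\<Sum>k<ipow n (1 / s). b (ipow (Suc k) s))"

lemma powsum_altdef: "powsum b s n = (\<Sum>k=1..ipow n (1 / s). b (ipow k s))"
  by (simp add: powsum_def sum.atLeast1_atMost_eq)

lemma powsum_mono:
  assumes "\<And>k. 0 \<le> b k" "0 \<le> s" "m \<le> n"
  shows "powsum b s m \<le> powsum b s n"
  unfolding powsum_def using assms ipow_mono[of "1 / s" m n] by (intro sum_mono2) auto

lemma powsum_nonneg: "(\<And>k. 0 \<le> b k) \<Longrightarrow> 0 \<le> powsum b s n"
  unfolding powsum_def by (simp add: sum_nonneg)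

text \<open>For large \<open>k\<close> one has \<open>(C * k) powr s' \<le> k powr s\<close>, so each of the \<open>C\<close> indices in the \<open>k\<close>-th block of
length \<open>C\<close> contributes to the sum for \<open>s'\<close> at least what \<open>k\<close> contributes to the sum for \<open>s\<close>.\<close>

lemma powsum_ratio:
  fixes b :: "nat \<Rightarrow> real" and C :: nat
  assumes b: "antimono b" "\<And>k. 0 \<le> b k" and s: "0 < s'" "s' < s"
  shows "\<exists>K. 0 \<le> K \<and> (\<forall>n. real C * powsum b s n \<le> powsum b s' n + K)"
proof -
  have "((\<lambda>k::real. (real C * k) powr s' / k powr s) \<longlongrightarrow> 0) at_top"
  proof (cases "C = 0")
    case False
    then show ?thesis using s by (auto simp: powr_mult) real_asymp
  qed (use s in simp)
  then have "\<forall>\<^sub>F k in at_top. (real C * k) powr s' / k powr s < 1"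
    by (rule order_tendstoD) simp
  then have "\<forall>\<^sub>F k in sequentially. (real C * real k) powr s' / real k powr s < 1"
    using filterlim_real_sequentially by (rule eventually_compose_filterlim)
  then obtain k0 where k0: "\<And>k. k0 \<le> k \<Longrightarrow> (real C * real k) powr s' / real k powr s < 1"
    by (auto simp: eventually_sequentially)
  have le: "(real C * real k) powr s' \<le> real k powr s" if "Suc k0 \<le> k" for k
    using k0[of k] that by (simp add: field_simps)
  have b_le: "b k \<le> b 0" for k using b(1) by (simp add: antimonoD)
  show ?thesis
  proof (intro exI[of _ "real C * (real (Suc k0) * b 0)"] conjI allI)
    show "0 \<le> real C * (real (Suc k0) * b 0)" using b by simp
    fix n
    define N N' where "N = ipow n (1 / s)" and "N' = ipow n (1 / s')"
    show "real C * powsum b s n \<le> powsum b s' n + real C * (real (Suc k0) * b 0)"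
    proof (cases "N \<le> Suc k0")
      case True
      have "powsum b s n \<le> (\<Sum>k<N. b 0)"
        unfolding powsum_def N_def by (intro sum_mono b_le)
      also have "\<dots> \<le> real (Suc k0) * b 0"
        using True b by (simp del: of_nat_Suc add: mult_right_mono)
      finally have "real C * powsum b s n \<le> real C * (real (Suc k0) * b 0)"
        by (intro mult_left_mono) auto
      then show ?thesis using powsum_nonneg[of b s' n] b by simp
    next
      case False
      have block: "real C * b (ipow (Suc k) s)
          \<le> (\<Sum>j\<in>{k * C..<k * C + C}. b (ipow (Suc j) s')) + (if k < Suc k0 then real C * b 0 else 0)" for k
      proof (cases "k < Suc k0")
        case True
        have "real C * b (ipow (Suc k) s) \<le> real C * b 0" by (intro mult_left_mono b_le) auto
        moreover have "0 \<le> (\<Sum>j\<in>{k * C..<k * C + C}. b (ipow (Suc j) s'))" using b by (intro sum_nonneg) auto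
        ultimately show ?thesis using True by simp
      next
        case False
        have "b (ipow (Suc k) s) \<le> b (ipow (Suc j) s')" if "j \<in> {k * C..<k * C + C}" for j
        proof (rule antimonoD[OF b(1)], rule ipow_le_ipow)
          have "Suc j \<le> C * Suc k" using that by (simp add: mult.commute)
          then have "real (Suc j) \<le> real C * real (Suc k)" by (metis of_nat_le_iff of_nat_mult)
          then have "real (Suc j) powr s' \<le> (real C * real (Suc k)) powr s'"
            using s by (intro powr_mono2) auto
          also have "\<dots> \<le> real (Suc k) powr s" using False by (intro le) simp
          finally show "real (Suc j) powr s' \<le> real (Suc k) powr s" .
        qed (use s in simp)
        then have "(\<Sum>j\<in>{k * C..<k * C + C}. b (ipow (Suc k) s)) \<le> (\<Sum>j\<in>{k * C..<k * C + C}. b (ipow (Suc j) s'))"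
          by (rule sum_mono)
        then show ?thesis using False by simp
      qed
      have "real C * powsum b s n = (\<Sum>k<N. real C * b (ipow (Suc k) s))"
        by (simp add: powsum_def N_def sum_distrib_left)
      also have "\<dots> \<le> (\<Sum>k<N. (\<Sum>j\<in>{k * C..<k * C + C}. b (ipow (Suc j) s')) +
          (if k < Suc k0 then real C * b 0 else 0))"
        by (intro sum_mono block)
      also have "\<dots> = (\<Sum>j<N * C. b (ipow (Suc j) s')) + (\<Sum>k<N. if k < Suc k0 then real C * b 0 else 0)"
        unfolding sum.distrib by (simp only: sum.nat_group)
      also have "(\<Sum>k<N. if k < Suc k0 then real C * b 0 else 0) \<le> real (Suc k0) * (real C * b 0)"
      proof -
        have "(\<Sum>k<N. if k < Suc k0 then real C * b 0 else 0) = (\<Sum>k\<in>{..<N} \<inter> {..<Suc k0}. real C * b 0)"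
          by (subst sum.inter_restrict) (auto intro!: sum.cong)
        also have "\<dots> \<le> (\<Sum>k\<in>{..<Suc k0}. real C * b 0)"
          using b by (intro sum_mono2) auto
        finally show ?thesis by simp
      qed
      also have "(\<Sum>j<N * C. b (ipow (Suc j) s')) \<le> powsum b s' n"
        unfolding powsum_def
      proof (rule sum_mono2)
        have "(real C * real N) powr s' \<le> real N powr s" using False by (intro le) simp
        also have "\<dots> \<le> real n" using s by (intro ipow_le_of_le_root) (auto simp: N_def)
        finally have "((real C * real N) powr s') powr (1 / s') \<le> real n powr (1 / s')"
          using s by (intro powr_mono2) auto
        then have "real (N * C) \<le> real n powr (1 / s')"
          using s by (simp add: powr_powr mult.commute)
        then show "{..<N * C} \<subseteq> {..<ipow n (1 / s')}" by (simp add: le_ipow_iff)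
      qed (use b in auto)
      finally show ?thesis by (simp add: mult_ac)
    qed
  qed
qed

section \<open>Upper bound for the number of visits\<close>

locale shrinking_target = intermittent_invariant +
  fixes B :: "nat \<Rightarrow> real set" and \<delta> :: real
  assumes borel_B [measurable]: "\<And>n. B n \<in> sets borel"
    and interval_B: "\<And>n x y z. x \<in> B n \<Longrightarrow> z \<in> B n \<Longrightarrow> x \<le> y \<Longrightarrow> y \<le> z \<Longrightarrow> y \<in> B n"
    and antimono_B: "\<And>m n. m \<le> n \<Longrightarrow> B n \<subseteq> B m"
    and delta: "0 < \<delta>"
    and B_sub: "\<And>n. B n \<subseteq> {\<delta>..<1}"
begin

definition \<beta> :: "nat \<Rightarrow> real" where "\<beta> n = measure \<nu> (B n)"

lemma nu_B_le: "\<exists>C. 0 < C \<and> (\<forall>n. emeasure \<nu> (B n) = ennreal (\<beta> n) \<and> \<beta> n \<le> C * measure unif (B n))"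
proof -
  obtain l where l: "2 * zpot \<delta> \<le> real l" using real_arch_simple by blast
  have sub: "B n \<subseteq> {x. 0 < x \<and> x < 1 \<and> entry x \<le> l}" for n
  proof safe
    fix x assume "x \<in> B n"
    then have x: "\<delta> \<le> x" "x < 1" using B_sub[of n] by auto
    then show "0 < x" "x < 1" using delta by auto
    have "zpot x \<le> zpot \<delta>" unfolding zpot_def using x delta alpha by (intro powr_mono2') auto
    then have "real (entry x) \<le> real l" using entry_le_zpot[of x] x delta l by simp
    then show "entry x \<le> l" by simp
  qed
  obtain C where C: "0 \<le> C" "\<And>A. A \<in> sets borel \<Longrightarrow>
    A \<subseteq> {x. 0 < x \<and> x < 1 \<and> entry x \<le> l} \<Longrightarrow> emeasure \<nu> A \<le> ennreal C * emeasure unif A"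
    using nu_le_unif[of l] by blast
  have "emeasure \<nu> (B n) = ennreal (\<beta> n) \<and> \<beta> n \<le> (C + 1) * measure unif (B n)" for n
  proof -
    have le: "emeasure \<nu> (B n) \<le> ennreal (C * measure unif (B n))"
      using C(2)[OF borel_B sub[of n]] C(1) by (simp add: unif.emeasure_eq_measure ennreal_mult)
    then have "emeasure \<nu> (B n) \<noteq> top" by (auto simp: top_unique)
    then have 1: "emeasure \<nu> (B n) = ennreal (\<beta> n)"
      unfolding \<beta>_def by (rule emeasure_eq_ennreal_measure)
    then have "\<beta> n \<le> C * measure unif (B n)"
      using le C(1) by (simp add: ennreal_le_iff)
    also have "\<dots> \<le> (C + 1) * measure unif (B n)" by (intro mult_right_mono) auto
    finally show ?thesis using 1 by simp
  qed
  then show ?thesis using C(1) by (intro exI[of _ "C + 1"]) auto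
qed

lemma emeasure_nu_B: "emeasure \<nu> (B n) = ennreal (\<beta> n)"
  using nu_B_le by auto

lemma beta_nonneg [simp]: "0 \<le> \<beta> n"
  by (simp add: \<beta>_def)

lemma antimono_beta: "antimono \<beta>"
proof (rule antimonoI)
  fix m n :: nat assume "m \<le> n"
  then have "emeasure \<nu> (B n) \<le> emeasure \<nu> (B m)" using antimono_B by (intro emeasure_mono) auto
  then show "\<beta> n \<le> \<beta> m" by (simp add: emeasure_nu_B ennreal_le_iff)
qed

definition visits :: "nat \<Rightarrow> real \<Rightarrow> real" where
  "visits n x = (\<Sum>k=1..n. indicator (B k) ((f ^^ k) x))"

text \<open>The number of visits to \<open>B u\<close> up to and including the entrance into the right half.\<close>

definition excursion :: "nat \<Rightarrow> real \<Rightarrow> real" where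
  "excursion u y = (\<Sum>i\<le>entry y. indicator (B u) ((f ^^ i) y))"

lemma borel_measurable_excursion [measurable]: "excursion u \<in> borel_measurable borel"
proof -
  have [measurable]: "(\<lambda>y. (\<Sum>i\<le>l. indicator (B u) ((f ^^ i) y)) :: real) \<in> borel_measurable borel" for l
    by measurable
  show ?thesis unfolding excursion_def
    by (rule measurable_compose_countable[where f = "\<lambda>l y. (\<Sum>i\<le>l. indicator (B u) ((f ^^ i) y))" and g = entry])
      measurable
qed

lemma excursion_nonneg [simp]: "0 \<le> excursion u y"
  by (simp add: excursion_def sum_nonneg)

lemma nn_integral_excursion_le: "(\<integral>\<^sup>+y. ennreal (excursion u y) \<partial>\<eta>) \<le> ennreal (\<beta> u)"
proof -
  have m: "{y. i \<le> entry y \<and> (f ^^ i) y \<in> B u} \<in> sets borel" for i by measurable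
  have "(\<integral>\<^sup>+y. ennreal (excursion u y) \<partial>\<eta>)
      \<le> (\<integral>\<^sup>+y. (\<Sum>i. indicator {y. i \<le> entry y \<and> (f ^^ i) y \<in> B u} y) \<partial>\<eta>)"
  proof (rule nn_integral_mono)
    fix y
    have "ennreal (excursion u y) = (\<Sum>i\<le>entry y. ennreal (indicator (B u) ((f ^^ i) y)))"
      by (simp add: excursion_def sum_ennreal)
    also have "\<dots> = (\<Sum>i\<le>entry y. indicator {y. i \<le> entry y \<and> (f ^^ i) y \<in> B u} y)"
      by (intro sum.cong) (auto split: split_indicator)
    also have "\<dots> \<le> (\<Sum>i. indicator {y. i \<le> entry y \<and> (f ^^ i) y \<in> B u} y)"
      by (rule sum_le_suminf) auto
    finally show "ennreal (excursion u y) \<le> (\<Sum>i. indicator {y. i \<le> entry y \<and> (f ^^ i) y \<in> B u} y)" .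
  qed
  also have "\<dots> = (\<Sum>i. \<integral>\<^sup>+y. indicator {y. i \<le> entry y \<and> (f ^^ i) y \<in> B u} y \<partial>\<eta>)"
    using m by (intro nn_integral_suminf) auto
  also have "\<dots> = (\<Sum>i. emeasure \<eta> {y. i \<le> entry y \<and> (f ^^ i) y \<in> B u})"
    using m by simp
  also have "\<dots> \<le> emeasure \<nu> (B u)" by (rule kac_visits) simp
  finally show ?thesis by (simp add: emeasure_nu_B)
qed

lemma AE_unif_of_eta:
  assumes "AE x in \<eta>. P x"
  shows "AE x in unif. P x"
proof -
  obtain N where N: "{x. \<not> P x} \<subseteq> N" "N \<in> sets borel" "emeasure \<eta> N = 0"
    using assms by (auto simp: eventually_ae_filter null_sets_def)
  then have "emeasure unif N * emeasure \<eta> UNIV = 0" using unif_le_eta[of N] by simp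
  then have "emeasure unif N = 0" using eta_UNIV_pos by simp
  then show ?thesis using N by (auto simp: eventually_ae_filter null_sets_def)
qed

lemma sum_visits_excursions:
  "(\<Sum>k<\<tau> N x. indicator (B k) ((f ^^ k) x)) =
   (\<Sum>j<N. \<Sum>i\<le>entry ((H ^^ j) x). indicator (B (\<tau> j x + i)) ((f ^^ i) ((H ^^ j) x)) :: real)"
proof (induction N)
  case (Suc N)
  have "(\<Sum>k<\<tau> (Suc N) x. indicator (B k) ((f ^^ k) x) :: real) =
      (\<Sum>k<\<tau> N x. indicator (B k) ((f ^^ k) x)) +
      (\<Sum>k\<in>{\<tau> N x..<\<tau> N x + Suc (entry ((H ^^ N) x))}. indicator (B k) ((f ^^ k) x))"
    unfolding tau_Suc lessThan_atLeast0 by (rule sum.atLeastLessThan_concat[symmetric]) auto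
  also have "(\<Sum>k\<in>{\<tau> N x..<\<tau> N x + Suc (entry ((H ^^ N) x))}. indicator (B k) ((f ^^ k) x) :: real) =
      (\<Sum>i\<in>{0..<Suc (entry ((H ^^ N) x))}. indicator (B (i + \<tau> N x)) ((f ^^ (i + \<tau> N x)) x))"
    using sum.shift_bounds_nat_ivl[of "\<lambda>k. indicator (B k) ((f ^^ k) x) :: real" 0 "\<tau> N x" "Suc (entry ((H ^^ N) x))"]
    by (simp only: add_0 add.commute)
  also have "\<dots> = (\<Sum>i\<le>entry ((H ^^ N) x). indicator (B (\<tau> N x + i)) ((f ^^ i) ((H ^^ N) x)))"
    by (intro sum.cong) (auto simp: funpow_add f_pow_tau add.commute)
  finally show ?case using Suc by simp
qed simp

text \<open>Let \<open>s < s' < \<alpha>\<close>. As \<open>\<tau> j x\<close> is eventually at least \<open>j powr s'\<close>, the visits in the \<open>j\<close>-th excursion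
are visits to \<open>B (j powr s')\<close>, and their expected number is at most \<open>\<beta> (j powr s')\<close>. Weight them with
\<open>1 / (1 + G j)\<close>, where \<open>G j\<close> is the target sum up to time \<open>j powr s'\<close>. That sum has about
\<open>j powr (s'/s)\<close> terms, none of them below \<open>\<beta> (j powr s')\<close>, so the weighted expectations are at most a
constant times \<open>j powr (- s'/s)\<close> and are summable.\<close>

lemma AE_visits_upper:
  assumes s: "0 < s" "s < \<alpha>"
  shows "AE x in unif. \<exists>C. 0 \<le> C \<and> (\<forall>n. visits n x \<le> C * (1 + powsum \<beta> s n))"
proof -
  define s' where "s' = (s + \<alpha>) / 2"
  have s': "s < s'" "s' < \<alpha>" "0 < s'" using s by (auto simp: s'_def)
  define G where "G = (\<lambda>j. powsum \<beta> s (ipow j s'))"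
  have G_nonneg: "0 \<le> G j" for j by (simp add: G_def powsum_nonneg)
  have G_mono: "i \<le> j \<Longrightarrow> G i \<le> G j" for i j
    unfolding G_def using s s' by (intro powsum_mono ipow_mono) auto
  define c where "c = (1/2) powr (1 / s) / 2"
  have c: "0 < c" by (simp add: c_def)
  define r where "r = s' / s"
  have r: "1 < r" using s s' by (simp add: r_def)
  have bound: "\<beta> (ipow j s') * (1 / (1 + G j)) \<le> 1 / c * real j powr (- r)" if j: "1 \<le> j" for j
  proof -
    define M where "M = ipow j s'"
    define N where "N = ipow M (1 / s)"
    have "1 \<le> real j powr s'" using j s' by (intro ge_one_powr_ge_zero) auto
    then have M1: "1 \<le> M" by (simp add: M_def le_ipow_iff)
    have "c * real j powr r = (real j powr s' / 2) powr (1 / s) / 2"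
      by (simp add: c_def r_def powr_divide powr_powr)
    also have "\<dots> \<le> real M powr (1 / s) / 2"
      using half_powr_le_ipow[of j s'] j s s' by (intro divide_right_mono powr_mono2) (auto simp: M_def)
    also have "\<dots> \<le> real N"
      unfolding N_def using M1 s by (intro half_powr_le_ipow) auto
    finally have N: "c * real j powr r \<le> real N" .
    have pos: "0 < c * real j powr r" using c j by simp
    have "real N * \<beta> M = (\<Sum>k<N. \<beta> M)" by simp
    also have "\<dots> \<le> (\<Sum>k<N. \<beta> (ipow (Suc k) s))"
    proof (rule sum_mono)
      fix k assume "k \<in> {..<N}"
      then have "real (Suc k) powr s \<le> real M" using s by (intro ipow_le_of_le_root) (auto simp: N_def)
      then have "real (ipow (Suc k) s) \<le> real M" using real_ipow_le[of "Suc k" s] by linarith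
      then show "\<beta> M \<le> \<beta> (ipow (Suc k) s)" by (intro antimonoD[OF antimono_beta]) simp
    qed
    also have "\<dots> = G j" by (simp add: G_def powsum_def N_def M_def)
    finally have "c * real j powr r * \<beta> M \<le> 1 + G j"
      using mult_right_mono[OF N, of "\<beta> M"] by simp
    then have "\<beta> M * (1 / (1 + G j)) \<le> 1 / (c * real j powr r)"
      using pos G_nonneg[of j] by (simp add: field_simps)
    also have "\<dots> = 1 / c * real j powr (- r)" by (simp add: powr_minus field_simps)
    finally show ?thesis by (simp add: M_def)
  qed
  have sum_w: "summable (\<lambda>j. \<beta> (ipow j s') * (1 / (1 + G j)))"
  proof (rule summable_comparison_test_ev)
    show "summable (\<lambda>j. 1 / c * real j powr (- r))"
      using r by (intro summable_mult) (simp add: summable_real_powr_iff)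
    show "\<forall>\<^sub>F j in sequentially. norm (\<beta> (ipow j s') * (1 / (1 + G j))) \<le> 1 / c * real j powr (- r)"
      using eventually_ge_at_top[of 1]
    proof eventually_elim
      case (elim j)
      then show ?case using bound[of j] G_nonneg[of j] by simp
    qed
  qed
  define X where "X = (\<lambda>j x. excursion (ipow j s') ((H ^^ j) x) * (1 / (1 + G j)))"
  have [measurable]: "X j \<in> borel_measurable borel" for j unfolding X_def by measurable
  have "AE x in \<eta>. \<exists>C. 0 \<le> C \<and> (\<forall>n. (\<Sum>j<n. X j x) \<le> (C :: real))"
  proof (rule AE_partial_sums_bounded)
    have "(\<integral>\<^sup>+x. ennreal (X j x) \<partial>\<eta>) \<le> ennreal (\<beta> (ipow j s') * (1 / (1 + G j)))" for j
    proof -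
      have "(\<integral>\<^sup>+x. ennreal (X j x) \<partial>\<eta>) =
          (\<integral>\<^sup>+x. ennreal (excursion (ipow j s') ((H ^^ j) x)) * ennreal (1 / (1 + G j)) \<partial>\<eta>)"
        unfolding X_def using G_nonneg[of j] by (intro nn_integral_cong ennreal_mult) auto
      also have "\<dots> = (\<integral>\<^sup>+x. ennreal (excursion (ipow j s') ((H ^^ j) x)) \<partial>\<eta>) * ennreal (1 / (1 + G j))"
        by (rule nn_integral_multc) measurable
      also have "(\<integral>\<^sup>+x. ennreal (excursion (ipow j s') ((H ^^ j) x)) \<partial>\<eta>) =
          (\<integral>\<^sup>+x. ennreal (excursion (ipow j s') x) \<partial>\<eta>)"
        by (rule nn_integral_eta_H_pow) measurable
      also have "\<dots> * ennreal (1 / (1 + G j)) \<le> ennreal (\<beta> (ipow j s')) * ennreal (1 / (1 + G j))"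
        by (intro mult_right_mono nn_integral_excursion_le) auto
      also have "\<dots> = ennreal (\<beta> (ipow j s') * (1 / (1 + G j)))"
        using G_nonneg[of j] by (intro ennreal_mult[symmetric]) auto
      finally show ?thesis .
    qed
    then have "(\<Sum>j. \<integral>\<^sup>+x. ennreal (X j x) \<partial>\<eta>) \<le> (\<Sum>j. ennreal (\<beta> (ipow j s') * (1 / (1 + G j))))"
      by (intro suminf_le) auto
    also have "\<dots> < \<infinity>"
      using sum_w G_nonneg by (subst suminf_ennreal2) auto
    finally show "(\<Sum>j. \<integral>\<^sup>+x. ennreal (X j x) \<partial>\<eta>) < \<infinity>" .
    show "0 \<le> X j x" for j x using G_nonneg[of j] by (simp add: X_def)
  qed simp
  then have ae: "AE x in unif. \<exists>C. 0 \<le> C \<and> (\<forall>n. (\<Sum>j<n. X j x) \<le> C)"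
    by (rule AE_unif_of_eta)
  show ?thesis
    using ae AE_tau_lower[OF s'(3,2)]
  proof eventually_elim
    case (elim x)
    then obtain C where C: "0 \<le> C" "\<And>n. (\<Sum>j<n. X j x) \<le> C" by blast
    obtain j0 where j0: "\<And>j. j0 \<le> j \<Longrightarrow> ipow j s' \<le> \<tau> j x"
      using elim by (auto simp: eventually_sequentially)
    \<comment> \<open>The first summand pays for the excursions before \<open>j0\<close>, the second for the case that time \<open>n\<close> belongs to one of them.\<close>
    define K where "K = real (\<tau> j0 x) + C * (1 + G j0) + C"
    have K: "0 \<le> K" "C \<le> K" using C(1) G_nonneg[of j0] by (auto simp: K_def)
    have "visits n x \<le> K * (1 + powsum \<beta> s n)" for n
    proof -
      let ?ind = "\<lambda>j i. indicator (B (\<tau> j x + i)) ((f ^^ i) ((H ^^ j) x)) :: real"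
      have "n < \<tau> (Suc n) x"
        using strict_mono_imp_increasing[OF strict_mono_tau, of "Suc n" x] by simp
      \<comment> \<open>The excursion to which time \<open>n\<close> belongs.\<close>
      define N where "N = (LEAST N. n < \<tau> (Suc N) x)"
      have N1: "n < \<tau> (Suc N) x" unfolding N_def by (rule LeastI) fact
      have N2: "\<tau> N x \<le> n"
      proof (cases N)
        case (Suc N')
        then have "\<not> n < \<tau> (Suc N') x" using not_less_Least[of N' "\<lambda>N. n < \<tau> (Suc N) x"] by (simp add: N_def)
        then show ?thesis using Suc by simp
      qed simp
      have "visits n x \<le> (\<Sum>k<\<tau> (Suc N) x. indicator (B k) ((f ^^ k) x))"
        unfolding visits_def using N1 by (intro sum_mono2) auto
      also have "\<dots> = (\<Sum>j<Suc N. \<Sum>i\<le>entry ((H ^^ j) x). ?ind j i)"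
        by (rule sum_visits_excursions)
      also have "\<dots> \<le> (\<Sum>j<Suc N. excursion (ipow j s') ((H ^^ j) x) +
          (if j < j0 then real (Suc (entry ((H ^^ j) x))) else 0))"
      proof (rule sum_mono)
        fix j
        show "(\<Sum>i\<le>entry ((H ^^ j) x). ?ind j i) \<le> excursion (ipow j s') ((H ^^ j) x) +
          (if j < j0 then real (Suc (entry ((H ^^ j) x))) else 0)"
        proof (cases "j < j0")
          case True
          have "(\<Sum>i\<le>entry ((H ^^ j) x). ?ind j i) \<le> (\<Sum>i\<le>entry ((H ^^ j) x). 1)"
            by (intro sum_mono) (auto split: split_indicator)
          then show ?thesis using True by (simp add: add_increasing)
        next
          case False
          have "(\<Sum>i\<le>entry ((H ^^ j) x). ?ind j i) \<le> excursion (ipow j s') ((H ^^ j) x)"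
            unfolding excursion_def
          proof (rule sum_mono)
            fix i
            have "B (\<tau> j x + i) \<subseteq> B (ipow j s')" using j0[of j] False by (intro antimono_B) simp
            then show "?ind j i \<le> indicator (B (ipow j s')) ((f ^^ i) ((H ^^ j) x))"
              by (auto split: split_indicator)
          qed
          then show ?thesis using False by simp
        qed
      qed
      also have "\<dots> = (\<Sum>j<Suc N. excursion (ipow j s') ((H ^^ j) x)) +
          (\<Sum>j<Suc N. if j < j0 then real (Suc (entry ((H ^^ j) x))) else 0)"
        by (rule sum.distrib)
      also have "(\<Sum>j<Suc N. if j < j0 then real (Suc (entry ((H ^^ j) x))) else 0) \<le> real (\<tau> j0 x)"
      proof -
        have "(\<Sum>j<Suc N. if j < j0 then real (Suc (entry ((H ^^ j) x))) else 0) =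
            (\<Sum>j\<in>{..<Suc N} \<inter> {..<j0}. real (Suc (entry ((H ^^ j) x))))"
          by (subst sum.inter_restrict) (auto intro!: sum.cong)
        also have "\<dots> \<le> (\<Sum>j<j0. real (Suc (entry ((H ^^ j) x))))"
          by (intro sum_mono2) auto
        also have "\<dots> = real (\<tau> j0 x)" by (induction j0) (auto simp: tau_Suc)
        finally show ?thesis .
      qed
      also have "(\<Sum>j<Suc N. excursion (ipow j s') ((H ^^ j) x)) \<le> C * (1 + G N)"
      proof -
        have "(\<Sum>j<Suc N. excursion (ipow j s') ((H ^^ j) x)) \<le> (\<Sum>j<Suc N. X j x * (1 + G N))"
        proof (rule sum_mono)
          fix j assume "j \<in> {..<Suc N}"
          then have "1 + G j \<le> 1 + G N" using G_mono[of j N] by simp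
          then have "1 \<le> 1 / (1 + G j) * (1 + G N)" using G_nonneg[of j] by (simp add: field_simps)
          then have "excursion (ipow j s') ((H ^^ j) x) * 1
              \<le> excursion (ipow j s') ((H ^^ j) x) * (1 / (1 + G j) * (1 + G N))"
            by (intro mult_left_mono) auto
          then show "excursion (ipow j s') ((H ^^ j) x) \<le> X j x * (1 + G N)"
            by (simp add: X_def)
        qed
        also have "\<dots> \<le> C * (1 + G N)"
          unfolding sum_distrib_right[symmetric] using C(2)[of "Suc N"] G_nonneg[of N]
          by (intro mult_right_mono) auto
        finally show ?thesis .
      qed
      also have "G N \<le> G j0 + powsum \<beta> s n"
      proof (cases "N \<le> j0")
        case True
        then show ?thesis using G_mono[of N j0] powsum_nonneg[of \<beta> s n] by simp
      next
        case False
        then have "ipow N s' \<le> n" using j0[of N] N2 by simp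
        then have "G N \<le> powsum \<beta> s n" unfolding G_def using s by (intro powsum_mono) auto
        then show ?thesis using G_nonneg[of j0] by simp
      qed
      finally have "visits n x \<le> C * (1 + (G j0 + powsum \<beta> s n)) + real (\<tau> j0 x)"
        using C(1) by (simp add: mult_left_mono)
      also have "\<dots> \<le> K + K * powsum \<beta> s n"
        using mult_right_mono[OF K(2) powsum_nonneg[of \<beta> s n]] C(1)
        by (simp add: K_def algebra_simps)
      finally show ?thesis by (simp add: algebra_simps)
    qed
    then show ?case using K by blast
  qed
qed

section \<open>Lower bound for the number of visits\<close>

lemma good_H_pow: "good x \<Longrightarrow> good ((H ^^ n) x)"
  by (induction n) (auto simp: good_H)

lemma length_word [simp]: "length (word n x) = n"
  by (induction n arbitrary: x) auto

lemma word_add: "word (m + n) x = word m x @ word n ((H ^^ m) x)"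
  by (induction m arbitrary: x) (auto simp: funpow_swap1)

lemma integrable_word:
  fixes \<psi> :: "nat list \<Rightarrow> real"
  assumes "\<And>w. 0 \<le> \<psi> w" "\<And>w. \<psi> w \<le> 1"
  shows "integrable unif (\<lambda>x. \<psi> (word n x))"
  using assms by (intro unif.integrable_const_bound[where B = 1]) auto

lemma quasi_independence_real:
  fixes \<psi> :: "nat list \<Rightarrow> real"
  assumes \<psi>: "\<And>w. 0 \<le> \<psi> w" "\<And>w. \<psi> w \<le> 1" and A [measurable]: "A \<in> sets borel"
  shows "(\<integral>x. \<psi> (word n x) \<partial>unif) * measure unif A
    \<le> D * (\<integral>x. \<psi> (word n x) * indicator A ((H ^^ n) x) \<partial>unif)"
proof -
  have int: "integrable unif (\<lambda>x. \<psi> (word n x) * indicator A ((H ^^ n) x))"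
    using \<psi> by (intro unif.integrable_const_bound[where B = 1]) (auto split: split_indicator)
  have 1: "(\<integral>\<^sup>+x. ennreal 1 * ennreal (\<psi> (word n x)) \<partial>unif) = ennreal (\<integral>x. \<psi> (word n x) \<partial>unif)"
    using integrable_word[of \<psi> n, OF \<psi>] \<psi> by (simp add: nn_integral_eq_integral)
  have "(\<integral>\<^sup>+x. ennreal 1 * ennreal (\<psi> (word n x)) * indicator A ((H ^^ n) x) \<partial>unif) =
      (\<integral>\<^sup>+x. ennreal (\<psi> (word n x) * indicator A ((H ^^ n) x)) \<partial>unif)"
    by (intro nn_integral_cong) (auto split: split_indicator)
  also have "\<dots> = ennreal (\<integral>x. \<psi> (word n x) * indicator A ((H ^^ n) x) \<partial>unif)"
    using int \<psi> by (intro nn_integral_eq_integral) auto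
  finally have 2: "(\<integral>\<^sup>+x. ennreal 1 * ennreal (\<psi> (word n x)) * indicator A ((H ^^ n) x) \<partial>unif) =
    ennreal (\<integral>x. \<psi> (word n x) * indicator A ((H ^^ n) x) \<partial>unif)" .
  have 3: "(\<integral>\<^sup>+x. indicator A x \<partial>unif) = ennreal (measure unif A)"
    by (simp add: unif.emeasure_eq_measure)
  have nonneg: "0 \<le> (\<integral>x. \<psi> (word n x) \<partial>unif)" "0 \<le> (\<integral>x. \<psi> (word n x) * indicator A ((H ^^ n) x) \<partial>unif)"
    using \<psi> by (auto intro!: integral_nonneg_AE)
  show ?thesis
    using quasi_independence(1)[OF flat_1, of "indicator A :: real \<Rightarrow> ennreal" "\<lambda>w. ennreal (\<psi> w)" n]
      nonneg D_ge_1
    unfolding 1 2 3 by (simp add: ennreal_mult[symmetric] ennreal_le_iff)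
qed

text \<open>The \<open>i\<close>-th event depends on the jumps \<open>t i, ..., t (i + 1) - 1\<close> only, and given the earlier ones it
has probability at least \<open>q i / D\<close>. Hence the expectation of \<open>(1/2) ^ S N\<close>, for the number \<open>S N\<close> of
events among the first \<open>N\<close>, decays exponentially in the sum \<open>Q N\<close> of the \<open>q i\<close>, which makes it
exponentially unlikely that \<open>S N\<close> is below \<open>Q N / (4 * D)\<close>. Borel-Cantelli is applied along the first
\<open>N\<close> at which \<open>Q N\<close> exceeds an integer.\<close>

lemma AE_sampled_hits:
  fixes gap :: "nat \<Rightarrow> nat" and W :: "nat \<Rightarrow> nat list set"
  defines "t \<equiv> \<lambda>i. \<Sum>k<i. gap k"
  defines "q \<equiv> \<lambda>i. measure unif {y. word (gap i) y \<in> W i}"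
  shows "AE x in unif. \<exists>K. \<forall>N. (\<Sum>i<N. q i) / (4 * D)
    \<le> (\<Sum>i<N. of_bool (word (gap i) ((H ^^ t i) x) \<in> W i)) + (K :: real)"
proof -
  define S where "S = (\<lambda>N x. \<Sum>i<N. of_bool (word (gap i) ((H ^^ t i) x) \<in> W i) :: nat)"
  define Q where "Q = (\<lambda>N. \<Sum>i<N. q i)"
  define \<psi> where "\<psi> = (\<lambda>N w. (1/2 :: real) ^ (\<Sum>i<N. of_bool (take (gap i) (drop (t i) w) \<in> W i)))"
  have q: "0 \<le> q i" for i by (simp add: q_def)
  have t_Suc: "t (Suc i) = t i + gap i" for i by (simp add: t_def)
  have t_mono: "i \<le> j \<Longrightarrow> t i \<le> t j" for i j unfolding t_def by (intro sum_mono2) auto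
  have \<psi>_word: "\<psi> N (word (t N) x) = (1/2) ^ S N x" for N x
  proof -
    have "take (gap i) (drop (t i) (word (t N) x)) = word (gap i) ((H ^^ t i) x)" if "i < N" for i
    proof -
      have "t (Suc i) \<le> t N" using that by (intro t_mono) simp
      then obtain r where "t N = t i + (gap i + r)" by (auto simp: t_Suc le_iff_add add.assoc)
      then show ?thesis by (simp add: word_add)
    qed
    then have "(\<Sum>i<N. of_bool (take (gap i) (drop (t i) (word (t N) x)) \<in> W i) :: nat) = S N x"
      unfolding S_def by (intro sum.cong) auto
    then show ?thesis by (simp add: \<psi>_def)
  qed
  have \<psi>: "0 \<le> \<psi> N w" "\<psi> N w \<le> 1" for N w by (auto simp: \<psi>_def power_le_one)
  have S_meas [measurable]: "S N \<in> borel \<rightarrow>\<^sub>M count_space UNIV" for N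
  proof -
    have "{x. word (gap i) ((H ^^ t i) x) \<in> W i} \<in> sets borel" for i
    proof -
      have "(H ^^ t i) -` {x. word (gap i) x \<in> W i} \<inter> space borel \<in> sets borel"
        by (rule measurable_sets[OF borel_measurable_H_pow]) simp
      then show ?thesis by (simp add: vimage_def)
    qed
    then have [measurable]: "Measurable.pred borel (\<lambda>x. word (gap i) ((H ^^ t i) x) \<in> W i)" for i
      by (simp add: pred_def)
    show ?thesis unfolding S_def by measurable
  qed
  define M where "M = (\<lambda>N. \<integral>x. (1/2 :: real) ^ S N x \<partial>unif)"
  have M_le: "M N \<le> exp (- Q N / (2 * D))" for N
  proof (induction N)
    case 0
    show ?case by (simp add: M_def S_def Q_def measure_def)
  next
    case (Suc N)
    define A where "A = {y. word (gap N) y \<in> W N}"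
    have A [measurable]: "A \<in> sets borel" by (simp add: A_def)
    have int: "integrable unif (\<lambda>x. (1/2 :: real) ^ S N x)"
      using integrable_word[of "\<psi> N" "t N", OF \<psi>] by (simp add: \<psi>_word)
    have int': "integrable unif (\<lambda>x. (1/2 :: real) ^ S N x * indicator A ((H ^^ t N) x))"
      by (intro unif.integrable_const_bound[where B = 1]) (auto split: split_indicator simp: power_le_one)
    have "(1/2 :: real) ^ S (Suc N) x = (1/2) ^ S N x - 1/2 * ((1/2) ^ S N x * indicator A ((H ^^ t N) x))" for x
    proof -
      have "S (Suc N) x = S N x + of_bool (word (gap N) ((H ^^ t N) x) \<in> W N)"
        by (simp only: S_def sum.lessThan_Suc)
      then show ?thesis by (auto simp: A_def)
    qed
    then have "M (Suc N) = (\<integral>x. (1/2) ^ S N x - 1/2 * ((1/2) ^ S N x * indicator A ((H ^^ t N) x)) \<partial>unif)"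
      by (simp only: M_def)
    also have "\<dots> = M N - 1/2 * (\<integral>x. (1/2) ^ S N x * indicator A ((H ^^ t N) x) \<partial>unif)"
      using int int' by (simp add: M_def)
    also have "\<dots> \<le> M N - 1/2 * (M N * q N / D)"
    proof -
      have "M N * q N \<le> D * (\<integral>x. (1/2) ^ S N x * indicator A ((H ^^ t N) x) \<partial>unif)"
        using quasi_independence_real[of "\<psi> N" A "t N", OF \<psi> A] by (simp add: \<psi>_word M_def q_def A_def)
      then show ?thesis using D_ge_1 by (simp add: field_simps)
    qed
    also have "\<dots> = M N * (1 + (- q N / (2 * D)))" by (simp add: algebra_simps)
    also have "\<dots> \<le> M N * exp (- q N / (2 * D))"
      by (intro mult_left_mono exp_ge_add_one_self) (auto simp: M_def intro!: integral_nonneg_AE)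
    also have "\<dots> \<le> exp (- Q N / (2 * D)) * exp (- q N / (2 * D))"
      using Suc by (intro mult_right_mono) auto
    also have "\<dots> = exp (- Q (Suc N) / (2 * D))"
      by (simp add: Q_def exp_add[symmetric] add_divide_distrib diff_divide_distrib)
    finally show ?case .
  qed
  define few where "few = (\<lambda>N. {x. real (S N x) \<le> Q N / (4 * D)})"
  have few_meas [measurable]: "few N \<in> sets unif" for N unfolding few_def by measurable
  have prob_few: "measure unif (few N) \<le> exp (- Q N / (4 * D))" for N
  proof -
    define c where "c = Q N / (4 * D)"
    have c: "0 \<le> c" using q D_ge_1 by (simp add: c_def Q_def sum_nonneg)
    have pow: "exp (- c) \<le> (1/2 :: real) ^ S N x" if "x \<in> few N" for x
    proof -
      have "exp (- c) \<le> exp (- real (S N x))" using that by (simp add: few_def c_def)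
      also have "\<dots> = exp (- 1) ^ S N x" by (simp add: exp_of_nat_mult[symmetric])
      also have "\<dots> \<le> (1/2) ^ S N x"
      proof (rule power_mono)
        have "2 \<le> exp (1 :: real)" using exp_ge_add_one_self[of "1::real"] by simp
        then show "exp (- 1) \<le> (1/2 :: real)" by (simp add: exp_minus field_simps)
      qed simp
      finally show ?thesis .
    qed
    have "exp (- c) * measure unif (few N) = (\<integral>x. exp (- c) * indicator (few N) x \<partial>unif)"
      using few_meas[of N] by simp
    also have "\<dots> \<le> M N"
      unfolding M_def
    proof (rule integral_mono)
      show "integrable unif (\<lambda>x. exp (- c) * indicator (few N) x)"
        using few_meas[of N] by simp
      show "integrable unif (\<lambda>x. (1/2 :: real) ^ S N x)"
        using integrable_word[of "\<psi> N" "t N", OF \<psi>] by (simp add: \<psi>_word)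
      show "exp (- c) * indicator (few N) x \<le> (1/2) ^ S N x" for x
        using pow[of x] by (auto split: split_indicator)
    qed
    also have "\<dots> \<le> exp (- c) * exp (- c)"
      using M_le[of N] by (simp add: c_def exp_add[symmetric] field_simps)
    finally show ?thesis by (simp add: c_def)
  qed
  define Nq where "Nq = (\<lambda>m::nat. LEAST N. real m \<le> Q N)"
  \<comment> \<open>When \<open>Q\<close> never reaches \<open>m\<close>, there is no \<open>N\<close> at which anything has to be controlled.\<close>
  define bad where "bad = (\<lambda>m::nat. if \<exists>N. real m \<le> Q N then few (Nq m) else {})"
  have Nq: "real m \<le> Q (Nq m)" if "\<exists>N. real m \<le> Q N" for m
    unfolding Nq_def using that by (rule LeastI_ex)
  have "AE x in unif. \<forall>\<^sub>F m in sequentially. x \<in> space unif - bad m"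
  proof (rule borel_cantelli_AE1)
    show "bad m \<in> sets unif" for m using few_meas by (simp add: bad_def)
    show "emeasure unif (bad m) < \<infinity>" for m by (simp add: unif.emeasure_eq_measure)
    show "summable (\<lambda>m. measure unif (bad m))"
    proof (rule summable_comparison_test)
      have "norm (exp (- (1 / (4 * D)))) < (1 :: real)" using D_ge_1 by simp
      then show "summable (\<lambda>m. exp (- (1 / (4 * D))) ^ m)" by (rule summable_geometric)
      have "norm (measure unif (bad m)) \<le> exp (- (1 / (4 * D))) ^ m" for m
      proof (cases "\<exists>N. real m \<le> Q N")
        case True
        have "measure unif (bad m) \<le> exp (- Q (Nq m) / (4 * D))"
          using True prob_few by (simp add: bad_def)
        also have "\<dots> \<le> exp (- real m / (4 * D))"
          using Nq[OF True] D_ge_1 by (simp add: divide_right_mono)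
        also have "\<dots> = exp (- (1 / (4 * D))) ^ m" by (simp add: exp_of_nat_mult[symmetric])
        finally show ?thesis by simp
      qed (simp add: bad_def)
      then show "\<exists>N. \<forall>m\<ge>N. norm (measure unif (bad m)) \<le> exp (- (1 / (4 * D))) ^ m" by blast
    qed
  qed
  then show ?thesis
  proof eventually_elim
    case (elim x)
    then obtain m0 where m0: "\<And>m. m0 \<le> m \<Longrightarrow> x \<notin> bad m" by (auto simp: eventually_sequentially)
    have "Q N / (4 * D) \<le> real (S N x) + real (Suc m0) / (4 * D)" for N
    proof -
      have Q: "0 \<le> Q N" using q by (simp add: Q_def sum_nonneg)
      define m where "m = nat \<lfloor>Q N\<rfloor>"
      have m: "real m \<le> Q N" "Q N < real m + 1" using Q by (auto simp: m_def of_nat_nat)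
      show ?thesis
      proof (cases "m0 \<le> m")
        case True
        have ex: "\<exists>N. real m \<le> Q N" using m by blast
        have "Nq m \<le> N" unfolding Nq_def using m by (intro Least_le)
        then have "S (Nq m) x \<le> S N x" unfolding S_def by (intro sum_mono2) auto
        moreover have "Q (Nq m) / (4 * D) < real (S (Nq m) x)"
          using m0[OF True] ex by (simp add: bad_def few_def)
        moreover have "Q N / (4 * D) \<le> (Q (Nq m) + real (Suc m0)) / (4 * D)"
          using Nq[OF ex] m D_ge_1 by (intro divide_right_mono) auto
        ultimately show ?thesis unfolding add_divide_distrib by linarith
      next
        case False
        then have "Q N \<le> real (Suc m0)" using m by simp
        then have "Q N / (4 * D) \<le> real (Suc m0) / (4 * D)" using D_ge_1 by (intro divide_right_mono) auto
        then show ?thesis by simp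
      qed
    qed
    then show ?case by (intro exI[of _ "real (Suc m0) / (4 * D)"]) (simp add: Q_def S_def)
  qed
qed

text \<open>The event that \<open>n\<close> jumps suffice to see that a point is in \<open>I\<close>. Only points within \<open>(1/2) ^ n\<close> of an
endpoint of \<open>I\<close> are lost.\<close>

lemma word_interior:
  fixes I :: "real set"
  assumes [measurable]: "I \<in> sets borel"
    and interval: "\<And>x y z. x \<in> I \<Longrightarrow> z \<in> I \<Longrightarrow> x \<le> y \<Longrightarrow> y \<le> z \<Longrightarrow> y \<in> I"
    and bounded: "I \<subseteq> {0..1}"
  shows "measure unif I - 2 * (1/2) ^ n
    \<le> measure unif {y. word n y \<in> {w. \<forall>z. good z \<longrightarrow> word n z = w \<longrightarrow> z \<in> I}}"
proof -
  define W where "W = {w. \<forall>z. good z \<longrightarrow> word n z = w \<longrightarrow> z \<in> I}"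
  define d :: real where "d = (1/2) ^ n"
  define a b where "a = Inf I" and "b = Sup I"
  have bdd: "bdd_below I" "bdd_above I"
    using bounded by (auto intro!: bdd_belowI[of _ 0] bdd_aboveI[of _ 1])
  have cover: "x \<in> {y. word n y \<in> W} \<union> ({a..a + d} \<union> {b - d..b})" if "good x" "x \<in> I" for x
  proof (cases "word n x \<in> W")
    case False
    then obtain z where z: "good z" "word n z = word n x" "z \<notin> I" by (auto simp: W_def)
    have xz: "\<bar>x - z\<bar> \<le> d" unfolding d_def using that z by (intro word_determines) auto
    have ab: "a \<le> x" "x \<le> b" using that bdd by (auto simp: a_def b_def intro: cInf_lower cSup_upper)
    show ?thesis
    proof (cases "z < x")
      case True
      have "z \<le> a" unfolding a_def
      proof (rule cInf_greatest)
        fix y assume "y \<in> I"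
        then show "z \<le> y" using interval[of y x z] that z True by force
      qed (use that in auto)
      then show ?thesis using xz ab by auto
    next
      case False
      then have "x < z" using z that by (metis linorder_neqE_linordered_idom)
      have "b \<le> z" unfolding b_def
      proof (rule cSup_least)
        fix y assume "y \<in> I"
        then show "y \<le> z" using interval[of x y z] that z \<open>x < z\<close> by force
      qed (use that in auto)
      then show ?thesis using xz ab by auto
    qed
  qed simp
  have d: "0 \<le> d" by (simp add: d_def)
  have W [measurable]: "{y. word n y \<in> W} \<in> sets borel" by measurable
  have "measure unif I \<le> measure unif ({y. word n y \<in> W} \<union> ({a..a + d} \<union> {b - d..b}))"
  proof (rule unif.finite_measure_mono_AE)
    show "AE x in unif. x \<in> I \<longrightarrow> x \<in> {y. word n y \<in> W} \<union> ({a..a + d} \<union> {b - d..b})"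
      using AE_good by eventually_elim (use cover in blast)
  qed (use W in auto)
  also have "\<dots> \<le> measure unif {y. word n y \<in> W} + measure unif ({a..a + d} \<union> {b - d..b})"
    using W by (intro measure_Un_le) auto
  also have "measure unif ({a..a + d} \<union> {b - d..b}) \<le> measure unif {a..a + d} + measure unif {b - d..b}"
    by (intro measure_Un_le) auto
  also have "\<dots> \<le> d + d"
    using measure_unif_interval_le[of a "a + d"] measure_unif_interval_le[of "b - d" b] d by simp
  finally show ?thesis by (simp add: W_def d_def)
qed

end

lemma summable_half_power_ipow:
  assumes "0 < \<eta>"
  shows "summable (\<lambda>k. (1/2 :: real) ^ ipow (Suc k) \<eta>)"
proof (rule summable_comparison_test)
  have "summable (\<lambda>j. exp (- ln 2 * real j powr \<eta>))"
    using assms by (intro summable_exp_minus_powr) auto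
  then have "summable (\<lambda>k. exp (- ln 2 * real (Suc k) powr \<eta>))"
    by (subst summable_Suc_iff)
  then show "summable (\<lambda>k. 2 * exp (- ln 2 * real (Suc k) powr \<eta>))"
    by (rule summable_mult)
  have "norm ((1/2 :: real) ^ ipow (Suc k) \<eta>) \<le> 2 * exp (- ln 2 * real (Suc k) powr \<eta>)" for k
  proof -
    have "real (Suc k) powr \<eta> \<le> real (ipow (Suc k) \<eta>) + 1"
      unfolding ipow_def by (simp add: of_nat_nat)
    then have "ln 2 * real (Suc k) powr \<eta> \<le> ln 2 * (real (ipow (Suc k) \<eta>) + 1)"
      by (intro mult_left_mono) auto
    then have "exp (- (ln 2 * (real (ipow (Suc k) \<eta>) + 1))) \<le> exp (- ln 2 * real (Suc k) powr \<eta>)"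
      by simp
    also have "exp (- (ln 2 * (real (ipow (Suc k) \<eta>) + 1))) = (1/2) powr (real (ipow (Suc k) \<eta>) + 1)"
      by (simp add: powr_def ln_div algebra_simps)
    also have "\<dots> = (1/2) ^ ipow (Suc k) \<eta> / 2"
      by (simp add: powr_add powr_realpow)
    finally show ?thesis by simp
  qed
  then show "\<exists>N. \<forall>k\<ge>N. norm ((1/2 :: real) ^ ipow (Suc k) \<eta>) \<le> 2 * exp (- ln 2 * real (Suc k) powr \<eta>)"
    by blast
qed

context shrinking_target
begin

text \<open>Hits of \<open>H\<close> on an interval do not depend on finitely many jumps. They are therefore sampled at the
sparse times \<open>t i\<close>, and the interval is replaced by the part that the jumps before the next sampling
time determine. With gaps of length \<open>i powr \<eta>'\<close> the total loss of measure is finite, while \<open>t i\<close> is at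
most \<open>i powr (1 + \<eta>')\<close>, which for small \<open>\<eta>'\<close> keeps the \<open>i\<close>-th sample before time \<open>i powr s\<close>.\<close>

lemma AE_visits_lower:
  assumes s: "\<alpha> < s"
  shows "AE x in unif. \<exists>c K. 0 < c \<and> (\<forall>n. c * powsum \<beta> s n \<le> visits n x + K)"
proof -
  define s' where "s' = (\<alpha> + s) / 2"
  define \<eta>' where "\<eta>' = (s / s' - 1) / 2"
  have s': "\<alpha> < s'" "s' < s" "0 < s'" using s alpha by (auto simp: s'_def)
  have \<eta>': "0 < \<eta>'" "(1 + \<eta>') * s' < s"
  proof -
    show "0 < \<eta>'" using s' by (simp add: \<eta>'_def)
    have "(1 + \<eta>') * s' = (s + s') / 2" using s' by (simp add: \<eta>'_def field_simps)
    then show "(1 + \<eta>') * s' < s" using s' by simp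
  qed
  define gap where "gap = (\<lambda>k. ipow (Suc k) \<eta>')"
  define t where "t = (\<lambda>i. \<Sum>k<i. gap k)"
  define u where "u = (\<lambda>i. ipow (Suc i) s)"
  define W where "W = (\<lambda>i. {w. \<forall>z. good z \<longrightarrow> word (gap i) z = w \<longrightarrow> z \<in> B (u i)})"
  define q where "q = (\<lambda>i. measure unif {y. word (gap i) y \<in> W i})"
  have gap_pos: "1 \<le> gap k" for k
    unfolding gap_def le_ipow_iff using \<eta>' by (simp add: ge_one_powr_ge_zero)
  have t_mono: "strict_mono t"
    unfolding t_def using gap_pos by (intro strict_monoI_Suc) (simp add: less_le_trans[of 0 1])
  have t_le: "real (t i) \<le> real i powr (1 + \<eta>')" for i
  proof (cases "i = 0")
    case False
    have "real (t i) = (\<Sum>k<i. real (gap k))" by (simp add: t_def)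
    also have "\<dots> \<le> (\<Sum>k<i. real i powr \<eta>')"
    proof (rule sum_mono)
      fix k assume "k \<in> {..<i}"
      then have "real (Suc k) powr \<eta>' \<le> real i powr \<eta>'" using \<eta>' by (intro powr_mono2) auto
      then show "real (gap k) \<le> real i powr \<eta>'"
        using real_ipow_le[of "Suc k" \<eta>'] by (simp add: gap_def)
    qed
    also have "\<dots> = real i powr (1 + \<eta>')" using False by (simp add: powr_add)
    finally show ?thesis .
  qed (simp add: t_def)
  define L where "L = (\<Sum>k. (1/2 :: real) ^ gap k)"
  have sum_half: "(\<Sum>i<N. (1/2 :: real) ^ gap i) \<le> L" for N
    unfolding L_def gap_def using \<eta>' by (intro sum_le_suminf summable_half_power_ipow) auto
  obtain C0 where C0: "0 < C0" "\<And>n. \<beta> n \<le> C0 * measure unif (B n)" using nu_B_le by blast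
  have q_ge: "powsum \<beta> s n / C0 - 2 * L \<le> (\<Sum>i<ipow n (1 / s). q i)" for n
  proof -
    have "\<beta> (u i) / C0 - 2 * (1/2) ^ gap i \<le> q i" for i
    proof -
      have "\<beta> (u i) / C0 \<le> measure unif (B (u i))"
        using C0(1) C0(2)[of "u i"] by (simp add: field_simps)
      moreover have "measure unif (B (u i)) - 2 * (1/2) ^ gap i \<le> q i"
        unfolding q_def W_def
      proof (rule word_interior)
        show "B (u i) \<subseteq> {0..1}" using B_sub[of "u i"] delta by auto
      qed (auto intro: interval_B)
      ultimately show ?thesis by linarith
    qed
    then have "(\<Sum>i<ipow n (1 / s). \<beta> (u i) / C0 - 2 * (1/2) ^ gap i) \<le> (\<Sum>i<ipow n (1 / s). q i)"
      by (intro sum_mono)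
    moreover have "(\<Sum>i<ipow n (1 / s). \<beta> (u i) / C0 - 2 * (1/2) ^ gap i) =
        powsum \<beta> s n / C0 - 2 * (\<Sum>i<ipow n (1 / s). (1/2) ^ gap i)"
      by (simp add: sum_subtractf powsum_def u_def sum_divide_distrib sum_distrib_left)
    ultimately show ?thesis using sum_half[of "ipow n (1 / s)"] by linarith
  qed
  show ?thesis
    using AE_sampled_hits[of gap W] AE_tau_upper[OF s'(1)] AE_good
  proof eventually_elim
    case (elim x)
    define hit where "hit = (\<lambda>i. word (gap i) ((H ^^ t i) x) \<in> W i)"
    obtain K where K: "\<And>N. (\<Sum>i<N. q i) / (4 * D) \<le> (\<Sum>i<N. of_bool (hit i)) + K"
      using elim(1) by (auto simp: q_def t_def hit_def)
    obtain C where C: "0 \<le> C" "\<And>j. real (\<tau> j x) \<le> C * real j powr s'" using elim(2) by blast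
    have "((\<lambda>i::real. C * (i powr ((1 + \<eta>') * s')) / i powr s) \<longlongrightarrow> 0) at_top"
    proof -
      have "((\<lambda>i::real. i powr ((1 + \<eta>') * s') / i powr s) \<longlongrightarrow> 0) at_top"
        using \<eta>'(2) by real_asymp
      then have "((\<lambda>i::real. C * (i powr ((1 + \<eta>') * s') / i powr s)) \<longlongrightarrow> C * 0) at_top"
        by (rule tendsto_mult_left)
      then show ?thesis by simp
    qed
    then have "\<forall>\<^sub>F i in at_top. C * (i powr ((1 + \<eta>') * s')) / i powr s < 1"
      by (rule order_tendstoD) simp
    then have "\<forall>\<^sub>F i in sequentially. C * (real i powr ((1 + \<eta>') * s')) / real i powr s < 1"
      using filterlim_real_sequentially by (rule eventually_compose_filterlim)
    then obtain i1 where i1: "\<And>i. i1 \<le> i \<Longrightarrow> C * (real i powr ((1 + \<eta>') * s')) / real i powr s < 1"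
      by (auto simp: eventually_sequentially)
    define i0 where "i0 = Suc i1"
    have tau_le: "\<tau> (t i) x \<le> u i" if "i0 \<le> i" for i
    proof -
      have i: "1 \<le> i" "i1 \<le> i" using that by (auto simp: i0_def)
      have "real (\<tau> (t i) x) \<le> C * real (t i) powr s'" by (rule C)
      also have "\<dots> \<le> C * (real i powr (1 + \<eta>')) powr s'"
        using C(1) s' t_le[of i] by (intro mult_left_mono powr_mono2) auto
      also have "\<dots> \<le> real i powr s"
        using i1[OF i(2)] i C(1) by (simp add: powr_powr field_simps)
      also have "\<dots> \<le> real (Suc i) powr s"
        using s alpha by (intro powr_mono2) auto
      finally show ?thesis by (simp add: u_def le_ipow_iff)
    qed
    have inj: "inj_on (\<lambda>i. \<tau> (t i) x) A" for A
      using strict_mono_compose[OF strict_mono_tau[of x] t_mono] by (simp add: strict_mono_imp_inj_on o_def inj_on_subset[of _ UNIV])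
    have hits: "(\<Sum>i<ipow n (1 / s). of_bool (hit i)) \<le> visits n x + real i0" for n
    proof -
      define N where "N = ipow n (1 / s)"
      have "(\<Sum>i<N. of_bool (hit i) :: real) \<le> (\<Sum>i\<in>{..<i0} \<union> {i0..<N}. of_bool (hit i))"
        by (intro sum_mono2) auto
      also have "\<dots> = (\<Sum>i<i0. of_bool (hit i)) + (\<Sum>i\<in>{i0..<N}. of_bool (hit i))"
        by (rule sum.union_disjoint) auto
      also have "(\<Sum>i<i0. of_bool (hit i) :: real) \<le> (\<Sum>i<i0. 1)" by (intro sum_mono) auto
      also have "(\<Sum>i\<in>{i0..<N}. of_bool (hit i) :: real)
          \<le> (\<Sum>i\<in>{i0..<N}. indicator (B (\<tau> (t i) x)) ((f ^^ \<tau> (t i) x) x))"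
      proof (rule sum_mono)
        fix i assume i: "i \<in> {i0..<N}"
        show "of_bool (hit i) \<le> (indicator (B (\<tau> (t i) x)) ((f ^^ \<tau> (t i) x) x) :: real)"
        proof (cases "hit i")
          case True
          have "good ((H ^^ t i) x)" using elim(3) by (rule good_H_pow)
          then have "(H ^^ t i) x \<in> B (u i)" using True by (auto simp: hit_def W_def)
          also have "B (u i) \<subseteq> B (\<tau> (t i) x)" using i by (intro antimono_B tau_le) simp
          finally show ?thesis by (simp add: f_pow_tau)
        qed simp
      qed
      also have "\<dots> = (\<Sum>k\<in>(\<lambda>i. \<tau> (t i) x) ` {i0..<N}. indicator (B k) ((f ^^ k) x))"
        using inj by (subst sum.reindex) (auto simp: o_def)
      also have "\<dots> \<le> visits n x"
        unfolding visits_def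
      proof (rule sum_mono2)
        show "(\<lambda>i. \<tau> (t i) x) ` {i0..<N} \<subseteq> {1..n}"
        proof safe
          fix i assume i: "i \<in> {i0..<N}"
          have "i \<le> \<tau> (t i) x"
            using strict_mono_imp_increasing[OF strict_mono_tau, of "t i" x]
              strict_mono_imp_increasing[OF t_mono, of i] by simp
          moreover have "real (Suc i) powr s \<le> real n"
            using i s alpha by (intro ipow_le_of_le_root) (auto simp: N_def)
          then have "real (u i) \<le> real n" using real_ipow_le[of "Suc i" s] by (simp add: u_def)
          ultimately show "\<tau> (t i) x \<in> {1..n}"
            using tau_le[of i] i by (auto simp: i0_def)
        qed
      qed auto
      finally show ?thesis by (simp add: N_def)
    qed
    have "1 / (4 * D * C0) * powsum \<beta> s n \<le> visits n x + (real i0 + K + 2 * L / (4 * D))" for n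
    proof -
      have "(powsum \<beta> s n / C0 - 2 * L) / (4 * D) \<le> (\<Sum>i<ipow n (1 / s). q i) / (4 * D)"
        using q_ge[of n] D_ge_1 by (intro divide_right_mono) auto
      also have "\<dots> \<le> visits n x + real i0 + K"
        using K[of "ipow n (1 / s)"] hits[of n] by linarith
      finally show ?thesis by (simp add: diff_divide_distrib mult_ac)
    qed
    moreover have "0 < 1 / (4 * D * C0)" using D_ge_1 C0 by simp
    ultimately show ?case by blast
  qed
qed

end

section \<open>Balls on the circle and the given measure\<close>

text \<open>A ball in the arc-length metric can be a union of two intervals of \<open>[0, 1)\<close>, but only by wrapping
around \<open>0\<close>.\<close>

lemma circle_ball_avoiding_0:
  assumes "circle_ball A" "0 \<notin> A"
  shows "A \<in> sets borel"
    and "\<And>x y z. x \<in> A \<Longrightarrow> z \<in> A \<Longrightarrow> x \<le> y \<Longrightarrow> y \<le> z \<Longrightarrow> y \<in> A"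
proof -
  obtain c r where c: "c \<in> circle" "0 < r"
    and A: "A = circle.mball c r \<or> A = circle.mcball c r"
    using assms(1) unfolding circle_ball_def by blast
  have c01: "0 \<le> c" "c < 1" using c by (auto simp: circle_def)
  have zero: "0 \<in> circle" by (simp add: circle_def)
  have dist: "circle_dist c y = min \<bar>c - y\<bar> (1 - \<bar>c - y\<bar>)" if "y \<in> circle" for y
    using circle_dist_altdef[OF c(1) that] .
  have "A = {y. 0 \<le> y \<and> y < 1 \<and> \<bar>c - y\<bar> < r} \<or> A = {y. 0 \<le> y \<and> y < 1 \<and> \<bar>c - y\<bar> \<le> r}"
    using A
  proof
    assume A: "A = circle.mball c r"
    then have "\<not> circle_dist c 0 < r" using assms(2) c(1) zero by simp
    then have "r \<le> c" "r \<le> 1 - c" using dist[OF zero] c01 by auto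
    then have "y \<in> A \<longleftrightarrow> 0 \<le> y \<and> y < 1 \<and> \<bar>c - y\<bar> < r" for y
      using c(1) c01 unfolding A circle.in_mball by (cases "y \<in> circle") (auto simp: dist circle_def min_def)
    then show ?thesis by blast
  next
    assume A: "A = circle.mcball c r"
    then have "\<not> circle_dist c 0 \<le> r" using assms(2) c(1) zero by simp
    then have "r < c" "r < 1 - c" using dist[OF zero] c01 by auto
    then have "y \<in> A \<longleftrightarrow> 0 \<le> y \<and> y < 1 \<and> \<bar>c - y\<bar> \<le> r" for y
      using c(1) c01 unfolding A circle.in_mcball by (cases "y \<in> circle") (auto simp: dist circle_def min_def)
    then show ?thesis by blast
  qed
  then show "A \<in> sets borel" "\<And>x y z. x \<in> A \<Longrightarrow> z \<in> A \<Longrightarrow> x \<le> y \<Longrightarrow> y \<le> z \<Longrightarrow> y \<in> A"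
    by (elim disjE; force)+
qed

text \<open>The distance of \<open>y\<close> from \<open>0\<close> on the circle is at most \<open>y\<close>.\<close>

lemma not_in_circle_closure:
  assumes "A \<subseteq> circle" "0 \<notin> circle.mtopology closure_of A"
  obtains e where "0 < e" "A \<subseteq> {e..<1}"
proof -
  have zero: "0 \<in> circle" by (simp add: circle_def)
  obtain e where e: "0 < e" "\<And>y. y \<in> A \<Longrightarrow> y \<notin> circle.mball 0 e"
    using assms(2) zero unfolding circle.metric_closure_of by blast
  have "y \<in> {e..<1}" if "y \<in> A" for y
  proof -
    have y: "y \<in> circle" using that assms(1) by auto
    then have "e \<le> circle_dist 0 y" using e(2)[OF that] zero by auto
    also have "\<dots> \<le> y" using circle_dist_altdef[OF zero y] y by (auto simp: circle_def)
    finally show ?thesis using y by (simp add: circle_def)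
  qed
  then show ?thesis using e(1) that by blast
qed

lemma circle_ball_subset: "circle_ball A \<Longrightarrow> A \<subseteq> circle"
  unfolding circle_ball_def by auto

lemma borel_circle [measurable, simp]: "circle \<in> sets borel"
  by (simp add: circle_def)

context
  fixes T :: "real \<Rightarrow> real" and \<mu> :: "real measure"
  assumes acim: "infinite_acim T \<mu>"
begin

lemma acim_sets: "sets \<mu> = sets (restrict_space borel circle)"
  using acim by (simp add: infinite_acim_def)

lemma acim_sets_iff: "A \<in> sets \<mu> \<longleftrightarrow> A \<in> sets borel \<and> A \<subseteq> circle"
  unfolding acim_sets by (subst sets_restrict_space_iff) auto

lemma acim_space: "space \<mu> = circle"
  using sets_eq_imp_space_eq[OF acim_sets] by (simp add: space_restrict_space)

lemma acim_measurable_id: "(\<lambda>x. x) \<in> measurable \<mu> borel"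
  by (rule measurableI) (auto simp: acim_sets_iff acim_space vimage_def Int_def[symmetric] intro: sets.Int)

lemma acim_emeasure_extend:
  assumes "A \<in> sets borel"
  shows "emeasure (distr \<mu> borel (\<lambda>x. x)) A = emeasure \<mu> (A \<inter> circle)"
  using emeasure_distr[OF acim_measurable_id assms] by (simp add: acim_space)

lemma acim_null:
  assumes A: "A \<in> sets borel" "emeasure unif A = 0"
  shows "A \<inter> circle \<in> null_sets \<mu>"
proof -
  have "emeasure lborel (A \<inter> circle) \<le> emeasure lborel ((A \<inter> {0<..<1}) \<union> {0})"
    using A by (intro emeasure_mono) (auto simp: circle_def)
  also have "\<dots> \<le> emeasure lborel (A \<inter> {0<..<1}) + emeasure lborel {0 :: real}"
    using A by (intro emeasure_subadditive) auto
  also have "\<dots> = 0" using A by (simp add: emeasure_unif)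
  finally have "emeasure (restrict_space lborel circle) (A \<inter> circle) = 0"
    by (subst emeasure_restrict_space) auto
  then have "A \<inter> circle \<in> null_sets (restrict_space lborel circle)"
    using A by (auto simp: null_sets_def sets_restrict_space_iff)
  then show ?thesis using acim unfolding infinite_acim_def absolutely_continuous_def by blast
qed

lemma acim_AE:
  assumes "AE x in unif. P x"
  shows "AE x in \<mu>. P x"
proof -
  obtain N where N: "{x. \<not> P x} \<subseteq> N" "N \<in> sets borel" "emeasure unif N = 0"
    using assms by (auto simp: eventually_ae_filter null_sets_def)
  then show ?thesis
    by (intro AE_I'[OF acim_null[OF N(2,3)]]) (auto simp: acim_space)
qed

end

text \<open>To extend a \<open>\<sigma>\<close>-finite cover from the circle to \<open>\<real>\<close>, the null complement of the circle is added to
each of its members.\<close>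

lemma (in intermittent) invariant_extension:
  assumes acim: "infinite_acim (intermittent_map \<alpha>) \<mu>"
  shows "intermittent_invariant \<alpha> (distr \<mu> borel (\<lambda>x. x))"
proof (intro intermittent_invariant.intro intermittent_axioms intermittent_invariant_axioms.intro)
  let ?\<nu> = "distr \<mu> borel (\<lambda>x. x)"
  note ext = acim_emeasure_extend[OF acim] and sets = acim_sets_iff[OF acim] and space = acim_space[OF acim]
  show "sets ?\<nu> = sets borel" by simp
  show "emeasure ?\<nu> (f -` A) = emeasure ?\<nu> A" if A: "A \<in> sets borel" for A
  proof -
    have fA: "f -` A \<in> sets borel" using measurable_sets_borel[OF borel_measurable_f, of A] A by simp
    have f: "f x \<in> circle" if "x \<in> circle" for x
    proof -
      have "f \<in> measurable \<mu> \<mu>" using acim by (simp add: infinite_acim_def)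
      then show ?thesis using that measurable_space[of f \<mu> \<mu> x] by (simp add: space)
    qed
    have "emeasure ?\<nu> (f -` A) = emeasure \<mu> (f -` A \<inter> circle)" by (rule ext[OF fA])
    also have "f -` A \<inter> circle = f -` (A \<inter> circle) \<inter> space \<mu>" using f by (auto simp: space)
    also have "emeasure \<mu> \<dots> = emeasure \<mu> (A \<inter> circle)"
    proof -
      have "A \<inter> circle \<in> sets \<mu>" unfolding sets using A by auto
      then show ?thesis using acim unfolding infinite_acim_def by blast
    qed
    also have "\<dots> = emeasure ?\<nu> A" using ext[OF A] by simp
    finally show ?thesis .
  qed
  show "emeasure ?\<nu> A = 0" if "A \<in> sets borel" "emeasure unif A = 0" for A
    using acim_null[OF acim that] ext[OF that(1)] by (simp add: null_sets_def)
  show "emeasure ?\<nu> UNIV \<noteq> 0"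
    using acim ext[of UNIV] by (simp add: infinite_acim_def space)
  show "sigma_finite_measure ?\<nu>"
  proof
    interpret sigma_finite_measure \<mu> using acim by (simp add: infinite_acim_def)
    obtain A :: "nat \<Rightarrow> real set" where A: "range A \<subseteq> sets \<mu>" "(\<Union>i. A i) = space \<mu>"
      "\<And>i. emeasure \<mu> (A i) \<noteq> \<infinity>" using sigma_finite by metis
    have Ai: "A i \<in> sets borel" "A i \<subseteq> circle" for i using A(1) sets[of "A i"] by auto
    show "\<exists>\<A>. countable \<A> \<and> \<A> \<subseteq> sets ?\<nu> \<and> \<Union>\<A> = Sigma_Algebra.space ?\<nu> \<and>
        (\<forall>a\<in>\<A>. emeasure ?\<nu> a \<noteq> \<infinity>)"
    proof (intro exI[of _ "range (\<lambda>i. A i \<union> - circle)"] conjI)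
      show "\<Union> (range (\<lambda>i. A i \<union> - circle)) = Sigma_Algebra.space ?\<nu>"
        using A(2) by (auto simp: space)
      show "\<forall>a\<in>range (\<lambda>i. A i \<union> - circle). emeasure ?\<nu> a \<noteq> \<infinity>"
      proof safe
        fix i assume "emeasure ?\<nu> (A i \<union> - circle) = \<infinity>"
        moreover have "(A i \<union> - circle) \<inter> circle = A i" using Ai by auto
        ultimately show False using ext[of "A i \<union> - circle"] Ai A(3)[of i] by simp
      qed
    qed (use Ai in auto)
  qed
qed

section \<open>The two bounds for all exponents\<close>

text \<open>The first balls may contain \<open>0\<close> and have infinite measure. Replacing them by a later ball changes
the sums and the counts by a bounded amount.\<close>

lemma partial_sums_finite_change:
  fixes a b :: "nat \<Rightarrow> real"
  assumes "\<And>k. k0 \<le> k \<Longrightarrow> a k = b k"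
  shows "\<exists>K. \<forall>N. (\<Sum>k=1..N. a k) \<le> (\<Sum>k=1..N. b k) + K"
proof (intro exI allI)
  fix N
  have "(\<Sum>k=1..N. a k - b k) \<le> (\<Sum>k=1..N. if k < k0 then \<bar>a k - b k\<bar> else 0)"
    using assms by (intro sum_mono) (auto simp: not_less)
  also have "\<dots> = (\<Sum>k\<in>{1..N} \<inter> {..<k0}. \<bar>a k - b k\<bar>)"
    by (subst sum.inter_restrict) (auto intro!: sum.cong)
  also have "\<dots> \<le> (\<Sum>k<k0. \<bar>a k - b k\<bar>)" by (intro sum_mono2) auto
  finally show "(\<Sum>k=1..N. a k) \<le> (\<Sum>k=1..N. b k) + (\<Sum>k<k0. \<bar>a k - b k\<bar>)"
    by (simp add: sum_subtractf)
qed

lemma eventually_ipow_ge: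
  assumes "0 < s"
  shows "\<forall>\<^sub>F n in sequentially. m \<le> ipow n s"
proof -
  have "filterlim (\<lambda>n. real n powr s) at_top sequentially"
    using assms by real_asymp
  then have "\<forall>\<^sub>F n in sequentially. real m \<le> real n powr s"
    by (simp add: filterlim_at_top)
  then show ?thesis by (simp add: le_ipow_iff)
qed

text \<open>\<open>powsum_ratio\<close> with a factor larger than \<open>C + 1\<close>; the surplus absorbs the additive constants because
the sum for \<open>s\<close> diverges.\<close>

lemma powsum_dominates:
  assumes b: "antimono b" "\<And>k. 0 \<le> b k" and s: "0 < s'" "s' < s"
    and div: "filterlim (powsum b s) at_top sequentially"
  shows "\<forall>\<^sub>F n in sequentially. C * powsum b s n + K \<le> powsum b s' n"
proof -
  obtain m :: nat where m: "C + 1 \<le> real m" using real_arch_simple by blast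
  obtain K1 where K1: "\<And>n. real m * powsum b s n \<le> powsum b s' n + K1"
    using powsum_ratio[OF b s, of m] by blast
  have "\<forall>\<^sub>F n in sequentially. K + K1 \<le> powsum b s n"
    using div by (simp add: filterlim_at_top)
  then show ?thesis
  proof eventually_elim
    case (elim n)
    have "(C + 1) * powsum b s n \<le> real m * powsum b s n"
      using m b by (intro mult_right_mono powsum_nonneg) auto
    then show ?case using K1[of n] elim by (simp add: algebra_simps)
  qed
qed

theorem corollary2p26:
  fixes \<alpha> \<epsilon>\<^sub>1 :: real and \<mu> :: "real measure" and B :: "nat \<Rightarrow> real set"
  assumes "\<alpha> \<ge> 1"
    and "infinite_acim (intermittent_map \<alpha>) \<mu>"
    and "\<And>n. n \<ge> 1 \<Longrightarrow> circle_ball (B n)"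
    and "\<And>n. n \<ge> 1 \<Longrightarrow> B (Suc n) \<subseteq> B n"
    and "0 < \<epsilon>\<^sub>1" and "\<epsilon>\<^sub>1 < \<alpha>"
    and "filterlim (\<lambda>N. \<Sum>n=1..N. measure \<mu> (B (ipow n (\<alpha> + \<epsilon>\<^sub>1)))) at_top sequentially"
    and "0 \<notin> (\<Inter>n\<in>{1..}. circle.mtopology closure_of B n)"
  shows "AE x in \<mu>. \<forall>\<epsilon>\<in>{0<..\<epsilon>\<^sub>1}. \<forall>\<^sub>F n in sequentially.
           (\<Sum>k=1..ipow n (1 / (\<alpha> + \<epsilon>)). measure \<mu> (B (ipow k (\<alpha> + \<epsilon>))))
             \<le> (\<Sum>k=1..n. indicator (B k) ((intermittent_map \<alpha> ^^ k) x)) \<and>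
           (\<Sum>k=1..n. indicator (B k) ((intermittent_map \<alpha> ^^ k) x))
             \<le> (\<Sum>k=1..ipow n (1 / (\<alpha> - \<epsilon>)). measure \<mu> (B (ipow k (\<alpha> - \<epsilon>))))"
proof -
  obtain n0 where n0: "1 \<le> n0" "0 \<notin> circle.mtopology closure_of B n0" using assms(8) by auto
  obtain \<delta> where \<delta>: "0 < \<delta>" "B n0 \<subseteq> {\<delta>..<1}"
    using not_in_circle_closure[OF circle_ball_subset[OF assms(3)[OF n0(1)]] n0(2)] by blast
  have anti: "B n \<subseteq> B m" if "1 \<le> m" "m \<le> n" for m n
    using that(2)
  proof (induction rule: dec_induct)
    case (step k)
    then show ?case using assms(4)[of k] that(1) by auto
  qed simp
  \<comment> \<open>From \<open>n0\<close> on the balls stay away from \<open>0\<close>; the earlier ones are replaced by \<open>B n0\<close>.\<close>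
  define B' where "B' = (\<lambda>n. B (max n n0))"
  have B': "B' n \<subseteq> {\<delta>..<1}" "circle_ball (B' n)" for n
    using anti[of n0 "max n n0"] n0 \<delta>(2) assms(3)[of "max n n0"] by (auto simp: B'_def)
  then have "0 \<notin> B' n" for n using \<delta>(1) by force
  note ball = circle_ball_avoiding_0[OF B'(2) this]
  define \<nu> where "\<nu> = distr \<mu> borel (\<lambda>x. x)"
  interpret intermittent \<alpha> by standard (rule assms)
  interpret intermittent_invariant \<alpha> \<nu>
    unfolding \<nu>_def by (rule invariant_extension[OF assms(2)])
  interpret shrinking_target \<alpha> \<nu> B' \<delta>
  proof
    show "B' n \<subseteq> B' m" if "m \<le> n" for m n
      using that n0 unfolding B'_def by (intro anti) auto
    show "B' n \<in> sets borel" for n by (rule ball)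
    show "y \<in> B' n" if "x \<in> B' n" "z \<in> B' n" "x \<le> y" "y \<le> z" for n x y z
      using that by (rule ball(2))
    show "0 < \<delta>" "B' n \<subseteq> {\<delta>..<1}" for n by (rule \<delta>, rule B')
  qed
  have beta_eq: "\<beta> n = measure \<mu> (B n)" if "n0 \<le> n" for n
  proof -
    have "B' n \<inter> circle = B' n" using circle_ball_subset[OF B'(2)[of n]] by auto
    then have "emeasure \<nu> (B' n) = emeasure \<mu> (B' n)"
      unfolding \<nu>_def using acim_emeasure_extend[OF assms(2) ball(1)[of n]] by simp
    moreover have "B' n = B n" using that by (simp add: B'_def max_def)
    ultimately show ?thesis by (simp add: \<beta>_def measure_def)
  qed
  define Tsum where "Tsum = (\<lambda>s n. \<Sum>k=1..ipow n (1 / s). measure \<mu> (B (ipow k s)))"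
  define count where "count = (\<lambda>n x. \<Sum>k=1..n. indicator (B k) ((f ^^ k) x) :: real)"
  have large: "\<exists>k0. \<forall>k\<ge>k0. n0 \<le> ipow k s" if "0 < s" for s
    using eventually_ipow_ge[OF that, of n0] by (simp add: eventually_sequentially)
  have T_le: "\<exists>K. \<forall>n. Tsum s n \<le> powsum \<beta> s n + K" if s_pos: "0 < s" for s
  proof -
    obtain k0 where k0: "\<And>k. k0 \<le> k \<Longrightarrow> n0 \<le> ipow k s" using large[OF s_pos] by blast
    have "\<exists>K. \<forall>N. (\<Sum>k=1..N. measure \<mu> (B (ipow k s))) \<le> (\<Sum>k=1..N. \<beta> (ipow k s)) + K"
      by (rule partial_sums_finite_change[of k0]) (simp add: beta_eq k0)
    then show ?thesis unfolding Tsum_def powsum_altdef by blast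
  qed
  have le_T: "\<exists>K. \<forall>n. powsum \<beta> s n \<le> Tsum s n + K" if s_pos: "0 < s" for s
  proof -
    obtain k0 where k0: "\<And>k. k0 \<le> k \<Longrightarrow> n0 \<le> ipow k s" using large[OF s_pos] by blast
    have "\<exists>K. \<forall>N. (\<Sum>k=1..N. \<beta> (ipow k s)) \<le> (\<Sum>k=1..N. measure \<mu> (B (ipow k s))) + K"
      by (rule partial_sums_finite_change[of k0]) (simp add: beta_eq k0)
    then show ?thesis unfolding Tsum_def powsum_altdef by blast
  qed
  have B_eq: "B' k = B k" if "n0 \<le> k" for k using that by (simp add: B'_def max_def)
  have count_le: "\<exists>K. \<forall>n. count n x \<le> visits n x + K" for x
    unfolding count_def visits_def
    by (rule partial_sums_finite_change[of n0]) (simp add: B_eq)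
  have visits_le: "\<exists>K. \<forall>n. visits n x \<le> count n x + K" for x
    unfolding count_def visits_def
    by (rule partial_sums_finite_change[of n0]) (simp add: B_eq)
  define s1 where "s1 = \<alpha> + \<epsilon>\<^sub>1"
  have s1: "0 < s1" using assms by (simp add: s1_def)
  have div1: "filterlim (powsum \<beta> s1) at_top sequentially"
  proof -
    obtain k0 where k0: "\<And>k. k0 \<le> k \<Longrightarrow> n0 \<le> ipow k s1" using large[OF s1] by blast
    obtain K where K: "\<And>n. Tsum s1 n \<le> powsum \<beta> s1 n + K" using T_le[OF s1] by blast
    have "filterlim (\<lambda>n. ipow n (1 / s1)) sequentially sequentially"
      using eventually_ipow_ge[of "1 / s1"] s1 by (simp add: filterlim_at_top)
    from filterlim_compose[OF assms(7) this]
    have "filterlim (Tsum s1) at_top sequentially" by (simp add: Tsum_def s1_def)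
    then have "filterlim (\<lambda>n. - K + Tsum s1 n) at_top sequentially"
      by (intro filterlim_tendsto_add_at_top[OF tendsto_const])
    then show ?thesis
      by (rule filterlim_at_top_mono) (use K in \<open>auto intro!: always_eventually simp: algebra_simps\<close>)
  qed
  have div: "filterlim (powsum \<beta> s) at_top sequentially" if "0 < s" "s \<le> s1" for s
  proof (cases "s = s1")
    case False
    then show ?thesis
      using powsum_dominates[OF antimono_beta beta_nonneg that(1) _ div1, of 1 0] that
      by (intro filterlim_at_top_mono[OF div1]) auto
  qed (use div1 in simp)
  \<comment> \<open>One null set must serve all \<open>\<epsilon>\<close>, so the bounds are collected for the rational exponents.\<close>
  have upper: "AE x in unif. \<forall>r::rat. 0 < (of_rat r :: real) \<and> of_rat r < \<alpha> \<longrightarrow>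
      (\<exists>C. 0 \<le> C \<and> (\<forall>n. visits n x \<le> C * (1 + powsum \<beta> (of_rat r) n)))"
    unfolding AE_all_countable
  proof
    fix r :: rat
    show "AE x in unif. 0 < (of_rat r :: real) \<and> of_rat r < \<alpha> \<longrightarrow>
        (\<exists>C. 0 \<le> C \<and> (\<forall>n. visits n x \<le> C * (1 + powsum \<beta> (of_rat r) n)))"
    proof (cases "0 < (of_rat r :: real) \<and> of_rat r < \<alpha>")
      case True
      then show ?thesis using AE_visits_upper[of "of_rat r"] by simp
    qed auto
  qed
  have lower: "AE x in unif. \<forall>r::rat. \<alpha> < of_rat r \<longrightarrow>
      (\<exists>c K. 0 < c \<and> (\<forall>n. c * powsum \<beta> (of_rat r) n \<le> visits n x + K))"
    unfolding AE_all_countable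
  proof
    fix r :: rat
    show "AE x in unif. \<alpha> < of_rat r \<longrightarrow>
        (\<exists>c K. 0 < c \<and> (\<forall>n. c * powsum \<beta> (of_rat r) n \<le> visits n x + K))"
    proof (cases "\<alpha> < of_rat r")
      case True
      then show ?thesis using AE_visits_lower[of "of_rat r"] by simp
    qed auto
  qed
  from eventually_conj[OF upper lower]
  have "AE x in \<mu>. (\<forall>r::rat. 0 < (of_rat r :: real) \<and> of_rat r < \<alpha> \<longrightarrow>
      (\<exists>C. 0 \<le> C \<and> (\<forall>n. visits n x \<le> C * (1 + powsum \<beta> (of_rat r) n)))) \<and>
    (\<forall>r::rat. \<alpha> < of_rat r \<longrightarrow>
      (\<exists>c K. 0 < c \<and> (\<forall>n. c * powsum \<beta> (of_rat r) n \<le> visits n x + K)))"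
    by (rule acim_AE[OF assms(2)])
  then have "AE x in \<mu>. \<forall>\<epsilon>\<in>{0<..\<epsilon>\<^sub>1}. \<forall>\<^sub>F n in sequentially.
      Tsum (\<alpha> + \<epsilon>) n \<le> count n x \<and> count n x \<le> Tsum (\<alpha> - \<epsilon>) n"
  proof eventually_elim
    case (elim x)
    show ?case
    proof
      fix \<epsilon> assume \<epsilon>: "\<epsilon> \<in> {0<..\<epsilon>\<^sub>1}"
      \<comment> \<open>Rational exponents strictly between \<open>\<alpha> \<mp> \<epsilon>\<close> and \<open>\<alpha>\<close> lose constant factors, which the passage to \<open>\<alpha> \<mp> \<epsilon>\<close> regains.\<close>
      obtain r where r: "\<alpha> - \<epsilon> < of_rat r" "of_rat r < \<alpha>" using of_rat_dense[of "\<alpha> - \<epsilon>" \<alpha>] \<epsilon> by auto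
      obtain R where R: "\<alpha> < of_rat R" "of_rat R < \<alpha> + \<epsilon>" using of_rat_dense[of \<alpha> "\<alpha> + \<epsilon>"] \<epsilon> by auto
      have pos: "0 < \<alpha> - \<epsilon>" "0 < \<alpha> + \<epsilon>" "0 < (of_rat r :: real)" "0 < (of_rat R :: real)"
        using \<epsilon> assms(1,6) r R by (simp_all only: greaterThanAtMost_iff) linarith+
      obtain C where C: "0 \<le> C" "\<And>n. visits n x \<le> C * (1 + powsum \<beta> (of_rat r) n)"
        using elim r pos by blast
      obtain c K where c: "0 < c" "\<And>n. c * powsum \<beta> (of_rat R) n \<le> visits n x + K"
        using elim R by blast
      obtain K1 where K1: "\<And>n. Tsum (\<alpha> + \<epsilon>) n \<le> powsum \<beta> (\<alpha> + \<epsilon>) n + K1" using T_le[OF pos(2)] by blast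
      obtain K2 where K2: "\<And>n. powsum \<beta> (\<alpha> - \<epsilon>) n \<le> Tsum (\<alpha> - \<epsilon>) n + K2" using le_T[OF pos(1)] by blast
      obtain K3 where K3: "\<And>n. count n x \<le> visits n x + K3" using count_le by blast
      obtain K4 where K4: "\<And>n. visits n x \<le> count n x + K4" using visits_le by blast
      have "\<forall>\<^sub>F n in sequentially. 1 / c * powsum \<beta> (\<alpha> + \<epsilon>) n + (K + K1 + K4) / c \<le> powsum \<beta> (of_rat R) n"
        using R pos \<epsilon> by (intro powsum_dominates[OF antimono_beta beta_nonneg] div) (auto simp: s1_def)
      moreover have "\<forall>\<^sub>F n in sequentially. C * powsum \<beta> (of_rat r) n + (C + K2 + K3) \<le> powsum \<beta> (\<alpha> - \<epsilon>) n"
        using r pos \<epsilon> by (intro powsum_dominates[OF antimono_beta beta_nonneg] div) (auto simp: s1_def)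
      ultimately show "\<forall>\<^sub>F n in sequentially. Tsum (\<alpha> + \<epsilon>) n \<le> count n x \<and> count n x \<le> Tsum (\<alpha> - \<epsilon>) n"
      proof eventually_elim
        case (elim n)
        have "powsum \<beta> (\<alpha> + \<epsilon>) n + (K + K1 + K4) \<le> c * powsum \<beta> (of_rat R) n"
        proof -
          have "c * (1 / c * powsum \<beta> (\<alpha> + \<epsilon>) n + (K + K1 + K4) / c) \<le> c * powsum \<beta> (of_rat R) n"
            using elim(1) c(1) by (intro mult_left_mono) auto
          moreover have "c * (1 / c * p + k / c) = p + k" for p k
            using c(1) by (simp add: distrib_left)
          ultimately show ?thesis by simp
        qed
        then have "Tsum (\<alpha> + \<epsilon>) n \<le> count n x" using c(2)[of n] K1[of n] K4[of n] by linarith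
        moreover have "count n x \<le> Tsum (\<alpha> - \<epsilon>) n"
          using elim(2) C(2)[of n] K2[of n] K3[of n] by (simp add: algebra_simps)
        ultimately show ?case ..
      qed
    qed
  qed
  then show ?thesis by (simp only: Tsum_def count_def)
qed

end
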